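(* Let $n\ge1$. For each of the following spherical bipartite-regular hypermaps $\mathcal{K}$, the closure cover $\mathcal{K}^{\Delta}$ (up to isomorphism), the type, number of flags $|\Omega|$ and genus of the covering core $\mathcal{K}_{\Delta}$, the irregularity index $\iota$ and the irregularity group $\Upsilon$ (up to isomorphism) of $\mathcal{K}$ are as listed: $$\begin{array}{l|l|l|l|l|l|l} \mathcal{K} & \mathcal{K}^{\Delta} & \text{type of }\mathcal{K}_\Delta & |\Omega|\text{ of }\mathcal{K}_\Delta & \text{genus of }\mathcal{K}_\Delta & \iota & \Upsilon\\ \hline \mathrm{Pin}(\mathcal{D}_{(0\,2)}(\mathcal{D}_n)) & \mathcal{D}_{(0\,2)}(\mathcal{D}_{2n}) & (1;2n;2n) & 4n & 0 & 1 & 1\\ \mathrm{Pin}(\mathcal{P}_n),\ n\text{ even} & \mathcal{D}_{(0\,2)}(\mathcal{D}_4) & (2;4;2n) & 8n^2 & \frac{(n-1)^2+1}{2} & n & D_{n/2}\\ \mathrm{Pin}(\mathcal{P}_n),\ n\text{ odd} & \mathcal{D}_{(0\,2)}(\mathcal{D}_2) & (2;4;2n) & 16n^2 & (n-1)^2 & 2n & D_n\\ \mathrm{Pin}(\mathcal{D}_{(0\,1)}(\mathcal{T})) & \mathcal{D}_{(0\,2)}(\mathcal{D}_6) & (2;6;6) & 192 & 9 & 4 & V_4\\ \mathrm{Pin}(\mathcal{D}_{(0\,1)}(\mathcal{C})) & \mathcal{D}_{(0\,2)}(\mathcal{D}_2) & (2;6;8) & 2304 & 121 & 24 & S_4\\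 \mathrm{Pin}(\mathcal{D}_{(0\,1)}(\mathcal{D})) & \mathcal{D}_{(0\,2)}(\mathcal{D}_2) & (2;6;10) & 14400 & 841 & 60 & A_5\\ \mathrm{Pin}(\mathcal{T}) & \mathcal{D}_{(0\,2)}(\mathcal{D}_2) & (3;4;6) & 576 & 37 & 12 & A_4\\ \mathrm{Pin}(\mathcal{C}) & \mathcal{D}_{(0\,2)}(\mathcal{D}_4) & (3;4;8) & 1152 & 85 & 12 & A_4\\ \mathrm{Pin}(\mathcal{D}) & \mathcal{D}_{(0\,2)}(\mathcal{D}_2) & (3;4;10) & 14400 & 1141 & 60 & A_5\\ \mathrm{Pin}(\mathcal{D}_{(0\,2)}(\mathcal{C})) & \mathcal{D}_{(0\,2)}(\mathcal{D}_2) & (4;4;6) & 2304 & 193 & 24 & S_4\\ \mathrm{Pin}(\mathcal{D}_{(0\,2)}(\mathcal{D})) & \mathcal{D}_{(0\,2)}(\mathcal{D}_2) & (5;4;6) & 14400 & 1381 & 60 & A_5\\ \mathrm{Pin}(\mathcal{D}_{(1\,2)}(\mathcal{D}_n)) & \mathcal{D}_{(0\,2)}(\mathcal{D}_2) & (n;2;2n) & 4n^2 & \frac{(n-1)(n-2)}{2} & n & C_n\\ \mathrm{Pin}(\mathcal{D}_{(0\,2)}(\mathcal{P}_n)) & \mathcal{D}_{(0\,2)}(\mathcal{D}_4) & (n;4;4) & 8n^2 & (n-1)^2 & n & C_n\\ \mathrm{Wal}(\mathcal{P}_n) & \mathcal{P}_{2n} & (2;2;2n) & 8n & 0 & 1 &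 1\\ \mathrm{Wal}(\mathcal{T}) & \mathcal{D}_{(0\,2)}(\mathcal{D}_2) & (6;2;6) & 576 & 25 & 12 & A_4\\ \mathrm{Wal}(\mathcal{C}) & \mathcal{D}_{(0\,2)}(\mathcal{D}_2) & (6;2;8) & 2304 & 121 & 24 & S_4\\ \mathrm{Wal}(\mathcal{D}) & \mathcal{D}_{(0\,2)}(\mathcal{D}_2) & (6;2;10) & 14400 & 841 & 60 & A_5\\ \mathrm{Wal}(\mathcal{D}_{(0\,2)}(\mathcal{C})) & \mathcal{P}_6 & (4;2;6) & 384 & 9 & 4 & V_4\\ \mathrm{Wal}(\mathcal{D}_{(0\,2)}(\mathcal{D})) & \mathcal{D}_{(0\,2)}(\mathcal{D}_2) & (10;2;6) & 14400 & 841 & 60 & A_5\\ \mathrm{Wal}(\mathcal{D}_{(0\,2)}(\mathcal{P}_n)),\ n\text{ even} & \mathcal{P}_4 & (n;2;4) & 4n^2 & \frac{(n-2)^2}{4} & \frac n2 & C_{n/2}\\ \mathrm{Wal}(\mathcal{D}_{(0\,2)}(\mathcal{P}_n)),\ n\text{ odd} & \mathcal{D}_{(0\,2)}(\mathcal{D}_2) & (2n;2;4) & 16n^2 & (n-1)^2 & 2n & D_n\\ \mathrm{Wal}(\mathcal{D}_{(1\,2)}(\mathcal{T})) & \mathcal{C} & (3;2;4) & 48 & 0 & 1 & 1\\ \mathrm{Wal}(\mathcal{D}_{(1\,2)}(\mathcal{C})) & \mathcal{D}_{(0\,2)}(\mathcal{D}_2) & (12;2;4) & 2304 & 97 & 24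 & S_4\\ \mathrm{Wal}(\mathcal{D}_{(1\,2)}(\mathcal{D})) & \mathcal{D}_{(0\,2)}(\mathcal{D}_2) & (15;2;4) & 14400 & 661 & 60 & A_5\\ \mathrm{Wal}(\mathcal{D}_n) & \mathcal{D}_{(0\,2)}(\mathcal{P}_n) & (n;2;2) & 4n & 0 & 1 & 1 \end{array}$$ When $\iota=1$, i.e. $\mathcal{K}$ is regular, $\mathcal{K}_\Delta\cong\mathcal{K}^\Delta\cong\mathcal{K}$. Here $C_k$ is cyclic of order $k$, $D_k$ is dihedral of order $2k$ (with $D_1=C_2$), and $V_4=C_2\times C_2$.
   Context: A hypermap is a tuple $\mathcal{H}=(\Omega;h_0,h_1,h_2)$, where $\Omega$ is a non-empty finite set (of flags) and $h_0,h_1,h_2$ are fixed-point-free involutory permutations of $\Omega$ (acting on the right) generating a group transitive on $\Omega$. For $\{i,j,k\}=\{0,1,2\}$ the $k$-faces are the $\langle h_i,h_j\rangle$-orbits; $0$-, $1$-, $2$-faces are called hypervertices, hyperedges, hyperfaces. The valency of a $k$-face is half its cardinality. $\mathcal{H}$ is uniform of type $(l;m;n)$ if all hypervertices have valency $l$, all hyperedges $m$, all hyperfaces $n$. An isomorphism is a bijection of flags commuting with the respective $h_0,h_1,h_2$. With $V,E,F$ the numbers of hypervertices, hyperedges, hyperfaces, the Euler characteristic is $V+E+F-|\Omega|/2$; spherical means it equals $2$, and the genus $g$ of an orientable hypermap is defined by Euler characteristic $=2-2g$. Let $\Delta=\langle R_0,R_1,R_2\mid R_0^2=R_1^2=R_2^2=1\rangle$.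 It acts on $\Omega$ by $R_i\mapsto h_i$; the stabiliser $H$ in $\Delta$ of a flag is a hypermap subgroup of $\mathcal{H}$ (unique up to conjugation), and $\mathcal{H}$ is isomorphic to the set of right cosets $\Delta/_r H$ with $R_0,R_1,R_2$ acting by right multiplication. $\mathcal{H}$ is regular if $H\lhd\Delta$ (regular hypermaps are uniform), and orientable if $H\le\langle R_1R_2,R_2R_0\rangle$. Write $x^g=g^{-1}xg$. $\Delta^{\hat 0}$ is the normal closure of $\{R_1,R_2\}$ in $\Delta$; it has index $2$ and is the free product of the order-two groups generated by $R_1,R_2,R_1^{R_0},R_2^{R_0}$. A hypermap $\mathcal{K}$ with hypermap subgroup $K$ is bipartite if $K\le\Delta^{\hat 0}$, and bipartite-regular if moreover $K\lhd\Delta^{\hat 0}$. For bipartite-regular $\mathcal{K}$: let $K^\Delta$ be the normal closure and $K_\Delta$ the core of $K$ in $\Delta$. The closure cover $\mathcal{K}^\Delta$ and the covering core $\mathcal{K}_\Delta$ are the regular hypermaps with hypermap subgroups $K^\Delta$ and $K_\Delta$ (so $\mathcal{K}^\Delta$ is the largest regular hypermap covered by $\mathcal{K}$ and $\mathcal{K}_\Delta$ the smallest regular hypermap covering $\mathcal{K}$). The irregularity group is $\Upsilon=K^\Delta/K\cong K/K_\Delta$ and the irregularity index is $\iota=|\Upsilon|$. $\mathrm{Wal}(\mathcal{H})$ and $\mathrm{Pin}(\mathcal{H})$ are the hypermaps with hypermap subgroups $H\varphi_W^{-1}$ and $H\varphi_P^{-1}$ (full preimages), where $\varphi_W,\varphi_P:\Delta^{\hat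 0}\to\Delta$ are the epimorphisms given by $R_1\varphi_W=R_1$, $R_2\varphi_W=R_2$, $R_1^{R_0}\varphi_W=R_0$, $R_2^{R_0}\varphi_W=R_2$; $R_1\varphi_P=R_1$, $R_2\varphi_P=R_2$, $R_1^{R_0}\varphi_P=R_0$, $R_2^{R_0}\varphi_P=R_0$. For a permutation $\sigma$ of $\{0,1,2\}$, $\mathcal{D}_\sigma(\mathcal{H})$ is the hypermap with hypermap subgroup $H\sigma^{\circ}$, where $\sigma^\circ\in\mathrm{Aut}(\Delta)$, $R_i\mapsto R_{i\sigma}$; the $k$-faces of $\mathcal{H}$ are the $k\sigma$-faces of $\mathcal{D}_\sigma(\mathcal{H})$. $\mathcal{T},\mathcal{C},\mathcal{D}$ (tetrahedron, cube, dodecahedron) denote the unique (up to isomorphism) uniform spherical hypermaps of types $(3;2;3)$, $(3;2;4)$, $(3;2;5)$. For $n\ge1$, $\mathcal{D}_n$ and $\mathcal{P}_n$ denote the unique (up to isomorphism) uniform spherical hypermaps of types $(n;n;1)$ and $(2;2;n)$, with $2n$ and $4n$ flags respectively. *)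

theory Defs
  imports Complex_Main "HOL-Algebra.Sym_Groups" "HOL-Algebra.Elementary_Groups"
begin

section \<open>The group \<open>\<Delta>\<close>\<close>

datatype idx = I0 | I1 | I2

text \<open>
  \<open>\<Delta> = \<langle>R\<^sub>0, R\<^sub>1, R\<^sub>2 | R\<^sub>0\<^sup>2 = R\<^sub>1\<^sup>2 = R\<^sub>2\<^sup>2 = 1\<rangle>\<close> is realised by normal forms: words without two
  equal adjacent letters, multiplied by concatenation followed by cancellation.
  The lemmas \<open>group_Delta\<close>, \<open>Delta_universal\<close> and \<open>Delta_universal_unique\<close> establish that this
  is the group with the above presentation.
\<close>

fun push :: "idx \<Rightarrow> idx list \<Rightarrow> idx list" where
  "push x [] = [x]"
| "push x (y # w) = (if x = y then w else x # y # w)"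

definition Delta :: "idx list monoid" where
  "Delta = \<lparr>carrier = {w. distinct_adj w}, mult = (\<lambda>u v. foldr push u v), one = []\<rparr>"

definition Rgen :: "idx \<Rightarrow> idx list" where
  "Rgen i = [i]"

lemma push_reduced: "distinct_adj w \<Longrightarrow> distinct_adj (push x w)"
  by (cases w rule: list.exhaust) (auto simp: distinct_adj_Cons)

lemma push_push: "distinct_adj w \<Longrightarrow> push x (push x w) = w"
  by (cases w; cases "tl w") (auto simp: distinct_adj_Cons)

lemma foldr_push_reduced: "distinct_adj v \<Longrightarrow> distinct_adj (foldr push u v)"
  by (induction u) (auto intro: push_reduced)

lemma foldr_push_push:
  "distinct_adj v \<Longrightarrow> foldr push (push x w) v = push x (foldr push w v)"
  by (cases w) (auto simp: push_push foldr_push_reduced)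

lemma foldr_push_assoc:
  "distinct_adj v \<Longrightarrow> foldr push (foldr push u w) v = foldr push u (foldr push w v)"
  by (induction u) (auto simp: foldr_push_push)

lemma foldr_push_Nil: "distinct_adj w \<Longrightarrow> foldr push w [] = w"
proof (induction w)
  case (Cons x w)
  then show ?case by (cases w) (auto simp: distinct_adj_Cons)
qed simp

lemma foldr_push_rev: "distinct_adj v \<Longrightarrow> foldr push (rev u) (foldr push u v) = v"
  by (induction u arbitrary: v) (auto simp: push_push foldr_push_reduced)

lemma group_Delta: "group Delta"
proof (rule groupI)
  fix w assume "w \<in> carrier Delta"
  then show "\<exists>v\<in>carrier Delta. v \<otimes>\<^bsub>Delta\<^esub> w = \<one>\<^bsub>Delta\<^esub>"
    using foldr_push_rev[of "[]" w]
    by (intro bexI[of _ "rev w"]) (auto simp: Delta_def foldr_push_Nil)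
qed (auto simp: Delta_def foldr_push_reduced foldr_push_assoc)

lemma Rgen_carrier: "Rgen i \<in> carrier Delta"
  and Rgen_square: "Rgen i \<otimes>\<^bsub>Delta\<^esub> Rgen i = \<one>\<^bsub>Delta\<^esub>"
  by (auto simp: Delta_def Rgen_def)

lemma Delta_universal:
  assumes "group G" and f: "\<And>i. f i \<in> carrier G" "\<And>i. f i \<otimes>\<^bsub>G\<^esub> f i = \<one>\<^bsub>G\<^esub>"
  shows "\<exists>h\<in>hom Delta G. \<forall>i. h (Rgen i) = f i"
proof
  interpret group G by fact
  define h where "h w = foldr (\<lambda>i x. f i \<otimes>\<^bsub>G\<^esub> x) w \<one>\<^bsub>G\<^esub>" for w
  have h_simps: "h [] = \<one>\<^bsub>G\<^esub>" "h (i # w) = f i \<otimes>\<^bsub>G\<^esub> h w" for i w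
    by (auto simp: h_def)
  have h_carrier: "h w \<in> carrier G" for w
    by (induction w) (auto simp: h_simps f)
  have h_push: "h (push i w) = f i \<otimes>\<^bsub>G\<^esub> h w" for i w
    by (cases w) (auto simp: h_simps h_carrier f m_assoc[symmetric])
  have "h (foldr push u v) = h u \<otimes>\<^bsub>G\<^esub> h v" for u v
    by (induction u) (auto simp: h_simps h_push h_carrier f m_assoc)
  then show "h \<in> hom Delta G"
    by (auto simp: hom_def Delta_def h_carrier)
  show "\<forall>i. h (Rgen i) = f i"
    by (auto simp: Rgen_def h_simps f)
qed

lemma Delta_universal_unique:
  assumes "group G" "h \<in> hom Delta G" "h' \<in> hom Delta G" "\<And>i. h (Rgen i) = h' (Rgen i)"
    and "w \<in> carrier Delta"
  shows "h w = h' w"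
proof -
  interpret h: group_hom Delta G h
    using assms group_Delta by (simp add: group_hom_def group_hom_axioms_def)
  interpret h': group_hom Delta G h'
    using assms group_Delta by (simp add: group_hom_def group_hom_axioms_def)
  have "distinct_adj w \<Longrightarrow> h w = h' w" for w
  proof (induction w)
    case Nil
    then show ?case using h.hom_one h'.hom_one by (simp add: Delta_def)
  next
    case (Cons x w)
    then have w: "w \<in> carrier Delta" and "h w = h' w"
      by (auto simp: Delta_def dest: distinct_adj_ConsD)
    moreover have "x # w = Rgen x \<otimes>\<^bsub>Delta\<^esub> w"
      using Cons.prems by (cases w) (auto simp: Delta_def Rgen_def)
    ultimately show ?case
      using assms(4) by (simp add: Rgen_carrier)
  qed
  then show ?thesis using assms(5) by (simp add: Delta_def)
qed


section \<open>Conjugation, normal closure, core\<close>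

definition conjg :: "('a, 'b) monoid_scheme \<Rightarrow> 'a \<Rightarrow> 'a \<Rightarrow> 'a" where
  "conjg G x g = inv\<^bsub>G\<^esub> g \<otimes>\<^bsub>G\<^esub> x \<otimes>\<^bsub>G\<^esub> g"

definition normal_closure :: "('a, 'b) monoid_scheme \<Rightarrow> 'a set \<Rightarrow> 'a set" where
  "normal_closure G S = \<Inter> {N. N \<lhd> G \<and> S \<subseteq> N}"

definition normal_core :: "('a, 'b) monoid_scheme \<Rightarrow> 'a set \<Rightarrow> 'a set" where
  "normal_core G K = (\<Inter>g\<in>carrier G. (\<lambda>x. conjg G x g) ` K)"


section \<open>Hypermaps\<close>

record 'a hypermap =
  flags :: "'a set"
  perm :: "idx \<Rightarrow> 'a \<Rightarrow> 'a"

text \<open>The right action of a word: the leftmost letter acts first.\<close>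

definition act :: "'a hypermap \<Rightarrow> idx list \<Rightarrow> 'a \<Rightarrow> 'a" where
  "act \<H> w \<omega> = fold (perm \<H>) w \<omega>"

definition hypermap :: "'a hypermap \<Rightarrow> bool" where
  "hypermap \<H> \<longleftrightarrow>
     finite (flags \<H>) \<and> flags \<H> \<noteq> {} \<and>
     (\<forall>i. \<forall>\<omega>\<in>flags \<H>. perm \<H> i \<omega> \<in> flags \<H> \<and> perm \<H> i (perm \<H> i \<omega>) = \<omega> \<and> perm \<H> i \<omega> \<noteq> \<omega>) \<and>
     (\<forall>\<omega>\<in>flags \<H>. \<forall>\<omega>'\<in>flags \<H>. \<exists>w\<in>carrier Delta. act \<H> w \<omega> = \<omega>')"

definition hypermap_iso :: "'a hypermap \<Rightarrow> 'b hypermap \<Rightarrow> bool" where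
  "hypermap_iso \<H> \<G> \<longleftrightarrow>
     (\<exists>f. bij_betw f (flags \<H>) (flags \<G>) \<and>
          (\<forall>i. \<forall>\<omega>\<in>flags \<H>. f (perm \<H> i \<omega>) = perm \<G> i (f \<omega>)))"

definition faces :: "'a hypermap \<Rightarrow> idx \<Rightarrow> 'a set set" where
  "faces \<H> k =
     (\<lambda>\<omega>. (\<lambda>w. act \<H> w \<omega>) ` generate Delta {Rgen i | i. i \<noteq> k}) ` flags \<H>"

definition valency :: "'a set \<Rightarrow> nat" where
  "valency face = card face div 2"

definition uniform :: "'a hypermap \<Rightarrow> nat \<Rightarrow> nat \<Rightarrow> nat \<Rightarrow> bool" where
  "uniform \<H> l m n \<longleftrightarrow>
     (\<forall>v\<in>faces \<H> I0. valency v = l) \<and>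
     (\<forall>e\<in>faces \<H> I1. valency e = m) \<and>
     (\<forall>f\<in>faces \<H> I2. valency f = n)"

definition euler_char :: "'a hypermap \<Rightarrow> int" where
  "euler_char \<H> =
     int (card (faces \<H> I0)) + int (card (faces \<H> I1)) + int (card (faces \<H> I2))
       - int (card (flags \<H>)) div 2"

definition spherical :: "'a hypermap \<Rightarrow> bool" where
  "spherical \<H> \<longleftrightarrow> euler_char \<H> = 2"

definition genus :: "'a hypermap \<Rightarrow> rat" where
  "genus \<H> = (2 - of_int (euler_char \<H>)) / 2"


section \<open>Hypermap subgroups\<close>

definition flag_stabiliser :: "'a hypermap \<Rightarrow> 'a \<Rightarrow> idx list set" where
  "flag_stabiliser \<H> \<omega> = {w \<in> carrier Delta. act \<H> w \<omega> = \<omega>}"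

text \<open>A hypermap subgroup is determined up to conjugacy only; we fix one choice.\<close>

definition hsub :: "'a hypermap \<Rightarrow> idx list set" where
  "hsub \<H> = flag_stabiliser \<H> (SOME \<omega>. \<omega> \<in> flags \<H>)"

definition coset_hypermap :: "idx list set \<Rightarrow> idx list set hypermap" where
  "coset_hypermap H = \<lparr>flags = rcosets\<^bsub>Delta\<^esub> H, perm = (\<lambda>i C. C #>\<^bsub>Delta\<^esub> Rgen i)\<rparr>"

definition regular :: "'a hypermap \<Rightarrow> bool" where
  "regular \<H> \<longleftrightarrow> hsub \<H> \<lhd> Delta"

definition orientable :: "'a hypermap \<Rightarrow> bool" where
  "orientable \<H> \<longleftrightarrow>
     hsub \<H> \<subseteq> generate Delta {Rgen I1 \<otimes>\<^bsub>Delta\<^esub> Rgen I2, Rgen I2 \<otimes>\<^bsub>Delta\<^esub> Rgen I0}"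

definition Delta0 :: "idx list set" where
  "Delta0 = normal_closure Delta {Rgen I1, Rgen I2}"

definition bipartite :: "'a hypermap \<Rightarrow> bool" where
  "bipartite \<K> \<longleftrightarrow> hsub \<K> \<subseteq> Delta0"

definition bipartite_regular :: "'a hypermap \<Rightarrow> bool" where
  "bipartite_regular \<K> \<longleftrightarrow> bipartite \<K> \<and> hsub \<K> \<lhd> Delta\<lparr>carrier := Delta0\<rparr>"

definition closure_cover :: "'a hypermap \<Rightarrow> idx list set hypermap" where
  "closure_cover \<K> = coset_hypermap (normal_closure Delta (hsub \<K>))"

definition covering_core :: "'a hypermap \<Rightarrow> idx list set hypermap" where
  "covering_core \<K> = coset_hypermap (normal_core Delta (hsub \<K>))"

definition irregularity_group :: "'a hypermap \<Rightarrow> idx list set monoid" where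
  "irregularity_group \<K> = Delta\<lparr>carrier := normal_closure Delta (hsub \<K>)\<rparr> Mod hsub \<K>"

definition irregularity_index :: "'a hypermap \<Rightarrow> nat" where
  "irregularity_index \<K> = order (irregularity_group \<K>)"


section \<open>The operations \<open>Wal\<close>, \<open>Pin\<close> and \<open>D\<^sub>\<sigma>\<close>\<close>

text \<open>
  The homomorphism from \<open>Delta0\<close> to \<open>\<Delta>\<close> sending \<open>R\<^sub>1\<close>, \<open>R\<^sub>2\<close> to themselves and
  \<open>R\<^sub>1\<close>, \<open>R\<^sub>2\<close> conjugated by \<open>R\<^sub>0\<close> to \<open>a\<close>, \<open>b\<close>. It is unique on \<open>Delta0\<close>, as \<open>Delta0\<close>
  is generated by these four elements.
\<close>

definition is_phi :: "idx list \<Rightarrow> idx list \<Rightarrow> (idx list \<Rightarrow> idx list) \<Rightarrow> bool" where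
  "is_phi a b \<phi> \<longleftrightarrow>
     \<phi> \<in> hom (Delta\<lparr>carrier := Delta0\<rparr>) Delta \<and>
     \<phi> (Rgen I1) = Rgen I1 \<and> \<phi> (Rgen I2) = Rgen I2 \<and>
     \<phi> (conjg Delta (Rgen I1) (Rgen I0)) = a \<and> \<phi> (conjg Delta (Rgen I2) (Rgen I0)) = b"

text \<open>Existence: \<open>hat a b p w\<close> reads \<open>w\<close> from the left, \<open>p\<close> being the parity of the number of
  letters \<open>I0\<close> already read.\<close>

fun hat :: "idx list \<Rightarrow> idx list \<Rightarrow> bool \<Rightarrow> idx list \<Rightarrow> idx list" where
  "hat a b p [] = \<one>\<^bsub>Delta\<^esub>"
| "hat a b p (I0 # w) = hat a b (\<not> p) w"
| "hat a b p (I1 # w) = (if p then a else Rgen I1) \<otimes>\<^bsub>Delta\<^esub> hat a b p w"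
| "hat a b p (I2 # w) = (if p then b else Rgen I2) \<otimes>\<^bsub>Delta\<^esub> hat a b p w"

definition odd0 :: "idx list \<Rightarrow> bool" where
  "odd0 w \<longleftrightarrow> odd (count_list w I0)"

lemma odd0_push: "odd0 (push x w) \<longleftrightarrow> (odd0 w \<noteq> (x = I0))"
  by (cases w) (auto simp: odd0_def)

lemma odd0_foldr: "odd0 (foldr push u v) \<longleftrightarrow> (odd0 u \<noteq> odd0 v)"
  by (induction u) (auto simp: odd0_push, auto simp: odd0_def)

lemma Delta0_even:
  assumes "w \<in> Delta0"
  shows "w \<in> carrier Delta" "\<not> odd0 w"
proof -
  interpret group Delta by (rule group_Delta)
  let ?E = "{w \<in> carrier Delta. \<not> odd0 w}"
  have mult: "odd0 (u \<otimes>\<^bsub>Delta\<^esub> v) \<longleftrightarrow> (odd0 u \<noteq> odd0 v)" for u v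
    by (simp add: Delta_def odd0_foldr)
  have one: "\<not> odd0 \<one>\<^bsub>Delta\<^esub>"
    by (simp add: Delta_def odd0_def)
  have inv: "odd0 (inv\<^bsub>Delta\<^esub> u) \<longleftrightarrow> odd0 u" if "u \<in> carrier Delta" for u
    using mult[of "inv\<^bsub>Delta\<^esub> u" u] one that by simp
  have "subgroup ?E Delta"
    by (rule subgroupI) (use one in \<open>auto simp: mult inv\<close>)
  then have "?E \<lhd> Delta"
    by (auto simp: normal_inv_iff mult inv)
  moreover have "{Rgen I1, Rgen I2} \<subseteq> ?E"
    by (auto simp: Rgen_carrier) (auto simp: Rgen_def odd0_def)
  ultimately have "Delta0 \<subseteq> ?E"
    by (auto simp: Delta0_def normal_closure_def)
  then show "w \<in> carrier Delta" "\<not> odd0 w"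
    using assms by auto
qed

lemma is_phi_exists:
  assumes "a \<in> carrier Delta" "a \<otimes>\<^bsub>Delta\<^esub> a = \<one>\<^bsub>Delta\<^esub>"
    and "b \<in> carrier Delta" "b \<otimes>\<^bsub>Delta\<^esub> b = \<one>\<^bsub>Delta\<^esub>"
  shows "\<exists>\<phi>. is_phi a b \<phi>"
proof -
  interpret group Delta by (rule group_Delta)
  have carr: "hat a b p w \<in> carrier Delta" for p w
  proof (induction w arbitrary: p)
    case (Cons x w)
    then show ?case
      by (cases x) (use assms in \<open>auto simp: Rgen_carrier\<close>)
  qed simp
  have cancel: "c \<otimes>\<^bsub>Delta\<^esub> (c \<otimes>\<^bsub>Delta\<^esub> x) = x"
    if "c \<otimes>\<^bsub>Delta\<^esub> c = \<one>\<^bsub>Delta\<^esub>" "c \<in> carrier Delta" "x \<in> carrier Delta" for c x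
    using that by (simp add: m_assoc[symmetric])
  have push: "hat a b p (push x w) = hat a b p (x # w)" for p x w
    by (cases w; cases x) (use assms in \<open>auto simp: cancel Rgen_carrier Rgen_square carr\<close>)
  have hom: "hat a b p (foldr push u v) = hat a b p u \<otimes>\<^bsub>Delta\<^esub> hat a b (p \<noteq> odd0 u) v" for p u v
  proof (induction u arbitrary: p)
    case Nil
    then show ?case by (simp add: odd0_def carr)
  next
    case (Cons x u)
    then show ?case
      by (cases x; cases p; cases "odd0 u")
        (use assms in \<open>auto simp: push m_assoc carr Rgen_carrier odd0_def\<close>)
  qed
  have inv0: "inv\<^bsub>Delta\<^esub> (Rgen i) = Rgen i" for i
    by (simp add: Rgen_carrier Rgen_square inv_equality)
  have "is_phi a b (hat a b False)"
    unfolding is_phi_def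
  proof (intro conjI)
    show "hat a b False \<in> hom (Delta\<lparr>carrier := Delta0\<rparr>) Delta"
      using hom[of False] by (auto simp: hom_def carr dest: Delta0_even) (auto simp: Delta_def Delta0_even)
    show "hat a b False (Rgen I1) = Rgen I1" "hat a b False (Rgen I2) = Rgen I2"
      using Rgen_carrier by (auto simp: Rgen_def)
    show "hat a b False (conjg Delta (Rgen I1) (Rgen I0)) = a"
      "hat a b False (conjg Delta (Rgen I2) (Rgen I0)) = b"
      using assms unfolding conjg_def inv0 by (simp_all add: Rgen_def Delta_def foldr_push_Nil)
  qed
  then show ?thesis by blast
qed

definition phi_W :: "idx list \<Rightarrow> idx list" where
  "phi_W = (SOME \<phi>. is_phi (Rgen I0) (Rgen I2) \<phi>)"

definition phi_P :: "idx list \<Rightarrow> idx list" where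
  "phi_P = (SOME \<phi>. is_phi (Rgen I0) (Rgen I0) \<phi>)"

definition Wal :: "'a hypermap \<Rightarrow> idx list set hypermap" where
  "Wal \<H> = coset_hypermap {w \<in> Delta0. phi_W w \<in> hsub \<H>}"

definition Pin :: "'a hypermap \<Rightarrow> idx list set hypermap" where
  "Pin \<H> = coset_hypermap {w \<in> Delta0. phi_P w \<in> hsub \<H>}"

text \<open>On words, the automorphism \<open>R\<^sub>i \<mapsto> R\<^bsub>\<sigma> i\<^esub>\<close> of \<open>\<Delta>\<close> is \<open>map \<sigma>\<close>.\<close>

definition Dop :: "(idx \<Rightarrow> idx) \<Rightarrow> 'a hypermap \<Rightarrow> idx list set hypermap" where
  "Dop \<sigma> \<H> = coset_hypermap (map \<sigma> ` hsub \<H>)"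

abbreviation D01 :: "'a hypermap \<Rightarrow> idx list set hypermap" where
  "D01 \<equiv> Dop (Transposition.transpose I0 I1)"

abbreviation D02 :: "'a hypermap \<Rightarrow> idx list set hypermap" where
  "D02 \<equiv> Dop (Transposition.transpose I0 I2)"

abbreviation D12 :: "'a hypermap \<Rightarrow> idx list set hypermap" where
  "D12 \<equiv> Dop (Transposition.transpose I1 I2)"


section \<open>The spherical hypermaps and groups in the table\<close>

text \<open>
  For the types used below a uniform spherical hypermap exists and is unique up to isomorphism;
  being finite, it has a copy with natural numbers as flags.
\<close>

definition uniform_spherical :: "nat \<Rightarrow> nat \<Rightarrow> nat \<Rightarrow> nat hypermap" where
  "uniform_spherical l m n = (SOME \<H>. hypermap \<H> \<and> spherical \<H> \<and> uniform \<H> l m n)"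

definition Tetrahedron :: "nat hypermap" where
  "Tetrahedron = uniform_spherical 3 2 3"

definition Cube :: "nat hypermap" where
  "Cube = uniform_spherical 3 2 4"

definition Dodecahedron :: "nat hypermap" where
  "Dodecahedron = uniform_spherical 3 2 5"

definition DD :: "nat \<Rightarrow> nat hypermap" where
  "DD n = uniform_spherical n n 1"

definition PP :: "nat \<Rightarrow> nat hypermap" where
  "PP n = uniform_spherical 2 2 n"

abbreviation cyclic :: "nat \<Rightarrow> int monoid" where
  "cyclic k \<equiv> integer_mod_group k"

text \<open>
  The dihedral group of order \<open>2k\<close> as the semidirect product of \<open>\<int>/k\<close> by inversion:
  \<open>(a, s)\<close> stands for \<open>\<rho>\<^sup>a \<tau>\<^sup>s\<close>, where \<open>\<tau>\<close> inverts \<open>\<rho>\<close>. In particular \<open>dihedral 1\<close> has order two.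
\<close>

definition dihedral :: "nat \<Rightarrow> (int \<times> bool) monoid" where
  "dihedral k =
     \<lparr>carrier = {0..<int k} \<times> UNIV,
      mult = (\<lambda>(a, s) (b, t). ((if s then a - b else a + b) mod int k, s \<noteq> t)),
      one = (0, False)\<rparr>"

abbreviation V4 :: "(int \<times> int) monoid" where
  "V4 \<equiv> cyclic 2 \<times>\<times> cyclic 2"

abbreviation trivial_grp :: "unit monoid" where
  "trivial_grp \<equiv> singleton_group ()"


section \<open>Rows of the table\<close>

text \<open>
  \<open>table_row \<K> \<L> (l, m, n) N g \<iota> \<Upsilon>\<close>: the hypermap \<open>\<K>\<close> is spherical and bipartite-regular, its
  closure cover is isomorphic to \<open>\<L>\<close>, its covering core has type \<open>(l; m; n)\<close>, \<open>N\<close> flags and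
  genus \<open>g\<close>, and its irregularity index and group are \<open>\<iota>\<close> and \<open>\<Upsilon>\<close>. The genus is only
  meaningful for orientable hypermaps, so orientability of the core is part of the claim.
\<close>

definition table_row ::
  "'a hypermap \<Rightarrow> 'b hypermap \<Rightarrow> nat \<times> nat \<times> nat \<Rightarrow> nat \<Rightarrow> rat \<Rightarrow> nat \<Rightarrow> 'c monoid \<Rightarrow> bool" where
  "table_row \<K> \<L> type N g \<iota> \<Upsilon> \<longleftrightarrow>
     hypermap \<K> \<and> spherical \<K> \<and> bipartite_regular \<K> \<and>
     hypermap_iso (closure_cover \<K>) \<L> \<and>
     hypermap (covering_core \<K>) \<and>
     (case type of (l, m, n) \<Rightarrow> uniform (covering_core \<K>) l m n) \<and>
     card (flags (covering_core \<K>)) = N \<and>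
     orientable (covering_core \<K>) \<and> genus (covering_core \<K>) = g \<and>
     irregularity_index \<K> = \<iota> \<and>
     irregularity_group \<K> \<cong> \<Upsilon> \<and>
     (\<iota> = 1 \<longleftrightarrow> regular \<K>) \<and>
     (\<iota> = 1 \<longrightarrow> hypermap_iso (covering_core \<K>) (closure_cover \<K>) \<and>
                hypermap_iso (closure_cover \<K>) \<K>)"

end

theory Submission
  imports Defs "HOL-Algebra.SndIsomorphismGrp" "HOL-Algebra.Multiplicative_Group"
begin

text \<open>
  \<^emph>\<open>Spherical hypermaps.\<close> For a type \<open>t = (l; m; n)\<close> let \<open>Tri t\<close> be the normal closure in \<open>\<Delta>\<close> of
  \<open>(R\<^sub>1 R\<^sub>2)\<^sup>l\<close>, \<open>(R\<^sub>2 R\<^sub>0)\<^sup>m\<close> and \<open>(R\<^sub>0 R\<^sub>1)\<^sup>n\<close>. A hypermap subgroup of a uniform hypermap of type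
  \<open>t\<close> contains these relators, and Euler characteristic \<open>2\<close> prescribes its index; once \<open>Tri t\<close> is
  known to have that very index, the subgroup is \<open>Tri t\<close> (\<open>spherical_type_unique\<close>). The index of
  \<open>Tri t\<close> is bounded from above by coset enumeration and from below by the classical quotients:
  dihedral groups, \<open>S\<^sub>4\<close> and \<open>A\<^sub>5\<close>. All entries of the table thereby become statements about
  the finite quotients of \<open>\<Delta>\<close> by \<open>Tri t\<close>.

  \<^emph>\<open>Lifting.\<close> \<open>\<phi>\<^sub>P\<close> and \<open>\<phi>\<^sub>W\<close> differ only in the image \<open>R\<^sub>j\<close> of \<open>R\<^sub>2\<close> conjugated by \<open>R\<^sub>0\<close>, with
  \<open>j = 0\<close> and \<open>j = 2\<close> respectively. So both are treated at once: \<open>K0 = \<phi>\<^sup>-\<^sup>1(Tri t)\<close> is normal in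
  \<open>Delta0\<close>, has index \<open>2 |\<Delta> : Tri t|\<close> in \<open>\<Delta>\<close>, and its only conjugates in \<open>\<Delta>\<close> are \<open>K0\<close> and its
  conjugate \<open>K0_swap\<close> by \<open>R\<^sub>0\<close>. The orders of the rotations modulo \<open>K0\<close> and \<open>K0_swap\<close> follow by
  applying \<open>\<phi>\<close>; they give the sizes of the faces of \<open>\<Delta> / K0\<close>, hence its Euler characteristic
  (\<open>K0_spherical\<close>), and the type of the covering core \<open>K0 \<inter> K0_swap\<close>.

  \<^emph>\<open>Closure.\<close> The normal closure of \<open>K0\<close> contains the powers of rotations that lie in \<open>K0\<close> or
  \<open>K0_swap\<close>, hence a group \<open>M\<close>: the triangle group kernel of type \<open>(1; 2k; 2k)\<close> with \<open>k = gcd(m, n)\<close>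
  for \<open>Pin\<close>, and of type \<open>(g; 2; 2n)\<close> with \<open>g = gcd(l, m)\<close> for \<open>Wal\<close>, which shrinks to \<open>(1; 2; 2)\<close> if
  \<open>g = 1\<close>. For the reverse inclusion consider the endomorphism \<open>\<tau>\<close> of \<open>\<Delta>\<close> that replaces \<open>R\<^sub>0\<close> by
  \<open>R\<^sub>0 R\<^sub>1 R\<^sub>0\<close>. It satisfies \<open>\<tau> (\<phi> w) = w\<close> modulo \<open>M\<close> for \<open>w\<close> in \<open>Delta0\<close>, since this holds on the
  four generators, and it maps \<open>Tri t\<close> into \<open>M\<close>. Hence \<open>w \<in> M\<close> exactly if \<open>\<phi> w\<close> lies in
  \<open>\<Theta> = \<tau>\<^sup>-\<^sup>1(M)\<close>; in particular \<open>K0\<close> lies in \<open>M\<close>, and \<open>\<phi>\<close> induces an isomorphism of \<open>\<Upsilon> = M / K0\<close> with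
  \<open>\<Theta> / Tri t\<close> (\<open>irregularity_iso\<close>). Comparing indices, \<open>\<iota> = 2 |\<Delta> : Tri t| / |\<Delta> : M|\<close>. As
  \<open>K0 K0_swap = M\<close>, the second isomorphism theorem gives the core the index \<open>2 |\<Delta> : Tri t| \<iota>\<close>
  (\<open>index_core\<close>), which together with its type determines its genus (\<open>lifted_table_row\<close>).

  \<^emph>\<open>The irregularity groups.\<close> \<open>\<Theta> / Tri t\<close> is recognised inside the finite group \<open>\<Delta> / Tri t\<close>. If \<open>M\<close> has
  type \<open>(1; 2; 2)\<close>, then \<open>\<Theta>\<close> contains all even words; for the Platonic types these map onto the rotation group \<open>A\<^sub>4\<close>, \<open>S\<^sub>4\<close>
  or \<open>A\<^sub>5\<close> of the solid, and the order leaves no room for a kernel. In the remaining cases explicit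
  rotations in \<open>\<Theta>\<close> generate a group of order \<open>\<iota>\<close> of the claimed shape.
\<close>

section \<open>Group-theoretic preliminaries\<close>

lemma (in group) normal_closure_normal:
  assumes "S \<subseteq> carrier G"
  shows "normal_closure G S \<lhd> G"
proof (rule normal_invI)
  have ne: "{N. N \<lhd> G \<and> S \<subseteq> N} \<noteq> {}"
    using assms normal_self by blast
  show "subgroup (normal_closure G S) G"
    unfolding normal_closure_def using ne
    by (intro subgroups_Inter) (auto dest: normal_imp_subgroup)
qed (auto simp: normal_closure_def normal_invE)

lemma normal_closure_subset: "S \<subseteq> normal_closure G S"
  by (auto simp: normal_closure_def)

lemma normal_closure_least: "N \<lhd> G \<Longrightarrow> S \<subseteq> N \<Longrightarrow> normal_closure G S \<subseteq> N"
  by (auto simp: normal_closure_def)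

lemma (in group) rcoset_eq_iff:
  assumes "subgroup M G" "u \<in> carrier G" "v \<in> carrier G"
  shows "M #> u = M #> v \<longleftrightarrow> u \<otimes> inv v \<in> M"
  by (metis assms group_axioms rcos_self repr_independence subgroup.rcos_module)

lemma (in group) bij_betw_rcosets_image:
  assumes "subgroup M G"
    and "\<And>u v. u \<in> carrier G \<Longrightarrow> v \<in> carrier G \<Longrightarrow> u \<otimes> inv v \<in> M \<longleftrightarrow> f u = f v"
  obtains h where "bij_betw h (rcosets M) (f ` carrier G)"
proof
  define h where "h C = f (SOME u. u \<in> carrier G \<and> C = M #> u)" for C
  have h: "h (M #> u) = f u" if "u \<in> carrier G" for u
    unfolding h_def
    by (rule someI2[of _ u]) (use that assms rcoset_eq_iff in auto)
  show "bij_betw h (rcosets M) (f ` carrier G)"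
    using assms by (auto simp: bij_betw_def inj_on_def RCOSETS_def h rcoset_eq_iff image_iff)
qed

lemma (in group) card_rcosets_eq_image:
  assumes "subgroup M G"
    and "\<And>u v. u \<in> carrier G \<Longrightarrow> v \<in> carrier G \<Longrightarrow> u \<otimes> inv v \<in> M \<longleftrightarrow> f u = f v"
  shows "card (rcosets M) = card (f ` carrier G)"
  using bij_betw_rcosets_image[of M f, OF assms] bij_betw_same_card by metis

lemma (in group) card_rcosets_ge_image:
  assumes "subgroup M G" "finite (rcosets M)"
    and "\<And>u v. u \<in> carrier G \<Longrightarrow> v \<in> carrier G \<Longrightarrow> u \<otimes> inv v \<in> M \<Longrightarrow> f u = f v"
  shows "finite (f ` carrier G)" "card (f ` carrier G) \<le> card (rcosets M)"
proof -
  define h where "h C = f (SOME u. u \<in> carrier G \<and> C = M #> u)" for C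
  have h: "h (M #> u) = f u" if "u \<in> carrier G" for u
    unfolding h_def
    by (rule someI2[of _ u]) (use that assms rcoset_eq_iff in auto)
  then have "f ` carrier G = h ` (rcosets M)"
    by (auto simp: RCOSETS_def image_iff)
  then show "finite (f ` carrier G)" "card (f ` carrier G) \<le> card (rcosets M)"
    using assms by (simp_all add: card_image_le)
qed

text \<open>The tower law for indices, without any finiteness assumption: a coset of \<open>M\<close> is a coset of
  \<open>M\<close> inside \<open>L\<close>, translated by the chosen representative of a coset of \<open>L\<close>.\<close>

lemma (in group) card_rcosets_tower:
  assumes M: "subgroup M G" and L: "subgroup L G" and sub: "M \<subseteq> L"
  shows "card (rcosets M) = card (rcosets L) * card (rcosets\<^bsub>G\<lparr>carrier := L\<rparr>\<^esub> M)"
proof -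
  define rep where "rep D = (SOME u. u \<in> carrier G \<and> D = L #> u)" for D
  have rep: "rep D \<in> carrier G" "L #> rep D = D" if "D \<in> rcosets L" for D
  proof -
    have "\<exists>u. u \<in> carrier G \<and> D = L #> u"
      using that by (auto simp: RCOSETS_def)
    from someI_ex[OF this] have *: "rep D \<in> carrier G \<and> D = L #> rep D"
      unfolding rep_def .
    from * show "rep D \<in> carrier G" by (rule conjunct1)
    from * show "L #> rep D = D" by (rule conjunct2[THEN sym])
  qed
  have Lc: "x \<in> carrier G" if "x \<in> L" for x
    by (rule subgroup.mem_carrier[OF L that])
  have in_M: "rcosets\<^bsub>G\<lparr>carrier := L\<rparr>\<^esub> M = (\<lambda>x. M #> x) ` L"
    by (auto simp: RCOSETS_def r_coset_def)
  define h where "h = (\<lambda>(D, C). C #> rep D)"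
  have h: "h (D, M #> x) = M #> (x \<otimes> rep D)" if "D \<in> rcosets L" "x \<in> L" for D x
    using that rep M Lc by (simp add: h_def coset_mult_assoc subgroup.subset)
  have "bij_betw h ((rcosets L) \<times> (rcosets\<^bsub>G\<lparr>carrier := L\<rparr>\<^esub> M)) (rcosets M)"
    unfolding bij_betw_def
  proof
    show "inj_on h ((rcosets L) \<times> (rcosets\<^bsub>G\<lparr>carrier := L\<rparr>\<^esub> M))"
    proof (rule inj_onI, clarify)
      fix D C D' C'
      assume D: "D \<in> rcosets L" "D' \<in> rcosets L"
        and "C \<in> rcosets\<^bsub>G\<lparr>carrier := L\<rparr>\<^esub> M" "C' \<in> rcosets\<^bsub>G\<lparr>carrier := L\<rparr>\<^esub> M"
        and eq: "h (D, C) = h (D', C')"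
      then obtain x y where x: "x \<in> L" "C = M #> x" and y: "y \<in> L" "C' = M #> y"
        by (auto simp: in_M)
      have e: "M #> (x \<otimes> rep D) = M #> (y \<otimes> rep D')"
        using eq h D x y by simp
      have cl: "x \<otimes> rep D \<in> carrier G" "y \<otimes> rep D' \<in> carrier G"
        using D x y rep Lc by auto
      from e have "(x \<otimes> rep D) \<otimes> inv (y \<otimes> rep D') \<in> L"
        using rcoset_eq_iff[OF M cl] sub by auto
      then have "L #> (x \<otimes> rep D) = L #> (y \<otimes> rep D')"
        using rcoset_eq_iff[OF L cl] by simp
      moreover have "L #> (z \<otimes> rep D) = D" if "z \<in> L" "D \<in> rcosets L" for z D
        using that rep L Lc by (metis coset_join2 coset_mult_assoc subgroup.subset)
      ultimately have DD: "D = D'"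
        using D x y by simp
      have "(x \<otimes> rep D) \<otimes> inv (y \<otimes> rep D) = x \<otimes> inv y"
        using D x y rep Lc by (simp add: inv_mult_group m_assoc inv_solve_left)
          (simp add: m_assoc[symmetric])
      then have "x \<otimes> inv y \<in> M"
        using e cl rcoset_eq_iff[OF M cl] DD by simp
      then show "D = D' \<and> C = C'"
        using DD x y rcoset_eq_iff[OF M] Lc by simp
    qed
    have "M #> u \<in> h ` ((rcosets L) \<times> (rcosets\<^bsub>G\<lparr>carrier := L\<rparr>\<^esub> M))" if u: "u \<in> carrier G" for u
    proof -
      let ?D = "L #> u"
      have D: "?D \<in> rcosets L"
        using u L rcosetsI subgroup.subset by blast
      let ?x = "u \<otimes> inv (rep ?D)"
      have x: "?x \<in> L"
        using rcoset_eq_iff[OF L u] rep[OF D] by metis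
      have "h (?D, M #> ?x) = M #> u"
        using h[OF D x] rep[OF D] u by (simp add: m_assoc)
      then show ?thesis
        using D x by (force simp: in_M)
    qed
    moreover have "h (D, C) \<in> rcosets M" if "D \<in> rcosets L" "C \<in> rcosets\<^bsub>G\<lparr>carrier := L\<rparr>\<^esub> M" for D C
      using that h rep Lc M by (auto simp: in_M intro!: rcosetsI subgroup.subset)
    ultimately show "h ` ((rcosets L) \<times> (rcosets\<^bsub>G\<lparr>carrier := L\<rparr>\<^esub> M)) = rcosets M"
      by (auto simp: RCOSETS_def[of G M])
  qed
  then show ?thesis
    by (metis bij_betw_same_card card_cartesian_product)
qed

text \<open>The cosets of \<open>M\<close> map onto those of \<open>L\<close>; as there are no more of the former, the map is
  injective, and \<open>L\<close> is a single coset of \<open>M\<close>.\<close>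

lemma (in group) subgroup_eq_of_index_le:
  assumes M: "subgroup M G" and L: "subgroup L G" and "M \<subseteq> L"
    and "finite (rcosets M)" and "card (rcosets M) \<le> card (rcosets L)"
  shows "M = L"
proof
  let ?f = "\<lambda>u. L #> u"
  define h where "h C = L <#> C" for C
  have h: "h (M #> u) = L #> u" if "u \<in> carrier G" for u
    using that assms by (simp add: h_def subgroup.subset setmult_rcos_assoc set_mult_subgroup_idem
        subgroup_incl subgroup.subgroup_is_group)
  have im: "h ` (rcosets M) = rcosets L"
    using h by (force simp: RCOSETS_def image_iff)
  then have "card (h ` (rcosets M)) = card (rcosets M)"
    using assms card_image_le[of "rcosets M" h] by simp
  then have inj: "inj_on h (rcosets M)"
    using assms(4) by (simp add: eq_card_imp_inj_on)
  show "L \<subseteq> M"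
  proof
    fix x assume x: "x \<in> L"
    then have xc: "x \<in> carrier G" by (rule subgroup.mem_carrier[OF L])
    have "h (M #> x) = h (M #> \<one>)"
      using h xc x L M by (metis coset_join2 coset_mult_one one_closed subgroup.subset)
    then have "M #> x = M #> \<one>"
      by (rule inj_onD[OF inj]) (use xc M in \<open>auto intro: rcosetsI dest: subgroup.subset\<close>)
    then show "x \<in> M"
      using rcoset_eq_iff[OF M xc one_closed] xc by simp
  qed
qed fact

subsection \<open>Recognising small groups\<close>

text \<open>The known group is mapped into the unknown one, because its elements are explicit and
  injectivity can be checked on them; surjectivity then follows by counting.\<close>

lemma (in group) iso_of_hom_card:
  assumes "h \<in> hom H G" "group H" "inj_on h (carrier H)" "finite (carrier G)" "order G = order H"
  shows "G \<cong> H"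
proof -
  have "h ` carrier H \<subseteq> carrier G"
    using assms by (auto simp: hom_def)
  moreover have "card (h ` carrier H) = card (carrier G)"
    using assms by (simp add: card_image order_def)
  ultimately have "h ` carrier H = carrier G"
    using assms(4) card_subset_eq by metis
  then have "h \<in> iso H G"
    using assms by (simp add: iso_def bij_betw_def)
  then show ?thesis
    using assms(2) group.iso_sym is_isoI by blast
qed

lemma (in group) iso_trivial_grp:
  assumes "order G = 1"
  shows "G \<cong> trivial_grp"
proof (rule iso_of_hom_card)
  show "(\<lambda>_. \<one>) \<in> hom trivial_grp G"
    by (simp add: hom_def)
  show "finite (carrier G)"
    using assms card.infinite[of "carrier G"] by (auto simp: order_def)
qed (use assms in \<open>auto simp: order_def\<close>)

lemma (in group) iso_cyclic:
  assumes x: "x \<in> carrier G" and "ord x = n" "order G = n" "n > 0"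
  shows "G \<cong> cyclic n"
proof (rule iso_of_hom_card)
  let ?h = "\<lambda>i::int. x [^] i"
  have mod: "x [^] (i mod int n) = x [^] i" for i
    using x assms by (simp add: int_pow_eq mod_eq_dvd_iff[symmetric])
  show "?h \<in> hom (cyclic n) G"
    using x assms by (auto simp: hom_def mod int_pow_mult)
  show "inj_on ?h (carrier (cyclic n))"
    using x assms by (auto simp: inj_on_def carrier_integer_mod_group int_pow_eq mod_eq_dvd_iff[symmetric])
  show "finite (carrier G)"
    using assms order_gt_0_iff_finite by simp
  show "order G = order (cyclic n)"
    using assms by (simp add: order_def carrier_integer_mod_group)
qed auto

lemma dihedral_simps:
  "carrier (dihedral k) = {0..<int k} \<times> UNIV"
  "(a, s) \<otimes>\<^bsub>dihedral k\<^esub> (b, t) = ((if s then a - b else a + b) mod int k, s \<noteq> t)"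
  "\<one>\<^bsub>dihedral k\<^esub> = (0, False)"
  by (auto simp: dihedral_def)

lemma group_dihedral:
  assumes "k > 0"
  shows "group (dihedral k)"
proof (rule groupI)
  fix x assume "x \<in> carrier (dihedral k)"
  then obtain a s where x: "x = (a, s)" "0 \<le> a" "a < int k"
    by (auto simp: dihedral_simps)
  show "\<exists>y\<in>carrier (dihedral k). y \<otimes>\<^bsub>dihedral k\<^esub> x = \<one>\<^bsub>dihedral k\<^esub>"
    by (rule bexI[of _ "(if s then a else (- a) mod int k, s)"])
      (use x assms in \<open>auto simp: dihedral_simps mod_simps\<close>)
next
  show "\<one>\<^bsub>dihedral k\<^esub> \<otimes>\<^bsub>dihedral k\<^esub> x = x" if "x \<in> carrier (dihedral k)" for x
    using that by (auto simp: dihedral_simps)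
next
  show "x \<otimes>\<^bsub>dihedral k\<^esub> y \<otimes>\<^bsub>dihedral k\<^esub> z = x \<otimes>\<^bsub>dihedral k\<^esub> (y \<otimes>\<^bsub>dihedral k\<^esub> z)" for x y z
    by (cases x; cases y; cases z) (auto simp: dihedral_simps mod_simps algebra_simps)
qed (use assms in \<open>auto simp: dihedral_simps\<close>)

lemma (in group) iso_dihedral:
  assumes u: "u \<in> carrier G" "ord u = k" and v: "v \<in> carrier G" "v \<otimes> v = \<one>"
    and vu: "v \<otimes> u \<otimes> v = inv u" and nin: "\<And>i::int. v \<noteq> u [^] i"
    and "order G = 2 * k" "k > 0"
  shows "G \<cong> dihedral k"
proof (rule iso_of_hom_card)
  let ?h = "\<lambda>(a::int, s). u [^] a \<otimes> (if s then v else \<one>)"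
  have mod: "u [^] (i mod int k) = u [^] i" for i
    using u assms by (simp add: int_pow_eq mod_eq_dvd_iff[symmetric])
  have invv: "inv v = v"
    using v by (simp add: inv_equality)
  have conj: "v \<otimes> (u [^] i) \<otimes> v = u [^] (- i)" for i :: int
  proof -
    have "v \<otimes> (u [^] i) \<otimes> v = (v \<otimes> u \<otimes> v) [^] i"
    proof -
      have "(\<lambda>x. v \<otimes> x \<otimes> v) \<in> hom G G"
      proof (rule homI)
        fix x y assume "x \<in> carrier G" "y \<in> carrier G"
        then show "v \<otimes> (x \<otimes> y) \<otimes> v = v \<otimes> x \<otimes> v \<otimes> (v \<otimes> y \<otimes> v)"
          using v by (simp add: m_assoc) (metis l_one m_assoc m_closed v)
      qed (use v in auto)
      then interpret c: group_hom G G "\<lambda>x. v \<otimes> x \<otimes> v"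
        by (simp add: group_hom_def group_hom_axioms_def)
      show ?thesis using u c.hom_int_pow by simp
    qed
    then show ?thesis using vu u by (simp add: int_pow_neg int_pow_inv)
  qed
  have vu': "v \<otimes> u [^] i = u [^] (- i) \<otimes> v" for i :: int
    using conj[of i] u v by (metis int_pow_closed inv_solve_right invv m_closed)
  show "?h \<in> hom (dihedral k) G"
  proof (rule homI)
    fix x y assume "x \<in> carrier (dihedral k)" "y \<in> carrier (dihedral k)"
    obtain a s b t where xy: "x = (a, s)" "y = (b, t)" by (cases x; cases y)
    have a: "u [^] a \<otimes> v \<otimes> (u [^] b \<otimes> z) = u [^] (a - b) \<otimes> (v \<otimes> z)" if "z \<in> carrier G" for z
    proof -
      have "u [^] a \<otimes> v \<otimes> (u [^] b \<otimes> z) = u [^] a \<otimes> (v \<otimes> u [^] b) \<otimes> z"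
        using u v that by (simp add: m_assoc)
      also have "\<dots> = (u [^] a \<otimes> u [^] (- b)) \<otimes> (v \<otimes> z)"
        using u v that by (simp add: vu' m_assoc)
      finally show ?thesis using u by (simp add: int_pow_mult[symmetric])
    qed
    show "?h (x \<otimes>\<^bsub>dihedral k\<^esub> y) = ?h x \<otimes> ?h y"
      using a[of v] a[of \<one>] u v
      by (cases s; cases t) (simp_all add: xy dihedral_simps mod m_assoc int_pow_mult)
  qed (use u v in auto)
  show "inj_on ?h (carrier (dihedral k))"
  proof (rule inj_onI, clarify)
    fix a s b t
    assume c: "(a, s) \<in> carrier (dihedral k)" "(b, t) \<in> carrier (dihedral k)"
      and eq: "u [^] a \<otimes> (if s then v else \<one>) = u [^] b \<otimes> (if t then v else \<one>)"
    have st: "s = t"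
    proof (rule ccontr)
      assume "s \<noteq> t"
      then have "u [^] a \<otimes> v = u [^] b \<or> u [^] b \<otimes> v = u [^] a"
        using eq u v by (cases s) auto
      then have "v = u [^] (b - a) \<or> v = u [^] (a - b)"
        using u v by (metis inv_solve_left int_pow_closed int_pow_diff int_pow_neg add.commute diff_conv_add_uminus int_pow_mult)
      then show False using nin by blast
    qed
    then have "u [^] a = u [^] b"
      using eq u v by (auto split: if_splits)
    then have "a mod int k = b mod int k"
      using u by (simp add: int_pow_eq mod_eq_dvd_iff dvd_diff_commute)
    then show "a = b \<and> s = t"
      using c st by (simp add: dihedral_simps)
  qed
  show "finite (carrier G)"
    using assms order_gt_0_iff_finite by simp
  show "order G = order (dihedral k)"
    using assms by (simp add: order_def dihedral_simps card_cartesian_product)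
qed (use assms group_dihedral in auto)

text \<open>\<open>a \<otimes> b\<close> and \<open>b \<otimes> a\<close> both differ from \<open>\<one>\<close>, \<open>a\<close> and \<open>b\<close>, which leaves a single element.\<close>

lemma (in group) commute_of_order_4:
  assumes "order G = 4" "a \<in> carrier G" "b \<in> carrier G"
    and "a \<otimes> a = \<one>" "b \<otimes> b = \<one>" "a \<noteq> \<one>" "b \<noteq> \<one>" "a \<noteq> b"
  shows "a \<otimes> b = b \<otimes> a" "distinct [\<one>, a, b, a \<otimes> b]"
proof -
  have inv: "inv a = a" "inv b = b"
    using assms by (auto simp: inv_equality)
  have d: "a \<otimes> b \<notin> {\<one>, a, b}" "b \<otimes> a \<notin> {\<one>, a, b}"
  proof -
    have "x \<otimes> y \<notin> {\<one>, x, y}" if "x \<in> carrier G" "y \<in> carrier G" "inv y = y" "x \<noteq> \<one>" "y \<noteq> \<one>" "x \<noteq> y" for x y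
      using that inv_equality[of x y] by (simp, metis)
    from this[of a b] this[of b a] show "a \<otimes> b \<notin> {\<one>, a, b}" "b \<otimes> a \<notin> {\<one>, a, b}"
      using assms(2-8) inv by blast+
  qed
  then show "distinct [\<one>, a, b, a \<otimes> b]"
    using assms by auto
  then have "card {\<one>, a, b, a \<otimes> b} = card (carrier G)"
    using assms by (simp add: order_def)
  moreover have "finite (carrier G)"
    using assms order_gt_0_iff_finite by simp
  ultimately have "{\<one>, a, b, a \<otimes> b} = carrier G"
    using assms by (intro card_subset_eq) auto
  then show "a \<otimes> b = b \<otimes> a"
  proof -
    assume *: "{\<one>, a, b, a \<otimes> b} = carrier G"
    have "b \<otimes> a \<in> {\<one>, a, b, a \<otimes> b}"
      unfolding * using assms(2,3) by simp
    then show ?thesis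
      using d(2) by auto
  qed
qed

lemma (in group) iso_V4:
  assumes 4: "order G = 4" and ab: "a \<in> carrier G" "b \<in> carrier G"
    and sq: "a \<otimes> a = \<one>" "b \<otimes> b = \<one>" and ne: "a \<noteq> \<one>" "b \<noteq> \<one>" "a \<noteq> b"
  shows "G \<cong> V4"
proof (rule iso_of_hom_card)
  let ?h = "\<lambda>(i::int, j::int). (if i = 0 then \<one> else a) \<otimes> (if j = 0 then \<one> else b)"
  have comm: "b \<otimes> a = a \<otimes> b" and dist: "distinct [\<one>, a, b, a \<otimes> b]"
    using commute_of_order_4[OF assms] by auto
  have aa: "a \<otimes> (a \<otimes> x) = x" "b \<otimes> (b \<otimes> x) = x" if "x \<in> carrier G" for x
    using ab sq that by (metis l_one m_assoc)+
  have ba: "b \<otimes> (a \<otimes> x) = a \<otimes> (b \<otimes> x)" if "x \<in> carrier G" for x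
    using ab comm that by (metis m_assoc)
  have V4: "carrier V4 = {0,1} \<times> {0,1}"
    by (auto simp: DirProd_def carrier_integer_mod_group)
  show "?h \<in> hom V4 G"
  proof (rule homI)
    fix x y assume "x \<in> carrier V4" "y \<in> carrier V4"
    then have "x \<in> {0,1} \<times> {0,1}" "y \<in> {0,1} \<times> {0,1}"
      unfolding V4 by auto
    then show "?h (x \<otimes>\<^bsub>V4\<^esub> y) = ?h x \<otimes> ?h y"
      using ab sq by (auto simp: DirProd_def comm aa ba m_assoc)
  qed (use ab in auto)
  show "inj_on ?h (carrier V4)"
    using ab dist unfolding V4 by (auto simp: inj_on_def)
  show "finite (carrier G)"
    using 4 order_gt_0_iff_finite by simp
  show "order G = order V4"
  proof -
    have "order V4 = 4"
      unfolding order_def V4 by (simp add: card_cartesian_product)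
    then show ?thesis using 4 by simp
  qed
qed (auto intro: DirProd_group)

section \<open>The group \<open>\<Delta>\<close>, word parity and \<open>Delta0\<close>\<close>

interpretation Delta: group Delta
  by (rule group_Delta)

lemma Rgen_closed [simp]: "Rgen i \<in> carrier Delta"
  by (rule Rgen_carrier)

lemma Rgen_sq [simp]: "Rgen i \<otimes>\<^bsub>Delta\<^esub> Rgen i = \<one>\<^bsub>Delta\<^esub>"
  by (rule Rgen_square)

lemma Rgen_inv [simp]: "inv\<^bsub>Delta\<^esub> Rgen i = Rgen i"
  by (simp add: Delta.inv_equality)

lemma Rgen_cancel [simp]:
  "w \<in> carrier Delta \<Longrightarrow> Rgen i \<otimes>\<^bsub>Delta\<^esub> (Rgen i \<otimes>\<^bsub>Delta\<^esub> w) = w"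
  by (simp add: Delta.m_assoc[symmetric])

lemma Cons_in_Delta:
  "x # w \<in> carrier Delta \<Longrightarrow> w \<in> carrier Delta \<and> x # w = Rgen x \<otimes>\<^bsub>Delta\<^esub> w"
  by (cases w) (auto simp: Delta_def Rgen_def)

lemma Delta_induct [consumes 1, case_names one step]:
  assumes "w \<in> carrier Delta" and "P \<one>\<^bsub>Delta\<^esub>"
    and "\<And>i w. w \<in> carrier Delta \<Longrightarrow> P w \<Longrightarrow> P (Rgen i \<otimes>\<^bsub>Delta\<^esub> w)"
  shows "P w"
  using assms(1)
proof (induction w)
  case Nil
  then show ?case using assms(2) by (simp add: Delta_def)
next
  case (Cons x w)
  then show ?case using Cons_in_Delta[OF Cons.prems] assms(3) by metis
qed

lemma even_length_push: "even (length (push x w)) \<longleftrightarrow> odd (length w)"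
  by (cases w) auto

lemma even_length_mult:
  "even (length (u \<otimes>\<^bsub>Delta\<^esub> v)) \<longleftrightarrow> (even (length u) \<longleftrightarrow> even (length v))"
proof -
  have "even (length (foldr push u v)) \<longleftrightarrow> (even (length u) \<longleftrightarrow> even (length v))"
    by (induction u) (auto simp: even_length_push)
  then show ?thesis by (simp add: Delta_def)
qed

lemma even_length_one [simp]: "even (length \<one>\<^bsub>Delta\<^esub>)"
  by (simp add: Delta_def)

lemma odd_length_Rgen [simp]: "odd (length (Rgen i))"
  by (simp add: Rgen_def)

lemma even_length_inv [simp]:
  "u \<in> carrier Delta \<Longrightarrow> even (length (inv\<^bsub>Delta\<^esub> u)) \<longleftrightarrow> even (length u)"
  using even_length_mult[of "inv\<^bsub>Delta\<^esub> u" u] by simp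

lemma odd0_mult: "odd0 (u \<otimes>\<^bsub>Delta\<^esub> v) \<longleftrightarrow> (odd0 u \<noteq> odd0 v)"
  by (simp add: Delta_def odd0_foldr)

lemma odd0_one [simp]: "\<not> odd0 \<one>\<^bsub>Delta\<^esub>"
  by (simp add: Delta_def odd0_def)

lemma odd0_Rgen [simp]: "odd0 (Rgen i) \<longleftrightarrow> i = I0"
  by (simp add: Rgen_def odd0_def)

lemma odd0_inv [simp]: "u \<in> carrier Delta \<Longrightarrow> odd0 (inv\<^bsub>Delta\<^esub> u) \<longleftrightarrow> odd0 u"
  using odd0_mult[of "inv\<^bsub>Delta\<^esub> u" u] by simp

definition Delta_plus :: "idx list set" where
  "Delta_plus = {w \<in> carrier Delta. even (length w)}"

lemma Delta_plus_normal: "Delta_plus \<lhd> Delta"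
proof (rule Delta.normal_invI)
  show "subgroup Delta_plus Delta"
    by (rule Delta.subgroupI) (use even_length_one in \<open>auto simp: Delta_plus_def even_length_mult\<close>)
qed (auto simp: Delta_plus_def even_length_mult)

lemma Delta_plus_generated:
  "Delta_plus \<subseteq> generate Delta {Rgen I1 \<otimes>\<^bsub>Delta\<^esub> Rgen I2, Rgen I2 \<otimes>\<^bsub>Delta\<^esub> Rgen I0}"
    (is "_ \<subseteq> ?S")
proof
  have S: "subgroup ?S Delta"
    by (rule Delta.generate_is_subgroup) auto
  have 12: "Rgen I1 \<otimes>\<^bsub>Delta\<^esub> Rgen I2 \<in> ?S" and 20: "Rgen I2 \<otimes>\<^bsub>Delta\<^esub> Rgen I0 \<in> ?S"
    by (auto intro: generate.incl)
  have "inv\<^bsub>Delta\<^esub> (Rgen I1 \<otimes>\<^bsub>Delta\<^esub> Rgen I2) \<in> ?S" "inv\<^bsub>Delta\<^esub> (Rgen I2 \<otimes>\<^bsub>Delta\<^esub> Rgen I0) \<in> ?S"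
    using 12 20 S by (auto intro: subgroup.m_inv_closed)
  then have 21: "Rgen I2 \<otimes>\<^bsub>Delta\<^esub> Rgen I1 \<in> ?S" and 02: "Rgen I0 \<otimes>\<^bsub>Delta\<^esub> Rgen I2 \<in> ?S"
    by (auto simp: Delta.inv_mult_group)
  have 10: "Rgen I1 \<otimes>\<^bsub>Delta\<^esub> Rgen I0 \<in> ?S"
    using subgroup.m_closed[OF S 12 20] by (simp add: Delta.m_assoc)
  have 01: "Rgen I0 \<otimes>\<^bsub>Delta\<^esub> Rgen I1 \<in> ?S"
    using subgroup.m_closed[OF S 02 21] by (simp add: Delta.m_assoc)
  have pair: "Rgen i \<otimes>\<^bsub>Delta\<^esub> Rgen j \<in> ?S" for i j
    using 12 20 21 02 10 01 subgroup.one_closed[OF S] by (cases i; cases j) auto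
  have "(even (length w) \<longrightarrow> w \<in> ?S) \<and> (odd (length w) \<longrightarrow> (\<forall>i. Rgen i \<otimes>\<^bsub>Delta\<^esub> w \<in> ?S))"
    if "w \<in> carrier Delta" for w
    using that
  proof (induction w rule: Delta_induct)
    case (step i w)
    then show ?case
      using subgroup.m_closed[OF S pair]
      by (auto simp: even_length_mult Delta.m_assoc[symmetric])
  qed (use subgroup.one_closed[OF S] pair in auto)
  then show "w \<in> ?S" if "w \<in> Delta_plus" for w
    using that by (auto simp: Delta_plus_def)
qed

text \<open>\<open>R\<^sub>0\<close> moves across a word at the price of conjugating the letters it passes; hence the
  words with an even number of letters \<open>R\<^sub>0\<close> are generated by \<open>R\<^sub>1\<close>, \<open>R\<^sub>2\<close> and their
  conjugates.\<close>

definition Delta0_gens :: "idx list set" where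
  "Delta0_gens = {Rgen I1, Rgen I2, conjg Delta (Rgen I1) (Rgen I0), conjg Delta (Rgen I2) (Rgen I0)}"

lemma conjg_R0:
  "conjg Delta x (Rgen I0) = Rgen I0 \<otimes>\<^bsub>Delta\<^esub> x \<otimes>\<^bsub>Delta\<^esub> Rgen I0"
  by (simp add: conjg_def)

lemma even0_generated:
  assumes "w \<in> carrier Delta"
  shows "(\<not> odd0 w \<longrightarrow> w \<in> generate Delta Delta0_gens) \<and>
         (odd0 w \<longrightarrow> Rgen I0 \<otimes>\<^bsub>Delta\<^esub> w \<in> generate Delta Delta0_gens)"
  using assms
proof (induction w rule: Delta_induct)
  case one
  show ?case by (simp add: generate.one)
next
  case (step i w)
  have gen: "g \<otimes>\<^bsub>Delta\<^esub> w \<in> generate Delta Delta0_gens"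
    if "g \<in> Delta0_gens" "w \<in> generate Delta Delta0_gens" for g w
    using that by (auto intro: generate.eng generate.incl)
  have shift: "conjg Delta (Rgen i) (Rgen I0) \<otimes>\<^bsub>Delta\<^esub> (Rgen I0 \<otimes>\<^bsub>Delta\<^esub> w)
      = Rgen I0 \<otimes>\<^bsub>Delta\<^esub> (Rgen i \<otimes>\<^bsub>Delta\<^esub> w)" for i
    using step by (simp add: conjg_R0 Delta.m_assoc)
  show ?case
  proof (cases i)
    case I0
    then show ?thesis using step by (simp add: odd0_mult)
  next
    case I1
    then show ?thesis
      using step gen[of "Rgen I1" w] gen[of "conjg Delta (Rgen I1) (Rgen I0)" "Rgen I0 \<otimes>\<^bsub>Delta\<^esub> w"] shift[of I1]
      by (auto simp: odd0_mult Delta0_gens_def)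
  next
    case I2
    then show ?thesis
      using step gen[of "Rgen I2" w] gen[of "conjg Delta (Rgen I2) (Rgen I0)" "Rgen I0 \<otimes>\<^bsub>Delta\<^esub> w"] shift[of I2]
      by (auto simp: odd0_mult Delta0_gens_def)
  qed
qed

lemma Delta0_normal: "Delta0 \<lhd> Delta"
  unfolding Delta0_def by (rule Delta.normal_closure_normal) auto

lemma Delta0_subgroup: "subgroup Delta0 Delta"
  using Delta0_normal by (rule normal_imp_subgroup)

lemma Delta0_gens_subset: "Delta0_gens \<subseteq> Delta0"
proof -
  have *: "{Rgen I1, Rgen I2} \<subseteq> Delta0"
    unfolding Delta0_def by (rule normal_closure_subset)
  moreover have "conjg Delta x (Rgen I0) \<in> Delta0" if "x \<in> Delta0" for x
    using Delta.normal_invE(2)[OF Delta0_normal, of "Rgen I0" x] that by (simp add: conjg_R0)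
  ultimately show ?thesis
    by (auto simp: Delta0_gens_def)
qed

lemma Delta0_eq: "Delta0 = {w \<in> carrier Delta. \<not> odd0 w}"
proof
  have "generate Delta Delta0_gens \<subseteq> Delta0"
    using Delta.generate_subgroup_incl[OF Delta0_gens_subset Delta0_subgroup] .
  then show "{w \<in> carrier Delta. \<not> odd0 w} \<subseteq> Delta0"
    using even0_generated by blast
qed (use Delta0_even in auto)

lemma Delta0_generated: "Delta0 = generate Delta Delta0_gens"
  using even0_generated Delta.generate_subgroup_incl[OF Delta0_gens_subset Delta0_subgroup]
  by (auto simp: Delta0_eq)

lemma Delta0_hom_unique:
  assumes "group G" and "f \<in> hom (Delta\<lparr>carrier := Delta0\<rparr>) G" "g \<in> hom (Delta\<lparr>carrier := Delta0\<rparr>) G"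
    and "\<And>x. x \<in> Delta0_gens \<Longrightarrow> f x = g x" and "w \<in> Delta0"
  shows "f w = g w"
proof -
  let ?D = "Delta\<lparr>carrier := Delta0\<rparr>"
  have D: "group ?D"
    using Delta.subgroup_imp_group Delta0_subgroup by blast
  interpret f: group_hom ?D G f using assms D by (simp add: group_hom_def group_hom_axioms_def)
  interpret g: group_hom ?D G g using assms D by (simp add: group_hom_def group_hom_axioms_def)
  have m_inv: "inv\<^bsub>?D\<^esub> x = inv\<^bsub>Delta\<^esub> x" if "x \<in> Delta0" for x
    using that Delta0_subgroup Delta.m_inv_consistent by blast
  have "w \<in> generate Delta Delta0_gens"
    using assms Delta0_generated by simp
  then show ?thesis
  proof (induction rule: generate.induct)
    case one
    show ?case using f.hom_one g.hom_one by simp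
  next
    case (incl h)
    then show ?case using assms by simp
  next
    case (inv h)
    then have "h \<in> Delta0" using Delta0_gens_subset by auto
    then have "f (inv\<^bsub>?D\<^esub> h) = inv\<^bsub>G\<^esub> f h" "g (inv\<^bsub>?D\<^esub> h) = inv\<^bsub>G\<^esub> g h"
      using f.hom_inv[of h] g.hom_inv[of h] by simp_all
    then show ?case using inv assms \<open>h \<in> Delta0\<close> m_inv by simp
  next
    case (eng h1 h2)
    then have "h1 \<in> Delta0" "h2 \<in> Delta0" using Delta0_generated by auto
    then show ?case using f.hom_mult[of h1 h2] g.hom_mult[of h1 h2] eng by simp
  qed
qed

section \<open>The action on flags and the faces\<close>

lemma hypermapD:
  assumes "hypermap \<H>"
  shows "finite (flags \<H>)" "flags \<H> \<noteq> {}"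
    "\<omega> \<in> flags \<H> \<Longrightarrow> perm \<H> i \<omega> \<in> flags \<H>"
    "\<omega> \<in> flags \<H> \<Longrightarrow> perm \<H> i (perm \<H> i \<omega>) = \<omega>"
    "\<omega> \<in> flags \<H> \<Longrightarrow> perm \<H> i \<omega> \<noteq> \<omega>"
    "\<omega> \<in> flags \<H> \<Longrightarrow> \<omega>' \<in> flags \<H> \<Longrightarrow> \<exists>w\<in>carrier Delta. act \<H> w \<omega> = \<omega>'"
  using assms unfolding hypermap_def by auto

text \<open>The part of being a hypermap on which the action laws depend. It holds for the cosets of any
  subgroup, also when there are infinitely many of them or some are fixed by a generator.\<close>

definition involutive_on :: "'a hypermap \<Rightarrow> bool" where
  "involutive_on \<H> \<longleftrightarrow>
     (\<forall>i. \<forall>\<omega>\<in>flags \<H>. perm \<H> i \<omega> \<in> flags \<H> \<and> perm \<H> i (perm \<H> i \<omega>) = \<omega>)"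

lemma hypermap_involutive: "hypermap \<H> \<Longrightarrow> involutive_on \<H>"
  by (simp add: hypermap_def involutive_on_def)

lemma act_push:
  assumes "involutive_on \<H>" "\<omega> \<in> flags \<H>"
  shows "act \<H> (push x w) \<omega> = act \<H> w (perm \<H> x \<omega>)"
  using assms by (cases w) (auto simp: act_def involutive_on_def)

lemma act_mult:
  assumes "involutive_on \<H>" "\<omega> \<in> flags \<H>"
  shows "act \<H> (u \<otimes>\<^bsub>Delta\<^esub> v) \<omega> = act \<H> v (act \<H> u \<omega>)"
proof -
  have "act \<H> (foldr push u v) \<omega> = act \<H> v (act \<H> u \<omega>)"
    using assms(2)
  proof (induction u arbitrary: \<omega>)
    case (Cons x u)
    have "perm \<H> x \<omega> \<in> flags \<H>"
      using Cons.prems assms(1) by (simp add: involutive_on_def)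
    then show ?case
      using Cons assms(1) by (simp add: act_push) (simp add: act_def)
  qed (simp add: act_def)
  then show ?thesis by (simp add: Delta_def)
qed

lemma act_one [simp]: "act \<H> \<one>\<^bsub>Delta\<^esub> \<omega> = \<omega>"
  by (simp add: act_def Delta_def)

lemma act_Rgen [simp]: "act \<H> (Rgen i) \<omega> = perm \<H> i \<omega>"
  by (simp add: act_def Rgen_def)

lemma act_closed:
  assumes "involutive_on \<H>" "\<omega> \<in> flags \<H>"
  shows "act \<H> w \<omega> \<in> flags \<H>"
  using assms(2)
  by (induction w arbitrary: \<omega>) (use assms(1) in \<open>auto simp: act_def involutive_on_def\<close>)

lemma act_pow:
  assumes "involutive_on \<H>" "\<omega> \<in> flags \<H>" "w \<in> carrier Delta"
  shows "act \<H> (w [^]\<^bsub>Delta\<^esub> (e::nat)) \<omega> = (act \<H> w ^^ e) \<omega>"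
  by (induction e) (use assms in \<open>auto simp: act_mult\<close>)

lemma act_inv:
  assumes "involutive_on \<H>" "\<omega> \<in> flags \<H>" "w \<in> carrier Delta"
  shows "act \<H> (inv\<^bsub>Delta\<^esub> w) (act \<H> w \<omega>) = \<omega>"
  using act_mult[OF assms(1,2), of w "inv\<^bsub>Delta\<^esub> w"] assms by simp

lemma flag_stabiliser_subgroup:
  assumes "involutive_on \<H>" "\<omega> \<in> flags \<H>"
  shows "subgroup (flag_stabiliser \<H> \<omega>) Delta"
proof (rule Delta.subgroupI)
  show "inv\<^bsub>Delta\<^esub> w \<in> flag_stabiliser \<H> \<omega>" if "w \<in> flag_stabiliser \<H> \<omega>" for w
    using that act_inv[OF assms, of w] by (auto simp: flag_stabiliser_def)
qed (use assms in \<open>auto simp: flag_stabiliser_def act_mult intro: exI[of _ "\<one>\<^bsub>Delta\<^esub>"]\<close>)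

lemma stabiliser_mem_iff:
  assumes "involutive_on \<H>" "\<omega> \<in> flags \<H>" and uv: "u \<in> carrier Delta" "v \<in> carrier Delta"
  shows "u \<otimes>\<^bsub>Delta\<^esub> inv\<^bsub>Delta\<^esub> v \<in> flag_stabiliser \<H> \<omega> \<longleftrightarrow> act \<H> u \<omega> = act \<H> v \<omega>"
proof -
  have "act \<H> (u \<otimes>\<^bsub>Delta\<^esub> inv\<^bsub>Delta\<^esub> v) \<omega> = \<omega> \<longleftrightarrow> act \<H> u \<omega> = act \<H> v \<omega>"
  proof
    assume *: "act \<H> (u \<otimes>\<^bsub>Delta\<^esub> inv\<^bsub>Delta\<^esub> v) \<omega> = \<omega>"
    have "act \<H> v \<omega> = act \<H> v (act \<H> (u \<otimes>\<^bsub>Delta\<^esub> inv\<^bsub>Delta\<^esub> v) \<omega>)"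
      by (simp add: *)
    also have "\<dots> = act \<H> u \<omega>"
      using assms by (simp add: act_mult[symmetric] Delta.m_assoc)
    finally show "act \<H> u \<omega> = act \<H> v \<omega>" ..
  qed (use assms in \<open>simp add: act_mult act_inv\<close>)
  then show ?thesis
    using uv by (simp add: flag_stabiliser_def)
qed

lemma flags_orbit:
  assumes "hypermap \<H>" "\<omega> \<in> flags \<H>"
  shows "(\<lambda>u. act \<H> u \<omega>) ` carrier Delta = flags \<H>"
  using hypermapD(6)[OF assms] act_closed[OF hypermap_involutive[OF assms(1)] assms(2)] by blast

lemma card_flags_index:
  assumes "hypermap \<H>" "\<omega> \<in> flags \<H>"
  shows "card (rcosets\<^bsub>Delta\<^esub> (flag_stabiliser \<H> \<omega>)) = card (flags \<H>)"
  using Delta.card_rcosets_eq_image[OF flag_stabiliser_subgroup stabiliser_mem_iff] assms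
  by (metis flags_orbit hypermap_involutive)

definition face :: "'a hypermap \<Rightarrow> idx \<Rightarrow> 'a \<Rightarrow> 'a set" where
  "face \<H> k \<omega> = (\<lambda>w. act \<H> w \<omega>) ` generate Delta {Rgen i | i. i \<noteq> k}"

lemma faces_eq: "faces \<H> k = face \<H> k ` flags \<H>"
  by (simp add: faces_def face_def)

lemma face_group: "subgroup (generate Delta {Rgen i | i. i \<noteq> k}) Delta"
  by (rule Delta.generate_is_subgroup) auto

lemma face_memI:
  "w \<in> generate Delta {Rgen i | i. i \<noteq> k} \<Longrightarrow> act \<H> w \<omega> \<in> face \<H> k \<omega>"
  by (simp add: face_def)

lemma face_self: "\<omega> \<in> face \<H> k \<omega>"
proof -
  have "act \<H> \<one>\<^bsub>Delta\<^esub> \<omega> \<in> face \<H> k \<omega>"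
    unfolding face_def by (intro imageI generate.one)
  then show ?thesis by simp
qed

lemma face_eq_of_mem:
  assumes "involutive_on \<H>" "\<omega> \<in> flags \<H>" "\<omega>' \<in> face \<H> k \<omega>"
  shows "face \<H> k \<omega>' = face \<H> k \<omega>"
proof -
  let ?S = "generate Delta {Rgen i | i. i \<noteq> k}"
  obtain v where v: "v \<in> ?S" "\<omega>' = act \<H> v \<omega>"
    using assms(3) by (auto simp: face_def)
  have vc: "v \<in> carrier Delta" and iv: "inv\<^bsub>Delta\<^esub> v \<in> ?S"
    using subgroup.mem_carrier[OF face_group v(1)] subgroup.m_inv_closed[OF face_group v(1)] by auto
  have "act \<H> w \<omega>' \<in> face \<H> k \<omega>" if "w \<in> ?S" for w
    using face_memI[OF subgroup.m_closed[OF face_group v(1) that], of \<H> \<omega>]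
    by (simp add: act_mult[OF assms(1,2)] v(2))
  moreover have "act \<H> w \<omega> \<in> face \<H> k \<omega>'" if "w \<in> ?S" for w
  proof -
    have wc: "w \<in> carrier Delta" by (rule subgroup.mem_carrier[OF face_group that])
    have "act \<H> (inv\<^bsub>Delta\<^esub> v \<otimes>\<^bsub>Delta\<^esub> w) \<omega>' = act \<H> w \<omega>"
      using v vc assms by (simp add: act_mult act_closed act_inv)
    then show ?thesis
      using face_memI[OF subgroup.m_closed[OF face_group iv that], of \<H> \<omega>'] by simp
  qed
  ultimately show ?thesis
    by (auto simp: face_def[of \<H> k \<omega>] face_def[of \<H> k \<omega>'])
qed

lemma face_subset:
  "involutive_on \<H> \<Longrightarrow> \<omega> \<in> flags \<H> \<Longrightarrow> face \<H> k \<omega> \<subseteq> flags \<H>"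
  by (auto simp: face_def act_closed)

lemma faces_partition:
  assumes "hypermap \<H>"
  shows "\<Union> (faces \<H> k) = flags \<H>" "pairwise disjnt (faces \<H> k)"
    "F \<in> faces \<H> k \<Longrightarrow> \<omega> \<in> F \<Longrightarrow> F = face \<H> k \<omega>"
    "F \<in> faces \<H> k \<Longrightarrow> finite F \<and> F \<noteq> {}"
proof -
  note inv = hypermap_involutive[OF assms] and fin = hypermapD(1)[OF assms]
  show part: "F = face \<H> k \<omega>" if "F \<in> faces \<H> k" "\<omega> \<in> F" for F \<omega>
    using that face_eq_of_mem[OF inv] by (auto simp: faces_eq)
  have finF: "F \<subseteq> flags \<H>" "finite F" "F \<noteq> {}" if F: "F \<in> faces \<H> k" for F
  proof -
    obtain \<omega> where \<omega>: "\<omega> \<in> flags \<H>" "F = face \<H> k \<omega>"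
      using F by (auto simp: faces_eq)
    then show "F \<subseteq> flags \<H>"
      using face_subset[OF inv \<omega>(1)] by simp
    then show "finite F" using fin finite_subset by blast
    show "F \<noteq> {}" using face_self[of \<omega> \<H> k] \<omega>(2) by auto
  qed
  then show "F \<in> faces \<H> k \<Longrightarrow> finite F \<and> F \<noteq> {}" by simp
  show "\<Union> (faces \<H> k) = flags \<H>"
  proof
    show "flags \<H> \<subseteq> \<Union> (faces \<H> k)"
    proof
      fix \<omega> assume "\<omega> \<in> flags \<H>"
      then have "face \<H> k \<omega> \<in> faces \<H> k" by (simp add: faces_eq)
      then show "\<omega> \<in> \<Union> (faces \<H> k)" using face_self by (rule UnionI)
    qed
    show "\<Union> (faces \<H> k) \<subseteq> flags \<H>"
      by (rule Union_least) (rule finF(1))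
  qed
  show "pairwise disjnt (faces \<H> k)"
  proof (rule pairwiseI, unfold disjnt_def, rule equals0I)
    fix A B \<omega> assume "A \<in> faces \<H> k" "B \<in> faces \<H> k" "A \<noteq> B" "\<omega> \<in> A \<inter> B"
    then show False using part[of A \<omega>] part[of B \<omega>] by simp
  qed
qed

text \<open>Each face contributes \<open>1\<close> in total, spread evenly over its flags.\<close>

lemma card_faces_sum:
  assumes "hypermap \<H>"
  shows "(of_nat (card (faces \<H> k)) :: rat) = (\<Sum>\<omega>\<in>flags \<H>. 1 / of_nat (card (face \<H> k \<omega>)))"
proof -
  note part = faces_partition[OF assms, where k = k]
  have "(\<Sum>\<omega>\<in>\<Union> (faces \<H> k). 1 / of_nat (card (face \<H> k \<omega>)) :: rat)
      = (\<Sum>F\<in>faces \<H> k. \<Sum>\<omega>\<in>F. 1 / of_nat (card (face \<H> k \<omega>)))"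
    by (rule sum.Union_disjoint[unfolded o_def])
      (use part(2,4) in \<open>auto simp: pairwise_def disjnt_def\<close>)
  also have "\<dots> = (\<Sum>F\<in>faces \<H> k. \<Sum>\<omega>\<in>F. 1 / of_nat (card F))"
    using part(3) by (intro sum.cong refl) simp
  also have "\<dots> = (\<Sum>F\<in>faces \<H> k. 1)"
    using part(4) by (intro sum.cong refl) auto
  finally show ?thesis by (simp add: part(1))
qed

lemma generate_two_cases:
  assumes "i \<noteq> j" "j \<noteq> k" "i \<noteq> k"
  shows "{Rgen l | l. l \<noteq> k} = {Rgen i, Rgen j}"
proof -
  have "l \<noteq> k \<longleftrightarrow> l = i \<or> l = j" for l
    using assms by (cases i; cases j; cases k; cases l) auto
  then show ?thesis by auto
qed

text \<open>The exponents that fix \<open>x\<close> are closed under subtraction, so they are the multiples of the least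
  positive one.\<close>

lemma period_exists:
  assumes fin: "finite X" and bij: "bij_betw T X X" and x: "x \<in> X"
  obtains d :: nat where "d > 0" "\<And>e. (T ^^ e) x = x \<longleftrightarrow> d dvd e"
proof -
  have cl: "(T ^^ e) y \<in> X" if "y \<in> X" for e y
    using that bij by (induction e) (auto simp: bij_betw_def)
  have inj: "(T ^^ e) y = (T ^^ e) z \<Longrightarrow> y = z" if "y \<in> X" "z \<in> X" for e y z
    using that bij cl by (induction e) (auto simp: bij_betw_def dest!: inj_onD)
  have "\<not> inj (\<lambda>e. (T ^^ e) x)"
    using cl[OF x] fin by (metis finite_subset image_subsetI infinite_UNIV_nat finite_imageD)
  then obtain a b where "a < b" "(T ^^ a) x = (T ^^ b) x"
    by (metis (no_types, lifting) injI linorder_neqE_nat)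
  moreover have "(T ^^ b) x = (T ^^ a) ((T ^^ (b - a)) x)" if "a < b" for a b
    using that by (metis funpow_add le_add_diff_inverse less_imp_le o_apply)
  ultimately have "(T ^^ (b - a)) x = x" "b - a > 0"
    using inj[of x "(T ^^ (b - a)) x" a] x cl by auto
  then have ex: "\<exists>e>0. (T ^^ e) x = x" by blast
  define d where "d = (LEAST e. e > 0 \<and> (T ^^ e) x = x)"
  have d: "d > 0" "(T ^^ d) x = x"
    using LeastI_ex[of "\<lambda>e. e > 0 \<and> (T ^^ e) x = x"] ex by (auto simp: d_def)
  have mult: "(T ^^ (d * q)) x = x" for q
    by (induction q) (auto simp: d funpow_add)
  have "(T ^^ e) x = x \<longleftrightarrow> d dvd e" for e
  proof
    assume "(T ^^ e) x = x"
    then have "(T ^^ (e mod d)) x = x"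
      using mult[of "e div d"] by (metis funpow_add mod_mult_div_eq o_apply)
    then have "e mod d = 0"
      using not_less_Least[of "e mod d" "\<lambda>e. e > 0 \<and> (T ^^ e) x = x"] d(1)
      by (auto simp: d_def[symmetric])
    then show "d dvd e" by auto
  qed (auto simp: mult)
  then show ?thesis using that d by blast
qed

abbreviation rot :: "idx \<Rightarrow> idx \<Rightarrow> idx list" where
  "rot i j \<equiv> Rgen i \<otimes>\<^bsub>Delta\<^esub> Rgen j"

lemma rot_closed [simp]: "rot i j \<in> carrier Delta"
  by simp

lemma funpow_closed: "T ` X \<subseteq> X \<Longrightarrow> x \<in> X \<Longrightarrow> (T ^^ s) x \<in> X"
  by (induction s) auto

lemma funpow_inj_on:
  assumes "inj_on T X" "T ` X \<subseteq> X" "x \<in> X" "y \<in> X" "(T ^^ s) x = (T ^^ s) y"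
  shows "x = y"
  using assms(5)
  by (induction s) (use assms funpow_closed in \<open>auto dest!: inj_onD\<close>)

lemma rotation_inj_on:
  fixes p q :: "'a \<Rightarrow> 'a"
  assumes p: "\<And>x. x \<in> X \<Longrightarrow> p x \<in> X \<and> p (p x) = x \<and> p x \<noteq> x"
    and q: "\<And>x. x \<in> X \<Longrightarrow> q x \<in> X \<and> q (q x) = x \<and> q x \<noteq> x"
  shows "inj_on (\<lambda>x. q (p x)) X"
proof (rule inj_onI)
  fix a b assume ab: "a \<in> X" "b \<in> X" "q (p a) = q (p b)"
  have 1: "q (q (p a)) = p a" "q (q (p b)) = p b"
    using p[OF ab(1)] p[OF ab(2)] q by blast+
  have 2: "p (p a) = a" "p (p b) = b"
    using p[OF ab(1)] p[OF ab(2)] by blast+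
  from ab(3) 1 have "p a = p b" by metis
  with 2 show "a = b" by metis
qed

text \<open>Orbits of a dihedral group generated by two fixed-point-free involutions \<open>p\<close>, \<open>q\<close>: if the two
  orbits of the rotation \<open>q \<circ> p\<close> interchanged by \<open>p\<close> met, then some reflection, being conjugate to
  \<open>p\<close> or \<open>q\<close>, would have a fixed point.\<close>

lemma rotation_orbits_disjoint:
  fixes p q :: "'a \<Rightarrow> 'a"
  assumes p: "\<And>x. x \<in> X \<Longrightarrow> p x \<in> X \<and> p (p x) = x \<and> p x \<noteq> x"
    and q: "\<And>x. x \<in> X \<Longrightarrow> q x \<in> X \<and> q (q x) = x \<and> q x \<noteq> x"
    and y: "y \<in> X"
  shows "((\<lambda>x. q (p x)) ^^ e) y \<noteq> p y"
proof
  let ?T = "\<lambda>x. q (p x)"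
  have cl: "(?T ^^ s) x \<in> X" if "x \<in> X" for s x
    using that p q by (induction s) auto
  have step1: "(?T ^^ Suc s) x = ?T ((?T ^^ s) x)" for s x
    by simp
  have step2: "(?T ^^ Suc s) x = (?T ^^ s) (?T x)" for s x
    by (simp only: funpow_Suc_right o_apply)
  have refl: "p ((?T ^^ s) (p ((?T ^^ s) x))) = x" if "x \<in> X" for s x
    using that
  proof (induction s arbitrary: x)
    case (Suc s)
    have Tx: "?T x \<in> X" using Suc.prems p q by auto
    have inner: "(?T ^^ s) (p ((?T ^^ s) (?T x))) = p (?T x)"
      using Suc.IH[OF Tx] p cl Tx by metis
    have "p ((?T ^^ Suc s) (p ((?T ^^ Suc s) x))) = p (?T ((?T ^^ s) (p ((?T ^^ s) (?T x)))))"
      by (subst step2[of s x]) (simp only: step1)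
    also have "\<dots> = x"
      unfolding inner using p q Suc.prems by simp
    finally show ?case .
  qed (use p in auto)
  assume eq: "(?T ^^ e) y = p y"
  define s where "s = e div 2"
  define z where "z = (?T ^^ s) y"
  have z: "z \<in> X" using cl y by (simp add: z_def)
  have turn: "(?T ^^ s) (p z) = p y"
    using refl[OF y, of s] p[OF cl[OF p[THEN conjunct1, OF z], of s]] p y by (metis z_def)
  have inj: "a = b" if "(?T ^^ s) a = (?T ^^ s) b" "a \<in> X" "b \<in> X" for a b
    using funpow_inj_on[OF rotation_inj_on[of X p q], OF p q _ that(2,3,1)] p q by auto
  show False
  proof (cases "even e")
    case True
    then have "(?T ^^ e) y = (?T ^^ s) z"
      by (auto simp: s_def z_def funpow_add[symmetric, THEN fun_cong, simplified] elim!: evenE)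
         (metis funpow_add mult_2 o_apply)
    then have "(?T ^^ s) z = (?T ^^ s) (p z)"
      using eq turn by simp
    then have "z = p z" using inj[of z "p z"] z p[OF z] by blast
    then show False using p[OF z] by auto
  next
    case False
    then have "e = s + Suc s"
      by (auto simp: s_def elim!: oddE)
    then have "(?T ^^ e) y = (?T ^^ s) (?T z)"
      by (simp only: funpow_add z_def o_apply step1)
    then have "?T z = p z"
      using eq turn inj[of "?T z" "p z"] p[OF z] q[of "p z"] by simp
    then show False using q[of "p z"] p[OF z] by auto
  qed
qed

lemma card_dihedral_orbit:
  fixes p q :: "'a \<Rightarrow> 'a"
  assumes p: "\<And>x. x \<in> X \<Longrightarrow> p x \<in> X \<and> p (p x) = x \<and> p x \<noteq> x"
    and q: "\<And>x. x \<in> X \<Longrightarrow> q x \<in> X \<and> q (q x) = x \<and> q x \<noteq> x"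
    and x: "x \<in> X" and d: "d > 0" "\<And>e. ((\<lambda>x. q (p x)) ^^ e) x = x \<longleftrightarrow> d dvd e"
  obtains A where "x \<in> A" "A \<subseteq> range (\<lambda>e. ((\<lambda>x. q (p x)) ^^ e) x)" "p ` (A \<union> p ` A) \<subseteq> A \<union> p ` A"
    "q ` (A \<union> p ` A) \<subseteq> A \<union> p ` A" "card (A \<union> p ` A) = 2 * d"
proof -
  let ?T = "\<lambda>x. q (p x)"
  define A where "A = (\<lambda>e. (?T ^^ e) x) ` {..<d}"
  have cl: "(?T ^^ s) x \<in> X" for s
    using x p q by (induction s) auto
  have A: "A = range (\<lambda>e. (?T ^^ e) x)"
  proof -
    have "(?T ^^ (d * c)) x = x" for c using d(2) by simp
    then have "(?T ^^ e) x = (?T ^^ (e mod d)) x" for e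
      by (metis funpow_add mod_mult_div_eq o_apply)
    then show ?thesis using d(1) by (force simp: A_def image_iff)
  qed
  have AX: "A \<subseteq> X" using cl A by auto
  have fin: "finite A" by (simp add: A_def)
  have T1: "inj_on ?T X" "?T ` X \<subseteq> X"
    using rotation_inj_on[of X p q, OF p q] p q by auto
  note Tinj = funpow_inj_on[OF T1]
  have inj: "inj_on (\<lambda>e. (?T ^^ e) x) {..<d}"
  proof -
    have "False" if "a < b" "b < d" "(?T ^^ a) x = (?T ^^ b) x" for a b
    proof -
      have "(?T ^^ b) x = (?T ^^ a) ((?T ^^ (b - a)) x)"
        using that by (metis funpow_add le_add_diff_inverse less_imp_le o_apply)
      then have "(?T ^^ (b - a)) x = x" using Tinj[OF x cl, of a "b - a"] that by simp
      then show False using d(2) that by (auto dest!: dvd_imp_le)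
    qed
    then show ?thesis by (intro inj_onI) (metis lessThan_iff linorder_neqE_nat)
  qed
  have TA: "?T ` A = A"
  proof
    show "?T ` A \<subseteq> A" unfolding A by (auto intro: range_eqI[of _ _ "Suc _"])
    then show "A \<subseteq> ?T ` A"
      using AX fin T1(1) by (simp add: endo_inj_surj inj_on_subset)
  qed
  have "A \<inter> p ` A = {}"
  proof -
    have False if "(?T ^^ a) x = p ((?T ^^ b) x)" for a b
    proof -
      have "d \<ge> 1" using d(1) by simp
      then have "b * d \<ge> b" by (metis mult.right_neutral mult_le_mono2)
      then have "a + b * d = (a + b * d - b) + b" by linarith
      then have "(?T ^^ (a + b * d - b)) ((?T ^^ b) x) = (?T ^^ (a + b * d)) x"
        by (metis funpow_add o_apply)
      also have "\<dots> = (?T ^^ a) x"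
        using d(2)[of "b * d"] by (simp add: funpow_add)
      finally show False
        using rotation_orbits_disjoint[of X p q "(?T ^^ b) x" "a + b * d - b"] p q cl that by simp
    qed
    then show ?thesis unfolding A by blast
  qed
  moreover have "card A = d" using inj by (simp add: A_def card_image)
  moreover have "card (p ` A) = card A"
    using p AX by (intro card_image inj_onI) (metis subsetD)
  ultimately have "card (A \<union> p ` A) = 2 * d"
    using fin by (simp add: card_Un_disjoint)
  moreover have "x \<in> A" unfolding A by (auto intro: range_eqI[of _ _ 0])
  moreover have "p ` (A \<union> p ` A) \<subseteq> A \<union> p ` A" using p AX by auto
  moreover have "q ` (A \<union> p ` A) \<subseteq> A \<union> p ` A"
  proof -
    have "q (p a) \<in> A" if "a \<in> A" for a using that TA by auto
    moreover have "q a \<in> p ` A" if "a \<in> A" for a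
    proof -
      obtain b where b: "b \<in> A" "a = q (p b)" using \<open>a \<in> A\<close> TA by blast
      then have "p b \<in> X" using p[of b] AX by blast
      then have "q a = p b" using q[of "p b"] b(2) by blast
      then show ?thesis using b(1) by (metis imageI)
    qed
    ultimately show ?thesis by auto
  qed
  ultimately show ?thesis using that[of A] A by simp
qed

lemma act_rot_pow:
  assumes "involutive_on \<H>" "\<omega> \<in> flags \<H>"
  shows "act \<H> (rot i j [^]\<^bsub>Delta\<^esub> (e::nat)) \<omega> = ((\<lambda>x. perm \<H> j (perm \<H> i x)) ^^ e) \<omega>"
proof -
  have "((\<lambda>x. perm \<H> j (perm \<H> i x)) ^^ e) \<omega> \<in> flags \<H> \<and>
    (act \<H> (rot i j) ^^ e) \<omega> = ((\<lambda>x. perm \<H> j (perm \<H> i x)) ^^ e) \<omega>"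
    using assms by (induction e) (auto simp: act_mult involutive_on_def)
  then show ?thesis using assms by (simp add: act_pow)
qed

text \<open>A face is the orbit of a dihedral group, that is, two rotation orbits interchanged by a
  reflection.\<close>

lemma card_face:
  assumes H: "hypermap \<H>" and \<omega>: "\<omega> \<in> flags \<H>" and ijk: "i \<noteq> j" "j \<noteq> k" "i \<noteq> k"
    and d: "d > 0" "\<And>e::nat. act \<H> (rot i j [^]\<^bsub>Delta\<^esub> e) \<omega> = \<omega> \<longleftrightarrow> d dvd e"
  shows "card (face \<H> k \<omega>) = 2 * d"
proof -
  let ?p = "perm \<H> i" and ?q = "perm \<H> j" and ?S = "generate Delta {Rgen i, Rgen j}"
  note inv = hypermap_involutive[OF H]
  have p: "x \<in> flags \<H> \<Longrightarrow> perm \<H> l x \<in> flags \<H> \<and> perm \<H> l (perm \<H> l x) = x \<and> perm \<H> l x \<noteq> x" for l x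
    using hypermapD[OF H] by auto
  have gens: "{Rgen l | l. l \<noteq> k} = {Rgen i, Rgen j}"
    by (rule generate_two_cases[OF ijk])
  have d': "((\<lambda>x. ?q (?p x)) ^^ e) \<omega> = \<omega> \<longleftrightarrow> d dvd e" for e
    using d(2) act_rot_pow[OF inv \<omega>] by simp
  obtain A where A: "\<omega> \<in> A" "A \<subseteq> range (\<lambda>e. ((\<lambda>x. ?q (?p x)) ^^ e) \<omega>)"
    "?p ` (A \<union> ?p ` A) \<subseteq> A \<union> ?p ` A" "?q ` (A \<union> ?p ` A) \<subseteq> A \<union> ?p ` A" "card (A \<union> ?p ` A) = 2 * d"
    by (rule card_dihedral_orbit[of "flags \<H>" ?p ?q, OF p p \<omega> d(1) d'])
  have AX: "A \<union> ?p ` A \<subseteq> flags \<H>"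
  proof -
    have "((\<lambda>x. ?q (?p x)) ^^ e) \<omega> \<in> flags \<H>" for e
      using p \<omega> by (induction e) auto
    then show ?thesis using A(2) p by auto
  qed
  have S: "subgroup ?S Delta"
    using face_group[of k] unfolding gens .
  have stable: "?p y \<in> A \<union> ?p ` A" "?q y \<in> A \<union> ?p ` A" if "y \<in> A \<union> ?p ` A" for y
    using A(3,4) that by blast+
  have "act \<H> w x \<in> A \<union> ?p ` A" if "w \<in> ?S" "x \<in> A \<union> ?p ` A" for w x
    using that
  proof (induction arbitrary: x rule: generate.induct)
    case (eng h1 h2)
    have "x \<in> flags \<H>" using eng.prems AX by blast
    then show ?case
      using eng act_mult[OF inv, of x h1 h2] by simp
  next
    case (incl h)
    then show ?case using stable[of x] by (auto simp del: Un_iff)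
  next
    case (inv h)
    then show ?case using stable[of x] by (auto simp del: Un_iff)
  qed simp
  then have "face \<H> k \<omega> \<subseteq> A \<union> ?p ` A"
    unfolding face_def gens using A(1) by auto
  moreover have "A \<union> ?p ` A \<subseteq> face \<H> k \<omega>"
  proof -
    have r: "Rgen i \<in> ?S" "Rgen j \<in> ?S" by (auto intro: generate.incl)
    have pow: "rot i j [^]\<^bsub>Delta\<^esub> (e::nat) \<in> ?S" for e
      by (induction e) (auto intro: subgroup.one_closed[OF S] subgroup.m_closed[OF S] r)
    have "((\<lambda>x. ?q (?p x)) ^^ e) \<omega> \<in> face \<H> k \<omega>" "?p (((\<lambda>x. ?q (?p x)) ^^ e) \<omega>) \<in> face \<H> k \<omega>" for e
    proof -
      have "act \<H> (rot i j [^]\<^bsub>Delta\<^esub> e) \<omega> \<in> face \<H> k \<omega>"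
        unfolding face_def gens using pow by blast
      then show "((\<lambda>x. ?q (?p x)) ^^ e) \<omega> \<in> face \<H> k \<omega>"
        by (simp only: act_rot_pow[OF inv \<omega>])
      have "act \<H> (rot i j [^]\<^bsub>Delta\<^esub> e \<otimes>\<^bsub>Delta\<^esub> Rgen i) \<omega> \<in> face \<H> k \<omega>"
        unfolding face_def gens using subgroup.m_closed[OF S pow r(1)] by blast
      then show "?p (((\<lambda>x. ?q (?p x)) ^^ e) \<omega>) \<in> face \<H> k \<omega>"
        by (simp only: act_rot_pow[OF inv \<omega>] act_mult[OF inv \<omega>] act_Rgen)
    qed
    then show ?thesis using A(2) by blast
  qed
  ultimately show ?thesis using A(5) by auto
qed

text \<open>Read backwards, the valency of a face is a period of the rotation around it: this is how the
  relators enter the flag stabilisers of a uniform hypermap.\<close>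

lemma rot_valency:
  assumes H: "hypermap \<H>" and \<omega>: "\<omega> \<in> flags \<H>" and ijk: "i \<noteq> j" "j \<noteq> k" "i \<noteq> k"
  shows "card (face \<H> k \<omega>) = 2 * valency (face \<H> k \<omega>)"
    and "valency (face \<H> k \<omega>) > 0"
    and "act \<H> (rot i j [^]\<^bsub>Delta\<^esub> valency (face \<H> k \<omega>)) \<omega> = \<omega>"
proof -
  note inv = hypermap_involutive[OF H]
  let ?T = "\<lambda>x. perm \<H> j (perm \<H> i x)"
  have "inj_on ?T (flags \<H>)" "?T ` flags \<H> \<subseteq> flags \<H>"
    using rotation_inj_on[of "flags \<H>" "perm \<H> i" "perm \<H> j"] hypermapD(3,4,5)[OF H] by auto
  then have "bij_betw ?T (flags \<H>) (flags \<H>)"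
    using hypermapD(1)[OF H] by (simp add: bij_betw_def endo_inj_surj)
  then obtain d where d: "d > 0" "\<And>e. (?T ^^ e) \<omega> = \<omega> \<longleftrightarrow> d dvd e"
    using period_exists[OF hypermapD(1)[OF H] _ \<omega>] by metis
  then have "card (face \<H> k \<omega>) = 2 * d"
    using card_face[OF H \<omega> ijk d(1)] act_rot_pow[OF inv \<omega>] by simp
  then show "card (face \<H> k \<omega>) = 2 * valency (face \<H> k \<omega>)" "valency (face \<H> k \<omega>) > 0"
    "act \<H> (rot i j [^]\<^bsub>Delta\<^esub> valency (face \<H> k \<omega>)) \<omega> = \<omega>"
    using d act_rot_pow[OF inv \<omega>] by (auto simp: valency_def)
qed

section \<open>Coset hypermaps\<close>

lemma coset_hypermap_simps [simp]:
  "flags (coset_hypermap M) = rcosets\<^bsub>Delta\<^esub> M"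
  "perm (coset_hypermap M) i C = C #>\<^bsub>Delta\<^esub> Rgen i"
  by (simp_all add: coset_hypermap_def)

context
  fixes M assumes M: "subgroup M Delta"
begin

lemma M_sub: "M \<subseteq> carrier Delta"
  by (rule subgroup.subset[OF M])

lemma coset_flags: "C \<in> rcosets\<^bsub>Delta\<^esub> M \<longleftrightarrow> (\<exists>g\<in>carrier Delta. C = M #>\<^bsub>Delta\<^esub> g)"
  by (auto simp: RCOSETS_def)

lemma coset_involutive: "involutive_on (coset_hypermap M)"
  unfolding involutive_on_def
proof (intro allI ballI)
  fix i C assume "C \<in> flags (coset_hypermap M)"
  then obtain g where "g \<in> carrier Delta" "C = M #>\<^bsub>Delta\<^esub> g"
    by (auto simp: coset_flags)
  then show "perm (coset_hypermap M) i C \<in> flags (coset_hypermap M) \<and>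
      perm (coset_hypermap M) i (perm (coset_hypermap M) i C) = C"
    using M_sub by (auto simp: coset_flags Delta.coset_mult_assoc Delta.m_assoc intro!: bexI[of _ "g \<otimes>\<^bsub>Delta\<^esub> Rgen i"])
qed

lemma act_coset:
  assumes "w \<in> carrier Delta" "g \<in> carrier Delta"
  shows "act (coset_hypermap M) w (M #>\<^bsub>Delta\<^esub> g) = M #>\<^bsub>Delta\<^esub> (g \<otimes>\<^bsub>Delta\<^esub> w)"
  using assms
proof (induction w arbitrary: g rule: Delta_induct)
  case (step i w)
  have "M #>\<^bsub>Delta\<^esub> g \<in> flags (coset_hypermap M)"
    using step by (auto simp: coset_flags)
  then show ?case
    using step M_sub act_mult[OF coset_involutive, of "M #>\<^bsub>Delta\<^esub> g" "Rgen i" w]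
    by (simp add: Delta.coset_mult_assoc Delta.m_assoc)
qed simp

lemma act_coset_fixes:
  assumes "w \<in> carrier Delta" "g \<in> carrier Delta"
  shows "act (coset_hypermap M) w (M #>\<^bsub>Delta\<^esub> g) = M #>\<^bsub>Delta\<^esub> g
    \<longleftrightarrow> g \<otimes>\<^bsub>Delta\<^esub> w \<otimes>\<^bsub>Delta\<^esub> inv\<^bsub>Delta\<^esub> g \<in> M"
  using assms by (simp add: act_coset Delta.rcoset_eq_iff[OF M])

lemma hypermap_coset:
  assumes "finite (rcosets\<^bsub>Delta\<^esub> M)" "M \<subseteq> Delta_plus"
  shows "hypermap (coset_hypermap M)"
  unfolding hypermap_def
proof (intro conjI allI ballI)
  have one: "M #>\<^bsub>Delta\<^esub> \<one>\<^bsub>Delta\<^esub> \<in> rcosets\<^bsub>Delta\<^esub> M"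
    using coset_flags by blast
  show "finite (flags (coset_hypermap M))" "flags (coset_hypermap M) \<noteq> {}"
    using assms one by auto
  fix i C assume C: "C \<in> flags (coset_hypermap M)"
  then show "perm (coset_hypermap M) i C \<in> flags (coset_hypermap M)"
    "perm (coset_hypermap M) i (perm (coset_hypermap M) i C) = C"
    using coset_involutive by (auto simp: involutive_on_def)
  obtain g where g: "g \<in> carrier Delta" "C = M #>\<^bsub>Delta\<^esub> g"
    using C by (auto simp: coset_flags)
  have "g \<otimes>\<^bsub>Delta\<^esub> Rgen i \<otimes>\<^bsub>Delta\<^esub> inv\<^bsub>Delta\<^esub> g \<notin> Delta_plus"
    using g by (simp add: Delta_plus_def even_length_mult)
  then show "perm (coset_hypermap M) i C \<noteq> C"
    using act_coset_fixes[of "Rgen i" g] g assms(2) by auto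
next
  fix C D assume "C \<in> flags (coset_hypermap M)" "D \<in> flags (coset_hypermap M)"
  then obtain g h where gh: "g \<in> carrier Delta" "C = M #>\<^bsub>Delta\<^esub> g" "h \<in> carrier Delta" "D = M #>\<^bsub>Delta\<^esub> h"
    by (auto simp: coset_flags)
  then show "\<exists>w\<in>carrier Delta. act (coset_hypermap M) w C = D"
    by (intro bexI[of _ "inv\<^bsub>Delta\<^esub> g \<otimes>\<^bsub>Delta\<^esub> h"]) (simp_all add: act_coset Delta.m_assoc[symmetric])
qed

text \<open>The flag chosen by \<open>hsub\<close> is unknown, so \<open>M\<close> is recovered up to conjugation only.\<close>

lemma hsub_coset:
  obtains g where "g \<in> carrier Delta"
    "hsub (coset_hypermap M) = {w \<in> carrier Delta. g \<otimes>\<^bsub>Delta\<^esub> w \<otimes>\<^bsub>Delta\<^esub> inv\<^bsub>Delta\<^esub> g \<in> M}"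
proof -
  have "M #>\<^bsub>Delta\<^esub> \<one>\<^bsub>Delta\<^esub> \<in> flags (coset_hypermap M)"
    using coset_flags by auto
  then have "(SOME \<omega>. \<omega> \<in> flags (coset_hypermap M)) \<in> flags (coset_hypermap M)"
    by (rule someI)
  then obtain g where "g \<in> carrier Delta" "(SOME \<omega>. \<omega> \<in> flags (coset_hypermap M)) = M #>\<^bsub>Delta\<^esub> g"
    by (auto simp: coset_flags)
  then show ?thesis
    using that[of g] act_coset_fixes[of _ g] by (auto simp: hsub_def flag_stabiliser_def)
qed

end

lemma normal_conj_iff:
  assumes "N \<lhd> Delta" "g \<in> carrier Delta" "w \<in> carrier Delta"
  shows "g \<otimes>\<^bsub>Delta\<^esub> w \<otimes>\<^bsub>Delta\<^esub> inv\<^bsub>Delta\<^esub> g \<in> N \<longleftrightarrow> w \<in> N"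
proof
  assume "g \<otimes>\<^bsub>Delta\<^esub> w \<otimes>\<^bsub>Delta\<^esub> inv\<^bsub>Delta\<^esub> g \<in> N"
  then have "inv\<^bsub>Delta\<^esub> g \<otimes>\<^bsub>Delta\<^esub> (g \<otimes>\<^bsub>Delta\<^esub> w \<otimes>\<^bsub>Delta\<^esub> inv\<^bsub>Delta\<^esub> g) \<otimes>\<^bsub>Delta\<^esub> inv\<^bsub>Delta\<^esub> (inv\<^bsub>Delta\<^esub> g) \<in> N"
    using assms Delta.normal_invE(2)[OF assms(1)] by (meson Delta.inv_closed)
  moreover have "inv\<^bsub>Delta\<^esub> g \<otimes>\<^bsub>Delta\<^esub> (g \<otimes>\<^bsub>Delta\<^esub> w \<otimes>\<^bsub>Delta\<^esub> inv\<^bsub>Delta\<^esub> g) \<otimes>\<^bsub>Delta\<^esub> inv\<^bsub>Delta\<^esub> (inv\<^bsub>Delta\<^esub> g) = w"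
    using assms by (simp add: Delta.m_assoc) (simp add: Delta.m_assoc[symmetric])
  ultimately show "w \<in> N" by simp
qed (use assms Delta.normal_invE(2) in blast)

lemma hsub_coset_normal:
  assumes "N \<lhd> Delta"
  shows "hsub (coset_hypermap N) = N"
proof -
  have N: "subgroup N Delta" using assms by (rule normal_imp_subgroup)
  obtain g where g: "g \<in> carrier Delta"
    "hsub (coset_hypermap N) = {w \<in> carrier Delta. g \<otimes>\<^bsub>Delta\<^esub> w \<otimes>\<^bsub>Delta\<^esub> inv\<^bsub>Delta\<^esub> g \<in> N}"
    using hsub_coset[OF N] .
  then show ?thesis
    using normal_conj_iff[OF assms] subgroup.subset[OF N] by auto
qed

lemma hypermap_iso_refl: "hypermap_iso \<H> \<H>"
  unfolding hypermap_iso_def by (intro exI[of _ id]) auto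

lemma hypermap_iso_coset:
  assumes "hypermap \<H>"
  shows "hypermap_iso (coset_hypermap (hsub \<H>)) \<H>"
proof -
  note inv = hypermap_involutive[OF assms]
  define \<omega> where "\<omega> = (SOME \<omega>. \<omega> \<in> flags \<H>)"
  have \<omega>: "\<omega> \<in> flags \<H>"
    unfolding \<omega>_def using hypermapD(2)[OF assms] by (simp add: some_in_eq)
  have hs: "hsub \<H> = flag_stabiliser \<H> \<omega>"
    by (simp add: hsub_def \<omega>_def)
  let ?M = "flag_stabiliser \<H> \<omega>"
  note M = flag_stabiliser_subgroup[OF inv \<omega>]
  have eq: "?M #>\<^bsub>Delta\<^esub> u = ?M #>\<^bsub>Delta\<^esub> v \<longleftrightarrow> act \<H> u \<omega> = act \<H> v \<omega>"
    if uv: "u \<in> carrier Delta" "v \<in> carrier Delta" for u v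
    using Delta.rcoset_eq_iff[OF M uv] stabiliser_mem_iff[OF inv \<omega> uv] by simp
  define f where "f C = act \<H> (SOME u. u \<in> carrier Delta \<and> C = ?M #>\<^bsub>Delta\<^esub> u) \<omega>" for C
  have f: "f (?M #>\<^bsub>Delta\<^esub> u) = act \<H> u \<omega>" if "u \<in> carrier Delta" for u
    unfolding f_def by (rule someI2[of _ u]) (use that eq in auto)
  have "bij_betw f (rcosets\<^bsub>Delta\<^esub> ?M) (flags \<H>)"
    unfolding bij_betw_def
  proof
    show "inj_on f (rcosets\<^bsub>Delta\<^esub> ?M)"
      by (rule inj_onI) (use coset_flags[OF M] f eq in metis)
    show "f ` (rcosets\<^bsub>Delta\<^esub> ?M) = flags \<H>"
    proof
      show "f ` (rcosets\<^bsub>Delta\<^esub> ?M) \<subseteq> flags \<H>"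
        using act_closed[OF inv \<omega>] by (auto simp: coset_flags[OF M] f)
      show "flags \<H> \<subseteq> f ` (rcosets\<^bsub>Delta\<^esub> ?M)"
      proof
        fix \<omega>' assume "\<omega>' \<in> flags \<H>"
        then obtain w where "w \<in> carrier Delta" "act \<H> w \<omega> = \<omega>'"
          using hypermapD(6)[OF assms \<omega>] by blast
        then show "\<omega>' \<in> f ` (rcosets\<^bsub>Delta\<^esub> ?M)"
          using f[of w] coset_flags[OF M] by (metis imageI)
      qed
    qed
  qed
  moreover have "f (C #>\<^bsub>Delta\<^esub> Rgen i) = perm \<H> i (f C)" if C: "C \<in> rcosets\<^bsub>Delta\<^esub> ?M" for i C
  proof -
    obtain g where "g \<in> carrier Delta" "C = ?M #>\<^bsub>Delta\<^esub> g"
      using C by (auto simp: coset_flags[OF M])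
    then show ?thesis
      using subgroup.subset[OF M] by (simp add: Delta.coset_mult_assoc f act_mult[OF inv \<omega>])
  qed
  ultimately show ?thesis
    unfolding hypermap_iso_def hs by auto
qed

lemma even_card_flags:
  assumes "hypermap \<H>"
  shows "even (card (flags \<H>))"
proof -
  have "even (card (\<Union> (faces \<H> I2)))"
  proof (rule dvd_partition)
    show "finite (\<Union> (faces \<H> I2))"
      using hypermapD(1)[OF assms] by (simp add: faces_partition(1)[OF assms])
    show "\<forall>F\<in>faces \<H> I2. even (card F)"
      using rot_valency(1)[OF assms, of _ I0 I1 I2] by (auto simp: faces_eq)
    show "\<forall>A\<in>faces \<H> I2. \<forall>B\<in>faces \<H> I2. A \<noteq> B \<longrightarrow> A \<inter> B = {}"
      using faces_partition(2)[OF assms, of I2] by (simp add: pairwise_def disjnt_def)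
  qed
  then show ?thesis by (simp add: faces_partition(1)[OF assms])
qed

lemma UNIV_idx: "(UNIV :: idx set) = {I0, I1, I2}"
  using idx.exhaust by blast

lemma euler_char_sum:
  assumes "hypermap \<H>"
  shows "(of_int (euler_char \<H>) :: rat) =
    (\<Sum>k\<in>UNIV. \<Sum>\<omega>\<in>flags \<H>. 1 / of_nat (card (face \<H> k \<omega>))) - of_nat (card (flags \<H>)) / 2"
proof -
  obtain m where "card (flags \<H>) = 2 * m"
    using even_card_flags[OF assms] by (elim evenE)
  then show ?thesis
    by (simp add: euler_char_def card_faces_sum[OF assms, symmetric] UNIV_idx)
qed

lemma euler_char_uniform:
  assumes H: "hypermap \<H>" and card: "\<And>k \<omega>. \<omega> \<in> flags \<H> \<Longrightarrow> card (face \<H> k \<omega>) = 2 * t k"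
  shows "(of_int (euler_char \<H>) :: rat) = of_nat (card (flags \<H>)) / 2 * ((\<Sum>k\<in>UNIV. 1 / of_nat (t k)) - 1)"
proof -
  have "(\<Sum>\<omega>\<in>flags \<H>. 1 / of_nat (card (face \<H> k \<omega>)) :: rat) = of_nat (card (flags \<H>)) / 2 * (1 / of_nat (t k))" for k
    using card by simp
  then show ?thesis
    unfolding euler_char_sum[OF H] by (simp only: sum_distrib_left[symmetric]) (simp add: algebra_simps)
qed

section \<open>Regular hypermaps and spherical types\<close>

abbreviation index :: "idx list set \<Rightarrow> nat" where
  "index M \<equiv> card (rcosets\<^bsub>Delta\<^esub> M)"

definition order_mod :: "idx list set \<Rightarrow> idx list \<Rightarrow> nat \<Rightarrow> bool" where
  "order_mod N x d \<longleftrightarrow> (\<forall>e::nat. x [^]\<^bsub>Delta\<^esub> e \<in> N \<longleftrightarrow> d dvd e)"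

text \<open>Modulo \<open>N\<close> the rotations have exact orders \<open>t\<close>, and not merely orders dividing \<open>t\<close> as modulo any
  normal subgroup containing \<open>Tri t\<close>.\<close>

definition has_type :: "idx list set \<Rightarrow> (idx \<Rightarrow> nat) \<Rightarrow> bool" where
  "has_type N t \<longleftrightarrow> (\<forall>i j k. i \<noteq> j \<longrightarrow> j \<noteq> k \<longrightarrow> i \<noteq> k \<longrightarrow> order_mod N (rot i j) (t k))"

definition ty :: "nat \<Rightarrow> nat \<Rightarrow> nat \<Rightarrow> idx \<Rightarrow> nat" where
  "ty l m n k = (case k of I0 \<Rightarrow> l | I1 \<Rightarrow> m | I2 \<Rightarrow> n)"

lemma ty_simps [simp]: "ty l m n I0 = l" "ty l m n I1 = m" "ty l m n I2 = n"
  by (simp_all add: ty_def)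

lemma inv_rot: "inv\<^bsub>Delta\<^esub> (rot i j) = rot j i"
  by (simp add: Delta.inv_mult_group)

lemma inv_rot_pow: "inv\<^bsub>Delta\<^esub> (rot i j [^]\<^bsub>Delta\<^esub> (e::nat)) = rot j i [^]\<^bsub>Delta\<^esub> e"
  by (simp add: Delta.nat_pow_inv[symmetric] inv_rot)

lemma rot_pow_swap:
  assumes "subgroup N Delta"
  shows "rot i j [^]\<^bsub>Delta\<^esub> (e::nat) \<in> N \<longleftrightarrow> rot j i [^]\<^bsub>Delta\<^esub> e \<in> N"
  using subgroup.m_inv_closed[OF assms] inv_rot_pow by metis

lemma order_mod_swap:
  "subgroup N Delta \<Longrightarrow> order_mod N (rot i j) d \<longleftrightarrow> order_mod N (rot j i) d"
  using rot_pow_swap by (simp add: order_mod_def)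

text \<open>The two orientations of a rotation are inverse to each other, so three cases are left.\<close>

lemma distinct_idx_cases:
  assumes "i \<noteq> j" "j \<noteq> k" "i \<noteq> k"
    and "P I1 I2 I0" "P I2 I0 I1" "P I0 I1 I2" and "\<And>i j k. P i j k \<Longrightarrow> P j i k"
  shows "P i j k"
  using assms by (cases i; cases j; cases k) auto

lemma has_typeI:
  assumes "subgroup N Delta" "order_mod N (rot I1 I2) (t I0)" "order_mod N (rot I2 I0) (t I1)"
    "order_mod N (rot I0 I1) (t I2)"
  shows "has_type N t"
  unfolding has_type_def
  by (intro allI impI, rule distinct_idx_cases) (use assms order_mod_swap[OF assms(1)] in auto)

text \<open>By normality all flags have the same stabiliser \<open>N\<close>, so all \<open>k\<close>-faces have the same size.\<close>

lemma card_face_normal: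
  assumes N: "N \<lhd> Delta" and H: "hypermap (coset_hypermap N)"
    and t: "has_type N t" "\<And>k. t k > 0" and C: "C \<in> flags (coset_hypermap N)"
  shows "card (face (coset_hypermap N) k C) = 2 * t k"
proof -
  note sg = normal_imp_subgroup[OF N]
  obtain g where g: "g \<in> carrier Delta" "C = N #>\<^bsub>Delta\<^esub> g"
    using C coset_flags[OF sg] by auto
  obtain i j where ijk: "i \<noteq> j" "j \<noteq> k" "i \<noteq> k"
    by (cases k) auto
  have "act (coset_hypermap N) (rot i j [^]\<^bsub>Delta\<^esub> e) C = C \<longleftrightarrow> t k dvd e" for e :: nat
    using g t(1) ijk act_coset_fixes[OF sg _ g(1)] normal_conj_iff[OF N g(1)]
    by (auto simp: has_type_def order_mod_def)
  then show ?thesis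
    by (rule card_face[OF H C ijk t(2)])
qed

lemma regular_hypermap:
  assumes N: "N \<lhd> Delta" "N \<subseteq> Delta_plus" "finite (rcosets\<^bsub>Delta\<^esub> N)"
    and t: "has_type N t" "\<And>k. t k > 0"
  shows "hypermap (coset_hypermap N)" "uniform (coset_hypermap N) (t I0) (t I1) (t I2)"
    "(of_int (euler_char (coset_hypermap N)) :: rat)
      = of_nat (index N) / 2 * ((\<Sum>k\<in>UNIV. 1 / of_nat (t k)) - 1)"
proof -
  show H: "hypermap (coset_hypermap N)"
    using hypermap_coset N by (simp add: normal_imp_subgroup)
  note f = card_face_normal[OF N(1) H t]
  show "uniform (coset_hypermap N) (t I0) (t I1) (t I2)"
    using f by (auto simp: uniform_def faces_eq valency_def)
  show "(of_int (euler_char (coset_hypermap N)) :: rat)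
      = of_nat (index N) / 2 * ((\<Sum>k\<in>UNIV. 1 / of_nat (t k)) - 1)"
    using euler_char_uniform[OF H f] by simp
qed

definition relators :: "(idx \<Rightarrow> nat) \<Rightarrow> idx list set" where
  "relators t = {rot i j [^]\<^bsub>Delta\<^esub> t k | i j k. i \<noteq> j \<and> j \<noteq> k \<and> i \<noteq> k}"

definition Tri :: "(idx \<Rightarrow> nat) \<Rightarrow> idx list set" where
  "Tri t = normal_closure Delta (relators t)"

lemma relators_closed: "relators t \<subseteq> carrier Delta"
  by (auto simp: relators_def)

lemma Tri_normal: "Tri t \<lhd> Delta"
  unfolding Tri_def by (rule Delta.normal_closure_normal[OF relators_closed])

lemma Tri_subgroup: "subgroup (Tri t) Delta"
  by (rule normal_imp_subgroup[OF Tri_normal])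

lemma relator_in_Tri: "i \<noteq> j \<Longrightarrow> j \<noteq> k \<Longrightarrow> i \<noteq> k \<Longrightarrow> rot i j [^]\<^bsub>Delta\<^esub> t k \<in> Tri t"
  unfolding Tri_def by (rule subsetD[OF normal_closure_subset]) (auto simp: relators_def)

lemma Tri_least:
  assumes N: "N \<lhd> Delta" and "rot I1 I2 [^]\<^bsub>Delta\<^esub> t I0 \<in> N" "rot I2 I0 [^]\<^bsub>Delta\<^esub> t I1 \<in> N"
    "rot I0 I1 [^]\<^bsub>Delta\<^esub> t I2 \<in> N"
  shows "Tri t \<subseteq> N"
  unfolding Tri_def
proof (rule normal_closure_least[OF N])
  have "rot i j [^]\<^bsub>Delta\<^esub> t k \<in> N" if "i \<noteq> j" "j \<noteq> k" "i \<noteq> k" for i j k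
    using that
    by (rule distinct_idx_cases) (use assms rot_pow_swap[OF normal_imp_subgroup[OF N]] in auto)
  then show "relators t \<subseteq> N" by (auto simp: relators_def)
qed

lemma rot_pow_Delta_plus: "rot i j [^]\<^bsub>Delta\<^esub> (e::nat) \<in> Delta_plus"
proof -
  have "even (length (rot i j [^]\<^bsub>Delta\<^esub> e))"
    by (induction e) (auto simp: even_length_mult)
  then show ?thesis by (simp add: Delta_plus_def)
qed

lemma Tri_Delta_plus: "Tri t \<subseteq> Delta_plus"
  by (rule Tri_least[OF Delta_plus_normal]) (rule rot_pow_Delta_plus)+

text \<open>A spherical type: the extended triangle group \<open>\<Delta> / Tri t\<close> is finite, its rotations have the
  prescribed orders, and its order is the number of flags forced by Euler characteristic \<open>2\<close>.\<close>

definition spherical_type :: "(idx \<Rightarrow> nat) \<Rightarrow> bool" where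
  "spherical_type t \<longleftrightarrow> (\<forall>k. t k > 0) \<and> finite (rcosets\<^bsub>Delta\<^esub> (Tri t)) \<and> has_type (Tri t) t \<and>
     of_nat (index (Tri t)) * ((\<Sum>k\<in>UNIV. 1 / of_nat (t k)) - 1) = (4 :: rat)"

lemma spherical_type_hypermap:
  assumes "spherical_type t"
  shows "hypermap (coset_hypermap (Tri t))" "spherical (coset_hypermap (Tri t))"
    "uniform (coset_hypermap (Tri t)) (t I0) (t I1) (t I2)"
proof -
  have t: "finite (rcosets\<^bsub>Delta\<^esub> (Tri t))" "has_type (Tri t) t" "\<And>k. t k > 0"
    using assms by (auto simp: spherical_type_def)
  note r = regular_hypermap[OF Tri_normal Tri_Delta_plus t]
  then show "hypermap (coset_hypermap (Tri t))" "uniform (coset_hypermap (Tri t)) (t I0) (t I1) (t I2)"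
    by blast+
  have "(of_int (euler_char (coset_hypermap (Tri t))) :: rat) = 4 / 2"
    unfolding r(3) using assms by (simp add: spherical_type_def)
  then show "spherical (coset_hypermap (Tri t))"
    unfolding spherical_def by simp
qed

text \<open>Uniqueness: the relators lie in every flag stabiliser of a uniform hypermap, and Euler
  characteristic \<open>2\<close> forces the index of the stabiliser to be that of the normal closure of the
  relators.\<close>

lemma spherical_type_unique:
  assumes t: "spherical_type t" and H: "hypermap \<H>" and S: "spherical \<H>"
    and U: "uniform \<H> (t I0) (t I1) (t I2)"
  shows "hsub \<H> = Tri t"
proof -
  note inv = hypermap_involutive[OF H]
  define \<omega> where "\<omega> = (SOME \<omega>. \<omega> \<in> flags \<H>)"
  have \<omega>: "\<omega> \<in> flags \<H>"
    unfolding \<omega>_def using hypermapD(2)[OF H] by (simp add: some_in_eq)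
  have hs: "hsub \<H> = flag_stabiliser \<H> \<omega>"
    by (simp add: hsub_def \<omega>_def)
  have val: "valency (face \<H> k \<omega>') = t k" if "\<omega>' \<in> flags \<H>" for k \<omega>'
    using U that by (cases k) (auto simp: uniform_def faces_eq)
  have cf: "card (face \<H> k \<omega>') = 2 * t k" if "\<omega>' \<in> flags \<H>" for k \<omega>'
  proof -
    obtain i j where "i \<noteq> j" "j \<noteq> k" "i \<noteq> k" by (cases k) auto
    then show ?thesis using rot_valency(1)[OF H that] val[OF that] by metis
  qed
  define K where "K = {w \<in> carrier Delta. \<forall>\<omega>'\<in>flags \<H>. act \<H> w \<omega>' = \<omega>'}"
  have K: "K \<lhd> Delta"
  proof (rule Delta.normal_invI)
    have iv: "act \<H> (inv\<^bsub>Delta\<^esub> w) \<omega>' = \<omega>'" if "w \<in> K" "\<omega>' \<in> flags \<H>" for w \<omega>'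
      using act_inv[OF inv that(2), of w] that by (simp add: K_def)
    show "subgroup K Delta"
      by (rule Delta.subgroupI)
        (use iv in \<open>auto simp: K_def act_mult[OF inv] intro: exI[of _ "\<one>\<^bsub>Delta\<^esub>"]\<close>)
  next
    fix x h assume x: "x \<in> carrier Delta" "h \<in> K"
    have "act \<H> (inv\<^bsub>Delta\<^esub> x) (act \<H> h (act \<H> x \<omega>')) = \<omega>'" if "\<omega>' \<in> flags \<H>" for \<omega>'
      using x that act_closed[OF inv] act_inv[OF inv] by (simp add: K_def)
    then show "x \<otimes>\<^bsub>Delta\<^esub> h \<otimes>\<^bsub>Delta\<^esub> inv\<^bsub>Delta\<^esub> x \<in> K"
      using x act_closed[OF inv] by (auto simp: K_def act_mult[OF inv])
  qed
  have "rot i j [^]\<^bsub>Delta\<^esub> t k \<in> K" if "i \<noteq> j" "j \<noteq> k" "i \<noteq> k" for i j k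
    using rot_valency(3)[OF H _ that] val by (auto simp: K_def)
  then have "Tri t \<subseteq> K"
    by (intro Tri_least[OF K]) auto
  then have sub: "Tri t \<subseteq> hsub \<H>"
    using \<omega> by (auto simp: hs K_def flag_stabiliser_def)
  have "(4 :: rat) = of_nat (card (flags \<H>)) * ((\<Sum>k\<in>UNIV. 1 / of_nat (t k)) - 1)"
    using euler_char_uniform[OF H cf] S by (simp add: spherical_def)
  then have "of_nat (card (flags \<H>)) = (of_nat (index (Tri t)) :: rat)"
    using t unfolding spherical_type_def
    by (metis mult_right_cancel mult_zero_right zero_neq_numeral)
  then have "index (Tri t) = index (hsub \<H>)"
    by (simp add: hs card_flags_index[OF H \<omega>])
  then show ?thesis
    using Delta.subgroup_eq_of_index_le[OF Tri_subgroup _ sub] t flag_stabiliser_subgroup[OF inv \<omega>]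
    by (simp add: hs spherical_type_def)
qed

text \<open>\<open>uniform_spherical\<close> chooses among hypermaps on natural numbers, whereas the existence proof
  produces cosets; finiteness allows the latter to be relabelled.\<close>

lemma nat_copy:
  fixes \<G> :: "'a hypermap"
  assumes G: "hypermap \<G>"
  obtains \<H> :: "nat hypermap" where "hypermap \<H>" "euler_char \<H> = euler_char \<G>"
    "\<forall>l m n. uniform \<G> l m n \<longrightarrow> uniform \<H> l m n"
proof -
  note inv = hypermap_involutive[OF G]
  obtain f where f: "bij_betw f (flags \<G>) {0..<card (flags \<G>)}"
    using ex_bij_betw_finite_nat[OF hypermapD(1)[OF G]] by blast
  define f' where "f' = the_inv_into (flags \<G>) f"
  have inj: "inj_on f (flags \<G>)"
    using f by (rule bij_betw_imp_inj_on)
  have f': "f' (f x) = x" if "x \<in> flags \<G>" for x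
    using that inj by (simp add: f'_def the_inv_into_f_f)
  define \<H> :: "nat hypermap" where
    "\<H> = \<lparr>flags = f ` flags \<G>, perm = (\<lambda>i x. f (perm \<G> i (f' x)))\<rparr>"
  have fl: "flags \<H> = f ` flags \<G>" by (simp add: \<H>_def)
  have pm: "perm \<H> i (f x) = f (perm \<G> i x)" if "x \<in> flags \<G>" for i x
    using that by (simp add: \<H>_def f')
  have ac: "act \<H> w (f x) = f (act \<G> w x)" if "x \<in> flags \<G>" for w x
    using that
  proof (induction w arbitrary: x)
    case (Cons i w)
    then show ?case
      using pm[of x i] hypermapD(3)[OF G, of x i] by (simp add: act_def)
  qed (simp add: act_def)
  have H: "hypermap \<H>"
    unfolding hypermap_def
  proof (intro conjI allI ballI)
    show "finite (flags \<H>)" "flags \<H> \<noteq> {}"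
      using hypermapD(1,2)[OF G] by (auto simp: fl)
  next
    fix i y assume "y \<in> flags \<H>"
    then obtain x where x: "x \<in> flags \<G>" "y = f x" by (auto simp: fl)
    then have px: "perm \<G> i x \<in> flags \<G>" using hypermapD(3)[OF G] by blast
    show "perm \<H> i y \<in> flags \<H>" "perm \<H> i (perm \<H> i y) = y"
      using x px pm[OF x(1)] pm[OF px] hypermapD(4)[OF G x(1)] by (simp_all add: fl)
    show "perm \<H> i y \<noteq> y"
      using x px pm[OF x(1)] inj hypermapD(5)[OF G x(1), of i] by (metis f')
  next
    fix y z assume "y \<in> flags \<H>" "z \<in> flags \<H>"
    then obtain u v where uv: "u \<in> flags \<G>" "y = f u" "v \<in> flags \<G>" "z = f v" by (auto simp: fl)
    then obtain w where "w \<in> carrier Delta" "act \<G> w u = v"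
      using hypermapD(6)[OF G] by blast
    then show "\<exists>w\<in>carrier Delta. act \<H> w y = z"
      using uv ac by auto
  qed
  have fc: "face \<H> k (f x) = f ` face \<G> k x" if "x \<in> flags \<G>" for k x
    using ac[OF that] by (auto simp: face_def image_iff)
  have cfc: "card (face \<H> k (f x)) = card (face \<G> k x)" if "x \<in> flags \<G>" for k x
    using fc[OF that] face_subset[OF inv that] inj by (simp add: card_image inj_on_subset)
  have "(\<Sum>y\<in>flags \<H>. 1 / of_nat (card (face \<H> k y)) :: rat)
      = (\<Sum>x\<in>flags \<G>. 1 / of_nat (card (face \<G> k x)))" for k
    unfolding fl sum.reindex[OF inj] o_def using cfc by (intro sum.cong) auto
  then have "(of_int (euler_char \<H>) :: rat) = of_int (euler_char \<G>)"
    unfolding euler_char_sum[OF H] euler_char_sum[OF G] by (simp add: fl card_image[OF inj])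
  then have "euler_char \<H> = euler_char \<G>" by simp
  moreover have "uniform \<H> l m n" if "uniform \<G> l m n" for l m n
    using that cfc by (auto simp: uniform_def faces_eq fl valency_def)
  ultimately show ?thesis using that H by simp
qed

lemma uniform_spherical_type:
  assumes "spherical_type (ty l m n)"
  shows "hypermap (uniform_spherical l m n)" "hsub (uniform_spherical l m n) = Tri (ty l m n)"
proof -
  note sp = spherical_type_hypermap[OF assms]
  obtain \<H> :: "nat hypermap" where "hypermap \<H>" "euler_char \<H> = euler_char (coset_hypermap (Tri (ty l m n)))"
    "\<forall>l' m' n'. uniform (coset_hypermap (Tri (ty l m n))) l' m' n' \<longrightarrow> uniform \<H> l' m' n'"
    using nat_copy[OF sp(1)] .
  then have "hypermap \<H> \<and> spherical \<H> \<and> uniform \<H> l m n"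
    using sp by (simp add: spherical_def)
  from someI[of "\<lambda>\<H>. hypermap \<H> \<and> spherical \<H> \<and> uniform \<H> l m n", OF this]
  have *: "hypermap (uniform_spherical l m n) \<and> spherical (uniform_spherical l m n) \<and>
      uniform (uniform_spherical l m n) l m n"
    by (simp only: uniform_spherical_def)
  then show "hypermap (uniform_spherical l m n)" by simp
  show "hsub (uniform_spherical l m n) = Tri (ty l m n)"
    by (rule spherical_type_unique[OF assms]) (use * in simp_all)
qed

subsection \<open>Permuting the three kinds of faces\<close>

lemma map_push: "inj \<sigma> \<Longrightarrow> map \<sigma> (push x w) = push (\<sigma> x) (map \<sigma> w)"
  by (cases w) (auto dest: injD)

lemma map_mult:
  assumes "inj \<sigma>"
  shows "map \<sigma> (u \<otimes>\<^bsub>Delta\<^esub> v) = map \<sigma> u \<otimes>\<^bsub>Delta\<^esub> map \<sigma> v"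
proof -
  have "map \<sigma> (foldr push u v) = foldr push (map \<sigma> u) (map \<sigma> v)"
    by (induction u) (auto simp: map_push[OF assms])
  then show ?thesis by (simp add: Delta_def)
qed

lemma map_hom:
  assumes "inj \<sigma>"
  shows "group_hom Delta Delta (map \<sigma>)"
proof -
  have "distinct_adj (map \<sigma> w)" if "distinct_adj w" for w
    using that by (simp add: distinct_adj_map_iff[OF inj_on_subset[OF assms]])
  then have "map \<sigma> w \<in> carrier Delta" if "w \<in> carrier Delta" for w
    using that by (simp add: Delta_def)
  then show ?thesis
    by (auto simp: group_hom_def group_hom_axioms_def hom_def map_mult[OF assms] group_Delta)
qed

lemma map_Rgen [simp]: "map \<sigma> (Rgen i) = Rgen (\<sigma> i)"
  by (simp add: Rgen_def)

lemma (in group_hom) vimage_normal: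
  assumes "N \<lhd> H"
  shows "{x \<in> carrier G. h x \<in> N} \<lhd> G"
proof (rule G.normal_invI)
  have N: "subgroup N H" using assms by (rule normal_imp_subgroup)
  show "subgroup {x \<in> carrier G. h x \<in> N} G"
    by (rule G.subgroupI)
      (use subgroup.one_closed[OF N] subgroup.m_closed[OF N] subgroup.m_inv_closed[OF N] in auto)
qed (use H.normal_invE(2)[OF assms] in auto)

lemma map_rot_pow:
  assumes "inj \<sigma>"
  shows "map \<sigma> (rot i j [^]\<^bsub>Delta\<^esub> (e::nat)) = rot (\<sigma> i) (\<sigma> j) [^]\<^bsub>Delta\<^esub> e"
  using group_hom.hom_nat_pow[OF map_hom[OF assms], of "rot i j" e] by (simp add: map_mult[OF assms])

lemma map_Tri_subset:
  assumes "\<And>i. \<sigma> (\<sigma> i) = i"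
  shows "map \<sigma> ` Tri t \<subseteq> Tri (t \<circ> \<sigma>)"
proof -
  have inj: "inj \<sigma>" using assms by (metis injI)
  let ?N = "{w \<in> carrier Delta. map \<sigma> w \<in> Tri (t \<circ> \<sigma>)}"
  have "rot i j [^]\<^bsub>Delta\<^esub> t k \<in> ?N" if "i \<noteq> j" "j \<noteq> k" "i \<noteq> k" for i j k
    using relator_in_Tri[of "\<sigma> i" "\<sigma> j" "\<sigma> k" "t \<circ> \<sigma>"] that assms inj
    by (simp add: map_rot_pow[OF inj] inj_eq)
  then have "Tri t \<subseteq> ?N"
    by (intro Tri_least group_hom.vimage_normal[OF map_hom[OF inj] Tri_normal]) auto
  then show ?thesis by auto
qed

lemma map_Tri:
  assumes "\<And>i. \<sigma> (\<sigma> i) = i"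
  shows "map \<sigma> ` Tri t = Tri (t \<circ> \<sigma>)"
proof
  have s: "\<sigma> \<circ> \<sigma> = id" using assms by auto
  have "Tri (t \<circ> \<sigma>) = map \<sigma> ` map \<sigma> ` Tri (t \<circ> \<sigma>)"
    by (simp add: image_image s)
  also have "\<dots> \<subseteq> map \<sigma> ` Tri (t \<circ> \<sigma> \<circ> \<sigma>)"
    using map_Tri_subset[OF assms] by (rule image_mono)
  also have "t \<circ> \<sigma> \<circ> \<sigma> = t"
    using s by (simp add: o_assoc[symmetric])
  finally show "Tri (t \<circ> \<sigma>) \<subseteq> map \<sigma> ` Tri t" .
qed (rule map_Tri_subset[OF assms])

lemma map_mem_Tri:
  assumes "\<And>i. \<sigma> (\<sigma> i) = i"
  shows "map \<sigma> w \<in> Tri (t \<circ> \<sigma>) \<longleftrightarrow> w \<in> Tri t"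
proof -
  have "inj (map \<sigma>)" using assms by (metis inj_mapI injI)
  then show ?thesis
    unfolding map_Tri[OF assms, symmetric] by (simp add: inj_image_mem_iff)
qed

lemma spherical_type_perm:
  assumes s: "\<And>i. \<sigma> (\<sigma> i) = i" and t: "spherical_type t"
  shows "spherical_type (t \<circ> \<sigma>)" "index (Tri (t \<circ> \<sigma>)) = index (Tri t)"
proof -
  have inj: "inj \<sigma>" using s by (metis injI)
  have bij: "bij \<sigma>" using s by (intro o_bij[of \<sigma>]) auto
  interpret map: group_hom Delta Delta "map \<sigma>" by (rule map_hom[OF inj])
  have "\<exists>u\<in>carrier Delta. v = map \<sigma> u" if "v \<in> carrier Delta" for v
    using that s map.hom_closed by (intro bexI[of _ "map \<sigma> v"]) (simp_all add: o_def)
  then have im: "map \<sigma> ` carrier Delta = carrier Delta"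
    by auto
  have mem: "u \<otimes>\<^bsub>Delta\<^esub> inv\<^bsub>Delta\<^esub> v \<in> Tri t \<longleftrightarrow> Tri (t \<circ> \<sigma>) #>\<^bsub>Delta\<^esub> map \<sigma> u = Tri (t \<circ> \<sigma>) #>\<^bsub>Delta\<^esub> map \<sigma> v"
    if "u \<in> carrier Delta" "v \<in> carrier Delta" for u v
    using that Delta.rcoset_eq_iff[OF Tri_subgroup, of "map \<sigma> u" "map \<sigma> v"]
      map_mem_Tri[OF s, of "u \<otimes>\<^bsub>Delta\<^esub> inv\<^bsub>Delta\<^esub> v" t] by simp
  obtain h where "bij_betw h (rcosets\<^bsub>Delta\<^esub> (Tri t)) ((\<lambda>u. Tri (t \<circ> \<sigma>) #>\<^bsub>Delta\<^esub> map \<sigma> u) ` carrier Delta)"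
    by (rule Delta.bij_betw_rcosets_image[OF Tri_subgroup mem])
  moreover have "(\<lambda>u. Tri (t \<circ> \<sigma>) #>\<^bsub>Delta\<^esub> map \<sigma> u) ` carrier Delta = rcosets\<^bsub>Delta\<^esub> (Tri (t \<circ> \<sigma>))"
    by (simp add: image_image[symmetric, of _ "map \<sigma>"] im) (auto simp: RCOSETS_def)
  ultimately have h: "bij_betw h (rcosets\<^bsub>Delta\<^esub> (Tri t)) (rcosets\<^bsub>Delta\<^esub> (Tri (t \<circ> \<sigma>)))" by simp
  have "has_type (Tri (t \<circ> \<sigma>)) (t \<circ> \<sigma>)"
    unfolding has_type_def
  proof (intro allI impI)
    fix i j k :: idx assume "i \<noteq> j" "j \<noteq> k" "i \<noteq> k"
    then have "order_mod (Tri t) (rot (\<sigma> i) (\<sigma> j)) (t (\<sigma> k))"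
      using t inj by (simp add: spherical_type_def has_type_def inj_eq)
    then show "order_mod (Tri (t \<circ> \<sigma>)) (rot i j) ((t \<circ> \<sigma>) k)"
      using map_mem_Tri[OF s, of _ t] map_rot_pow[OF inj, of "\<sigma> i" "\<sigma> j"] s
      by (simp add: order_mod_def) metis
  qed
  moreover have "(\<Sum>k\<in>UNIV. 1 / of_nat (t (\<sigma> k)) :: rat) = (\<Sum>k\<in>UNIV. 1 / of_nat (t k))"
    using sum.reindex_bij_betw[of \<sigma> UNIV UNIV "\<lambda>k. 1 / of_nat (t k) :: rat"] bij by simp
  ultimately show "spherical_type (t \<circ> \<sigma>)" "index (Tri (t \<circ> \<sigma>)) = index (Tri t)"
    using t bij_betw_same_card[OF h] bij_betw_finite[OF h] by (simp_all add: spherical_type_def)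
qed

lemma Dop_Tri:
  assumes "\<And>i. \<sigma> (\<sigma> i) = i" "hsub \<H> = Tri t"
  shows "Dop \<sigma> \<H> = coset_hypermap (Tri (t \<circ> \<sigma>))" "hsub (Dop \<sigma> \<H>) = Tri (t \<circ> \<sigma>)"
  using assms by (simp_all add: Dop_def map_Tri hsub_coset_normal[OF Tri_normal])

section \<open>Bounding triangle groups from above: coset enumeration\<close>

text \<open>The orbit consists of the points \<open>T\<^sup>e x0\<close> and \<open>T\<^sup>e (f x0)\<close> with \<open>e < n\<close>, where \<open>T\<close> is the rotation
  \<open>g \<circ> f\<close>.\<close>

lemma dihedral_block:
  fixes f g :: "'x \<Rightarrow> 'x"
  assumes f: "\<And>x. f (f x) = x" and g: "\<And>x. g (g x) = x" and n: "n > 0" "\<And>x. ((\<lambda>x. g (f x)) ^^ n) x = x"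
  obtains A where "x0 \<in> A" "finite A" "card A \<le> 2 * n" "f ` A \<subseteq> A" "g ` A \<subseteq> A"
proof -
  define T where "T = (\<lambda>x. g (f x))"
  have Tn: "(T ^^ n) x = x" for x using n(2) by (simp add: T_def)
  define B where "B = (\<lambda>e. (T ^^ e) x0) ` {..<n}"
  have "(T ^^ (n * c)) x = x" for c x
    by (induction c) (simp_all add: funpow_add Tn)
  then have "(T ^^ e) x0 = (T ^^ (e mod n)) x0" for e
    by (metis funpow_add mod_mult_div_eq o_apply)
  then have B: "(T ^^ e) x0 \<in> B" for e
    unfolding B_def by (rule image_eqI[of _ _ "e mod n"]) (use n(1) in auto)
  have TB: "T b \<in> B" if "b \<in> B" for b
    using that B[of "Suc _"] by (auto simp: B_def)
  have gB: "g b \<in> f ` B" if b: "b \<in> B" for b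
  proof -
    obtain e where "b = (T ^^ e) x0" using b by (auto simp: B_def)
    then have "b = T ((T ^^ (n - 1 + e)) x0)"
      using Tn[of "(T ^^ e) x0"] n(1) by (metis Suc_diff_1 funpow.simps(2) funpow_add o_apply)
    moreover have "g (T y) = f y" for y by (simp add: T_def g)
    ultimately have "g b = f ((T ^^ (n - 1 + e)) x0)" by metis
    then show ?thesis using B by auto
  qed
  show ?thesis
  proof
    show "x0 \<in> B \<union> f ` B" using B[of 0] by simp
    show "finite (B \<union> f ` B)" by (simp add: B_def)
    have "card B \<le> n" unfolding B_def by (metis card_image_le card_lessThan finite_lessThan)
    moreover have "card (f ` B) \<le> card B" by (rule card_image_le) (simp add: B_def)
    ultimately show "card (B \<union> f ` B) \<le> 2 * n"
      using card_Un_le[of B "f ` B"] by linarith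
    show "f ` (B \<union> f ` B) \<subseteq> B \<union> f ` B" using f by auto
    show "g ` (B \<union> f ` B) \<subseteq> B \<union> f ` B"
      using gB TB by (auto simp: T_def)
  qed
qed

text \<open>\<open>\<Delta>\<close> permutes the cosets of a normal subgroup; extended by the identity, each generator is an
  involution of the whole type, so that the relators become unconditional equations.\<close>

definition coset_step :: "idx list set \<Rightarrow> idx \<Rightarrow> idx list set \<Rightarrow> idx list set" where
  "coset_step N i C = (if C \<in> rcosets\<^bsub>Delta\<^esub> N then C #>\<^bsub>Delta\<^esub> Rgen i else C)"

lemma coset_step_pow:
  assumes N: "subgroup N Delta"
  shows "((\<lambda>C. coset_step N j (coset_step N i C)) ^^ e) C =
    (if C \<in> rcosets\<^bsub>Delta\<^esub> N then act (coset_hypermap N) (rot i j [^]\<^bsub>Delta\<^esub> e) C else C)"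
proof (cases "C \<in> rcosets\<^bsub>Delta\<^esub> N")
  case True
  have "perm (coset_hypermap N) i D \<in> rcosets\<^bsub>Delta\<^esub> N" if "D \<in> rcosets\<^bsub>Delta\<^esub> N" for i D
    using coset_involutive[OF N] that by (simp add: involutive_on_def)
  then have "((\<lambda>C. coset_step N j (coset_step N i C)) ^^ e) C \<in> rcosets\<^bsub>Delta\<^esub> N \<and>
      ((\<lambda>C. coset_step N j (coset_step N i C)) ^^ e) C
      = ((\<lambda>C. perm (coset_hypermap N) j (perm (coset_hypermap N) i C)) ^^ e) C"
    using True by (induction e) (auto simp: coset_step_def)
  then show ?thesis
    using True act_rot_pow[OF coset_involutive[OF N], of C i j e] by simp
next
  case False
  then have "((\<lambda>C. coset_step N j (coset_step N i C)) ^^ e) C = C"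
    by (induction e) (auto simp: coset_step_def)
  then show ?thesis using False by simp
qed

lemma funpow_image:
  fixes f :: "'x \<Rightarrow> 'y" and g :: "'y \<Rightarrow> 'x"
  shows "((\<lambda>Z. g ` f ` Z) ^^ e) Y = ((\<lambda>x. g (f x)) ^^ e) ` Y"
  by (induction e) (auto simp: image_image)

text \<open>The sets \<open>Y\<close> below stand for the cosets of \<open>\<langle>R\<^sub>0, R\<^sub>1\<rangle>\<close> in \<open>\<Delta> / Tri t\<close>; if enumerating them from the
  relations closes up after \<open>c\<close> steps, the group has at most \<open>c\<close> times the order of a dihedral
  group many elements.\<close>

lemma index_Tri_le:
  assumes pos: "t I2 > 0"
    and enum: "\<And>(F :: idx \<Rightarrow> idx list set set \<Rightarrow> idx list set set) Y.
      \<lbrakk>\<And>i Z. F i (F i Z) = Z;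
       \<And>i j k Z. i \<noteq> j \<Longrightarrow> j \<noteq> k \<Longrightarrow> i \<noteq> k \<Longrightarrow> ((\<lambda>Z. F j (F i Z)) ^^ t k) Z = Z;
       F I0 Y = Y; F I1 Y = Y\<rbrakk>
      \<Longrightarrow> \<exists>S. Y \<in> S \<and> finite S \<and> card S \<le> c \<and> (\<forall>i. F i ` S \<subseteq> S)"
  shows "finite (rcosets\<^bsub>Delta\<^esub> (Tri t))" "index (Tri t) \<le> 2 * t I2 * c"
proof -
  define N where "N = Tri t"
  have N: "N \<lhd> Delta" and sg: "subgroup N Delta"
    using Tri_normal Tri_subgroup by (auto simp: N_def)
  define s where "s = coset_step N"
  have inv: "s i (s i C) = C" for i C
    using coset_involutive[OF sg] by (auto simp: s_def coset_step_def involutive_on_def)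
  have rel: "((\<lambda>C. s j (s i C)) ^^ t k) C = C" if "i \<noteq> j" "j \<noteq> k" "i \<noteq> k" for i j k C
  proof (cases "C \<in> rcosets\<^bsub>Delta\<^esub> N")
    case True
    then obtain g where g: "g \<in> carrier Delta" "C = N #>\<^bsub>Delta\<^esub> g"
      using coset_flags[OF sg] by auto
    have "g \<otimes>\<^bsub>Delta\<^esub> (rot i j [^]\<^bsub>Delta\<^esub> t k) \<otimes>\<^bsub>Delta\<^esub> inv\<^bsub>Delta\<^esub> g \<in> N"
      using normal_conj_iff[OF N g(1)] relator_in_Tri[OF that, of t] by (simp add: N_def)
    then show ?thesis
      using act_coset_fixes[OF sg _ g(1)] g True by (simp add: s_def coset_step_pow[OF sg])
  qed (simp add: s_def coset_step_pow[OF sg])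
  define x0 where "x0 = N #>\<^bsub>Delta\<^esub> \<one>\<^bsub>Delta\<^esub>"
  obtain A where A: "x0 \<in> A" "finite A" "card A \<le> 2 * t I2" "s I0 ` A \<subseteq> A" "s I1 ` A \<subseteq> A"
    by (rule dihedral_block[of "s I0" "s I1" "t I2" x0]) (use inv pos rel[of I0 I1 I2] in auto)
  have stable: "s i ` A = A" if "s i ` A \<subseteq> A" for i
  proof -
    have "A = s i ` s i ` A" by (simp add: image_image inv)
    then show ?thesis using that by blast
  qed
  have "\<exists>S. A \<in> S \<and> finite S \<and> card S \<le> c \<and> (\<forall>i. (`) (s i) ` S \<subseteq> S)"
  proof (rule enum)
    show "((\<lambda>Z. s j ` s i ` Z) ^^ t k) Z = Z" if "i \<noteq> j" "j \<noteq> k" "i \<noteq> k" for i j k Z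
      using rel[OF that] by (simp add: funpow_image)
  qed (use stable A inv in \<open>auto simp: image_image\<close>)
  then obtain S where S: "A \<in> S" "finite S" "card S \<le> c" "\<And>i. (`) (s i) ` S \<subseteq> S" by blast
  define S' where "S' = {Z \<in> S. finite Z \<and> card Z \<le> 2 * t I2}"
  have S': "finite S'" "card S' \<le> c" "A \<in> S'"
    using S A card_mono[of S S'] by (auto simp: S'_def)
  have S's: "s i ` Z \<in> S'" if "Z \<in> S'" for i Z
    using that S(4)[of i] card_image_le[of Z "s i"] by (auto simp: S'_def)
  let ?U = "\<Union> S'"
  have fin: "finite ?U" using S' by (auto simp: S'_def)
  have "card ?U \<le> (\<Sum>Z\<in>S'. card Z)" by (rule card_Union_le_sum_card)
  also have "\<dots> \<le> (\<Sum>Z\<in>S'. 2 * t I2)" by (rule sum_mono) (simp add: S'_def)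
  also have "\<dots> \<le> 2 * t I2 * c" using S' by simp
  finally have cU: "card ?U \<le> 2 * t I2 * c" .
  have sU: "s i C \<in> ?U" if "C \<in> ?U" for i C
    using that S's by blast
  have "N #>\<^bsub>Delta\<^esub> (g \<otimes>\<^bsub>Delta\<^esub> w) \<in> ?U"
    if "w \<in> carrier Delta" "g \<in> carrier Delta" "N #>\<^bsub>Delta\<^esub> g \<in> ?U" for w g
    using that
  proof (induction w arbitrary: g rule: Delta_induct)
    case (step i w)
    have "s i (N #>\<^bsub>Delta\<^esub> g) = N #>\<^bsub>Delta\<^esub> (g \<otimes>\<^bsub>Delta\<^esub> Rgen i)"
      using step.prems(1) M_sub[OF sg] Delta.rcosetsI
      by (simp add: s_def coset_step_def Delta.coset_mult_assoc)
    then have "N #>\<^bsub>Delta\<^esub> (g \<otimes>\<^bsub>Delta\<^esub> Rgen i) \<in> ?U"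
      using sU[OF step.prems(2), of i] by metis
    then show ?case
      using step.IH[of "g \<otimes>\<^bsub>Delta\<^esub> Rgen i"] step.hyps step.prems(1) by (simp add: Delta.m_assoc)
  qed simp
  note orbit = this
  have "N #>\<^bsub>Delta\<^esub> \<one>\<^bsub>Delta\<^esub> \<in> ?U"
    using S'(3) A(1) unfolding x0_def by (rule UnionI)
  then have "N #>\<^bsub>Delta\<^esub> w \<in> ?U" if "w \<in> carrier Delta" for w
    using orbit[OF that, of "\<one>\<^bsub>Delta\<^esub>"] that by simp
  then have sub: "rcosets\<^bsub>Delta\<^esub> N \<subseteq> ?U"
    unfolding RCOSETS_def by blast
  show "finite (rcosets\<^bsub>Delta\<^esub> (Tri t))" "index (Tri t) \<le> 2 * t I2 * c"
    using finite_subset[OF sub fin] card_mono[OF fin sub] cU by (simp_all add: N_def)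
qed

text \<open>Enumeration of the faces of the tetrahedron, the cube and the dodecahedron from the relations
  of the involutions \<open>a\<close>, \<open>b\<close>, \<open>c\<close> alone: they are visited at increasing distance from the face \<open>x\<close>,
  and every generator that does not lead further is evaluated by the braid relations.\<close>

lemma tetrahedron_enum:
  fixes a b c :: "'x \<Rightarrow> 'x"
  assumes inv: "\<And>x. a (a x) = x" "\<And>x. b (b x) = x" "\<And>x. c (c x) = x"
    and ac: "\<And>x. c (a x) = a (c x)" and bc: "\<And>x. c (b (c x)) = b (c (b x))"
    and ab: "\<And>x. b (a (b x)) = a (b (a x))"
    and x: "a x = x" "b x = x"
  obtains S where "x \<in> S" "finite S" "card S \<le> 4" "a ` S \<subseteq> S" "b ` S \<subseteq> S" "c ` S \<subseteq> S"
proof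
  let ?x1 = "c x" let ?x2 = "b ?x1" let ?x3 = "a ?x2"
  let ?S = "set [x, ?x1, ?x2, ?x3]"
  have f: "a ?x1 = ?x1" "c ?x2 = ?x2" "c ?x3 = ?x3" "b ?x3 = ?x3"
    using ac[of x] bc[of x] ac[of ?x2] ab[of ?x1] x by simp_all
  show "a ` ?S \<subseteq> ?S" "b ` ?S \<subseteq> ?S" "c ` ?S \<subseteq> ?S"
    by (simp_all only: list.set image_insert image_empty f x inv) auto
  show "card ?S \<le> 4" by (rule order.trans[OF card_length]) simp
qed auto

lemma cube_enum:
  fixes a b c :: "'x \<Rightarrow> 'x"
  assumes inv: "\<And>x. a (a x) = x" "\<And>x. b (b x) = x" "\<And>x. c (c x) = x"
    and ac: "\<And>x. c (a x) = a (c x)" and bc: "\<And>x. c (b (c x)) = b (c (b x))"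
    and ab: "\<And>x. a (b (a (b x))) = b (a (b (a x)))"
    and x: "a x = x" "b x = x"
  obtains S where "x \<in> S" "finite S" "card S \<le> 6" "a ` S \<subseteq> S" "b ` S \<subseteq> S" "c ` S \<subseteq> S"
proof
  let ?x1 = "c x" let ?x2 = "b ?x1" let ?x3 = "a ?x2" let ?x4 = "b ?x3" let ?x5 = "c ?x4"
  let ?S = "set [x, ?x1, ?x2, ?x3, ?x4, ?x5]"
  have f: "a ?x1 = ?x1" "c ?x2 = ?x2" "c ?x3 = ?x3" "a ?x4 = ?x4"
    using ac[of x] bc[of x] ac[of ?x2] ab[of ?x1] x by simp_all
  have f': "a ?x5 = ?x5" "b ?x5 = ?x5"
    using ac[of ?x4] bc[of ?x3] f by simp_all
  show "a ` ?S \<subseteq> ?S" "b ` ?S \<subseteq> ?S" "c ` ?S \<subseteq> ?S"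
    by (simp_all only: list.set image_insert image_empty f f' x inv) auto
  show "card ?S \<le> 6" by (rule order.trans[OF card_length]) simp
qed auto

lemma dodecahedron_enum:
  fixes a b c :: "'x \<Rightarrow> 'x"
  assumes inv: "\<And>x. a (a x) = x" "\<And>x. b (b x) = x" "\<And>x. c (c x) = x"
    and ac: "\<And>x. c (a x) = a (c x)" and bc: "\<And>x. c (b (c x)) = b (c (b x))"
    and ab: "\<And>x. b (a (b (a (b x)))) = a (b (a (b (a x))))"
    and x: "a x = x" "b x = x"
  obtains S where "x \<in> S" "finite S" "card S \<le> 12" "a ` S \<subseteq> S" "b ` S \<subseteq> S" "c ` S \<subseteq> S"
proof
  let ?x1 = "c x" let ?x2 = "b ?x1" let ?x3 = "a ?x2" let ?x4 = "b ?x3" let ?x5 = "a ?x4"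
  let ?y5 = "c ?x4" let ?x6 = "c ?x5" let ?x7 = "b ?x6" let ?x8 = "a ?x7" let ?x9 = "b ?x8"
  let ?x10 = "c ?x9"
  let ?S = "set [x, ?x1, ?x2, ?x3, ?x4, ?x5, ?y5, ?x6, ?x7, ?x8, ?x9, ?x10]"
  have f1: "a ?x1 = ?x1" "c ?x2 = ?x2" "c ?x3 = ?x3"
    using ac[of x] bc[of x] ac[of ?x2] x by simp_all
  have f2: "b ?x5 = ?x5" "a ?y5 = ?x6" "a ?x6 = ?y5" "b ?y5 = ?y5"
    using ab[of ?x1] f1 ac[of ?x4] ac[of ?x5] inv bc[of ?x3] by simp_all
  have f3: "c ?x7 = ?x7" "c ?x8 = ?x8"
    using bc[of ?x5] f2 ac[of ?x7] by simp_all
  have f4: "a ?x9 = ?x9"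
    using ab[of ?y5] f2 by simp
  have f5: "a ?x10 = ?x10" "b ?x10 = ?x10"
    using ac[of ?x9] f4 bc[of ?x8] f3 by simp_all
  show "a ` ?S \<subseteq> ?S" "b ` ?S \<subseteq> ?S" "c ` ?S \<subseteq> ?S"
    by (simp_all only: list.set image_insert image_empty f1 f2 f3 f4 f5 x inv) auto
  show "card ?S \<le> 12" by (rule order.trans[OF card_length]) simp
qed auto

text \<open>A relator of even length is split into two equal alternating words; these equations are what the
  enumerations rewrite with.\<close>

lemma braid_of_pow:
  fixes a b :: "'x \<Rightarrow> 'x"
  assumes inv: "\<And>x. a (a x) = x" "\<And>x. b (b x) = x"
  shows "(\<And>x. ((\<lambda>x. a (b x)) ^^ 2) x = x) \<Longrightarrow> a (b x) = b (a x)"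
    and "(\<And>x. ((\<lambda>x. a (b x)) ^^ 3) x = x) \<Longrightarrow> a (b (a x)) = b (a (b x))"
    and "(\<And>x. ((\<lambda>x. a (b x)) ^^ 4) x = x) \<Longrightarrow> a (b (a (b x))) = b (a (b (a x)))"
    and "(\<And>x. ((\<lambda>x. a (b x)) ^^ 5) x = x) \<Longrightarrow> a (b (a (b (a x)))) = b (a (b (a (b x))))"
proof -
  assume "\<And>x. ((\<lambda>x. a (b x)) ^^ 2) x = x"
  from this[of "b (a x)"] show "a (b x) = b (a x)"
    by (simp add: numeral_eq_Suc inv)
next
  assume "\<And>x. ((\<lambda>x. a (b x)) ^^ 3) x = x"
  from this[of "b (a (b x))"] show "a (b (a x)) = b (a (b x))"
    by (simp add: numeral_eq_Suc inv)
next
  assume "\<And>x. ((\<lambda>x. a (b x)) ^^ 4) x = x"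
  from this[of "b (a (b (a x)))"] show "a (b (a (b x))) = b (a (b (a x)))"
    by (simp add: numeral_eq_Suc inv)
next
  assume "\<And>x. ((\<lambda>x. a (b x)) ^^ 5) x = x"
  from this[of "b (a (b (a (b x))))"] show "a (b (a (b (a x)))) = b (a (b (a (b x))))"
    by (simp add: numeral_eq_Suc inv)
qed

lemma all_idx: "(\<forall>i. P i) \<longleftrightarrow> P I0 \<and> P I1 \<and> P I2"
  by (metis idx.exhaust)

lemma index_tetrahedron_le:
  "finite (rcosets\<^bsub>Delta\<^esub> (Tri (ty 3 2 3)))" "index (Tri (ty 3 2 3)) \<le> 24"
proof -
  have e: "\<exists>S. Y \<in> S \<and> finite S \<and> card S \<le> 4 \<and> (\<forall>i. F i ` S \<subseteq> S)"
    if inv: "\<And>i Z. F i (F i Z) = Z"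
      and rel: "\<And>i j k Z. i \<noteq> j \<Longrightarrow> j \<noteq> k \<Longrightarrow> i \<noteq> k \<Longrightarrow> ((\<lambda>Z. F j (F i Z)) ^^ ty 3 2 3 k) Z = Z"
      and Y: "F I0 Y = Y" "F I1 Y = Y"
    for F :: "idx \<Rightarrow> idx list set set \<Rightarrow> idx list set set" and Y
  proof -
    have ac: "F I2 (F I0 Z) = F I0 (F I2 Z)" for Z
      by (rule braid_of_pow(1)[OF inv inv]) (rule rel[of I0 I2 I1, simplified])
    have bc: "F I2 (F I1 (F I2 Z)) = F I1 (F I2 (F I1 Z))" for Z
      by (rule braid_of_pow(2)[OF inv inv]) (rule rel[of I1 I2 I0, simplified])
    note ab = braid_of_pow(2)[of "F I1" "F I0", OF inv inv rel[of I0 I1 I2, simplified]]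
    obtain S where "Y \<in> S" "finite S" "card S \<le> 4" "F I0 ` S \<subseteq> S" "F I1 ` S \<subseteq> S" "F I2 ` S \<subseteq> S"
      by (rule tetrahedron_enum[of "F I0" "F I1" "F I2" Y, OF inv inv inv ac bc ab Y])
    then show ?thesis
      by (intro exI[of _ S]) (simp add: all_idx)
  qed
  show "finite (rcosets\<^bsub>Delta\<^esub> (Tri (ty 3 2 3)))"
    by (rule index_Tri_le[OF _ e]) auto
  have "index (Tri (ty 3 2 3)) \<le> 2 * ty 3 2 3 I2 * 4"
    by (rule index_Tri_le[OF _ e]) auto
  then show "index (Tri (ty 3 2 3)) \<le> 24" by simp
qed

lemma index_cube_le:
  "finite (rcosets\<^bsub>Delta\<^esub> (Tri (ty 3 2 4)))" "index (Tri (ty 3 2 4)) \<le> 48"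
proof -
  have e: "\<exists>S. Y \<in> S \<and> finite S \<and> card S \<le> 6 \<and> (\<forall>i. F i ` S \<subseteq> S)"
    if inv: "\<And>i Z. F i (F i Z) = Z"
      and rel: "\<And>i j k Z. i \<noteq> j \<Longrightarrow> j \<noteq> k \<Longrightarrow> i \<noteq> k \<Longrightarrow> ((\<lambda>Z. F j (F i Z)) ^^ ty 3 2 4 k) Z = Z"
      and Y: "F I0 Y = Y" "F I1 Y = Y"
    for F :: "idx \<Rightarrow> idx list set set \<Rightarrow> idx list set set" and Y
  proof -
    have ac: "F I2 (F I0 Z) = F I0 (F I2 Z)" for Z
      by (rule braid_of_pow(1)[OF inv inv]) (rule rel[of I0 I2 I1, simplified])
    have bc: "F I2 (F I1 (F I2 Z)) = F I1 (F I2 (F I1 Z))" for Z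
      by (rule braid_of_pow(2)[OF inv inv]) (rule rel[of I1 I2 I0, simplified])
    note ab = braid_of_pow(3)[of "F I0" "F I1", OF inv inv rel[of I1 I0 I2, simplified]]
    obtain S where "Y \<in> S" "finite S" "card S \<le> 6" "F I0 ` S \<subseteq> S" "F I1 ` S \<subseteq> S" "F I2 ` S \<subseteq> S"
      by (rule cube_enum[of "F I0" "F I1" "F I2" Y, OF inv inv inv ac bc ab Y])
    then show ?thesis
      by (intro exI[of _ S]) (simp add: all_idx)
  qed
  show "finite (rcosets\<^bsub>Delta\<^esub> (Tri (ty 3 2 4)))"
    by (rule index_Tri_le[OF _ e]) auto
  have "index (Tri (ty 3 2 4)) \<le> 2 * ty 3 2 4 I2 * 6"
    by (rule index_Tri_le[OF _ e]) auto
  then show "index (Tri (ty 3 2 4)) \<le> 48" by simp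
qed

lemma index_dodecahedron_le:
  "finite (rcosets\<^bsub>Delta\<^esub> (Tri (ty 3 2 5)))" "index (Tri (ty 3 2 5)) \<le> 120"
proof -
  have e: "\<exists>S. Y \<in> S \<and> finite S \<and> card S \<le> 12 \<and> (\<forall>i. F i ` S \<subseteq> S)"
    if inv: "\<And>i Z. F i (F i Z) = Z"
      and rel: "\<And>i j k Z. i \<noteq> j \<Longrightarrow> j \<noteq> k \<Longrightarrow> i \<noteq> k \<Longrightarrow> ((\<lambda>Z. F j (F i Z)) ^^ ty 3 2 5 k) Z = Z"
      and Y: "F I0 Y = Y" "F I1 Y = Y"
    for F :: "idx \<Rightarrow> idx list set set \<Rightarrow> idx list set set" and Y
  proof -
    have ac: "F I2 (F I0 Z) = F I0 (F I2 Z)" for Z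
      by (rule braid_of_pow(1)[OF inv inv]) (rule rel[of I0 I2 I1, simplified])
    have bc: "F I2 (F I1 (F I2 Z)) = F I1 (F I2 (F I1 Z))" for Z
      by (rule braid_of_pow(2)[OF inv inv]) (rule rel[of I1 I2 I0, simplified])
    note ab = braid_of_pow(4)[of "F I1" "F I0", OF inv inv rel[of I0 I1 I2, simplified]]
    obtain S where "Y \<in> S" "finite S" "card S \<le> 12" "F I0 ` S \<subseteq> S" "F I1 ` S \<subseteq> S" "F I2 ` S \<subseteq> S"
      by (rule dodecahedron_enum[of "F I0" "F I1" "F I2" Y, OF inv inv inv ac bc ab Y])
    then show ?thesis
      by (intro exI[of _ S]) (simp add: all_idx)
  qed
  show "finite (rcosets\<^bsub>Delta\<^esub> (Tri (ty 3 2 5)))"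
    by (rule index_Tri_le[OF _ e]) auto
  have "index (Tri (ty 3 2 5)) \<le> 2 * ty 3 2 5 I2 * 12"
    by (rule index_Tri_le[OF _ e]) auto
  then show "index (Tri (ty 3 2 5)) \<le> 120" by simp
qed

lemma index_dihedron_le:
  assumes "n > 0"
  shows "finite (rcosets\<^bsub>Delta\<^esub> (Tri (ty 1 n n)))" "index (Tri (ty 1 n n)) \<le> 2 * n"
proof -
  have e: "\<exists>S. Y \<in> S \<and> finite S \<and> card S \<le> 1 \<and> (\<forall>i. F i ` S \<subseteq> S)"
    if inv: "\<And>i Z. F i (F i Z) = Z"
      and rel: "\<And>i j k Z. i \<noteq> j \<Longrightarrow> j \<noteq> k \<Longrightarrow> i \<noteq> k \<Longrightarrow> ((\<lambda>Z. F j (F i Z)) ^^ ty 1 n n k) Z = Z"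
      and Y: "F I0 Y = Y" "F I1 Y = Y"
    for F :: "idx \<Rightarrow> idx list set set \<Rightarrow> idx list set set" and Y
    by (rule exI[of _ "{Y}"]) (use Y rel[of I1 I2 I0 Y] in \<open>simp add: all_idx\<close>)
  show "finite (rcosets\<^bsub>Delta\<^esub> (Tri (ty 1 n n)))"
    by (rule index_Tri_le[OF _ e]) (use assms in auto)
  have "index (Tri (ty 1 n n)) \<le> 2 * ty 1 n n I2 * 1"
    by (rule index_Tri_le[OF _ e]) (use assms in auto)
  then show "index (Tri (ty 1 n n)) \<le> 2 * n" by simp
qed

lemma index_prism_le:
  assumes "n > 0"
  shows "finite (rcosets\<^bsub>Delta\<^esub> (Tri (ty 2 2 n)))" "index (Tri (ty 2 2 n)) \<le> 4 * n"
proof -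
  have e: "\<exists>S. Y \<in> S \<and> finite S \<and> card S \<le> 2 \<and> (\<forall>i. F i ` S \<subseteq> S)"
    if inv: "\<And>i Z. F i (F i Z) = Z"
      and rel: "\<And>i j k Z. i \<noteq> j \<Longrightarrow> j \<noteq> k \<Longrightarrow> i \<noteq> k \<Longrightarrow> ((\<lambda>Z. F j (F i Z)) ^^ ty 2 2 n k) Z = Z"
      and Y: "F I0 Y = Y" "F I1 Y = Y"
    for F :: "idx \<Rightarrow> idx list set set \<Rightarrow> idx list set set" and Y
  proof -
    have "F I2 (F I0 Z) = F I0 (F I2 Z)" "F I2 (F I1 Z) = F I1 (F I2 Z)" for Z
      by (rule braid_of_pow(1)[OF inv inv], rule rel[of I0 I2 I1, simplified],
          rule braid_of_pow(1)[OF inv inv], rule rel[of I1 I2 I0, simplified])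
    then have "F I0 (F I2 Y) = F I2 Y" "F I1 (F I2 Y) = F I2 Y"
      using Y by metis+
    then show ?thesis
      using Y inv card_length[of "[Y, F I2 Y]"] by (intro exI[of _ "{Y, F I2 Y}"]) (simp add: all_idx)
  qed
  show "finite (rcosets\<^bsub>Delta\<^esub> (Tri (ty 2 2 n)))"
    by (rule index_Tri_le[OF _ e]) (use assms in auto)
  have "index (Tri (ty 2 2 n)) \<le> 2 * ty 2 2 n I2 * 2"
    by (rule index_Tri_le[OF _ e]) (use assms in auto)
  then show "index (Tri (ty 2 2 n)) \<le> 4 * n" by simp
qed

section \<open>Bounding triangle groups from below: permutation and dihedral quotients\<close>

definition hom_of :: "('b, 'c) monoid_scheme \<Rightarrow> (idx \<Rightarrow> 'b) \<Rightarrow> idx list \<Rightarrow> 'b" where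
  "hom_of G f = (SOME h. h \<in> hom Delta G \<and> (\<forall>i. h (Rgen i) = f i))"

lemma hom_of:
  assumes "group G" "\<And>i. f i \<in> carrier G" "\<And>i. f i \<otimes>\<^bsub>G\<^esub> f i = \<one>\<^bsub>G\<^esub>"
  shows "group_hom Delta G (hom_of G f)" "hom_of G f (Rgen i) = f i"
proof -
  have "\<exists>h. h \<in> hom Delta G \<and> (\<forall>i. h (Rgen i) = f i)"
    using Delta_universal[of G f] assms by blast
  from someI_ex[OF this] have *: "hom_of G f \<in> hom Delta G \<and> (\<forall>i. hom_of G f (Rgen i) = f i)"
    by (simp add: hom_of_def)
  then show "group_hom Delta G (hom_of G f)" "hom_of G f (Rgen i) = f i"
    using assms(1) by (auto simp: group_hom_def group_hom_axioms_def group_Delta)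
qed

lemma Tri_kernel:
  assumes h: "group_hom Delta G h"
    and "h (rot I1 I2) [^]\<^bsub>G\<^esub> t I0 = \<one>\<^bsub>G\<^esub>" "h (rot I2 I0) [^]\<^bsub>G\<^esub> t I1 = \<one>\<^bsub>G\<^esub>"
      "h (rot I0 I1) [^]\<^bsub>G\<^esub> t I2 = \<one>\<^bsub>G\<^esub>"
  shows "Tri t \<subseteq> kernel Delta G h"
proof (rule Tri_least[OF group_hom.normal_kernel[OF h]])
qed (use assms(2-) group_hom.hom_nat_pow[OF h] in \<open>simp_all add: kernel_def\<close>)

lemma kernel_eq:
  assumes h: "group_hom Delta G h" and N: "N \<subseteq> kernel Delta G h"
    and uv: "u \<in> carrier Delta" "v \<in> carrier Delta" "u \<otimes>\<^bsub>Delta\<^esub> inv\<^bsub>Delta\<^esub> v \<in> N"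
  shows "h u = h v"
proof -
  interpret group_hom Delta G h by (rule h)
  have "h u \<otimes>\<^bsub>G\<^esub> inv\<^bsub>G\<^esub> h v = \<one>\<^bsub>G\<^esub>"
    using N uv by (auto simp: kernel_def)
  then show ?thesis using uv by (simp add: H.inv_equality[symmetric] H.inv_solve_right')
qed

text \<open>A relation and a homomorphic image in which no smaller power vanishes determine the order.\<close>

lemma order_modI:
  assumes h: "group_hom Delta G h" and N: "N \<subseteq> kernel Delta G h" "subgroup N Delta"
    and x: "x \<in> carrier Delta" "x [^]\<^bsub>Delta\<^esub> d \<in> N" and ord: "group.ord G (h x) = d"
  shows "order_mod N x d"
  unfolding order_mod_def
proof (intro allI iffI)
  interpret group_hom Delta G h by (rule h)
  fix e :: nat
  {
    assume "x [^]\<^bsub>Delta\<^esub> e \<in> N"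
    then have "h x [^]\<^bsub>G\<^esub> e = \<one>\<^bsub>G\<^esub>"
      using N(1) x hom_nat_pow[of x e] by (auto simp: kernel_def)
    then show "d dvd e"
      using H.pow_eq_id[of "h x" e] x ord by simp
  next
    assume "d dvd e"
    then obtain q where "e = d * q" by (elim dvdE)
    then have "x [^]\<^bsub>Delta\<^esub> e = (x [^]\<^bsub>Delta\<^esub> d) [^]\<^bsub>Delta\<^esub> q"
      using x by (simp add: Delta.nat_pow_pow)
    moreover have "(x [^]\<^bsub>Delta\<^esub> d) [^]\<^bsub>Delta\<^esub> q \<in> N"
      by (induction q) (use x N(2) in \<open>auto intro: subgroup.one_closed subgroup.m_closed\<close>)
    ultimately show "x [^]\<^bsub>Delta\<^esub> e \<in> N" by simp
  }
qed

lemma (in group) ord_eqI: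
  assumes "x \<in> carrier G" "n > 0" "x [^] n = \<one>" "\<And>d. 0 < d \<Longrightarrow> d < n \<Longrightarrow> x [^] d \<noteq> \<one>"
  shows "ord x = n"
proof -
  have "ord x dvd n" using assms pow_eq_id by blast
  moreover have "ord x > 0" using calculation assms(2) by (metis dvd_0_left neq0_conv)
  moreover have "\<not> ord x < n" using assms(4)[of "ord x"] assms(1) calculation(2) by auto
  ultimately show ?thesis using assms(2) dvd_imp_le by fastforce
qed

text \<open>Parity and the image of the even part are independent: every even word can be made odd by a
  letter \<open>R\<^sub>0\<close>, whose effect on the image is undone in the definition of \<open>f\<close>. This gives the right bound
  although the homomorphism itself may kill odd words, such as a central inversion.\<close>

lemma index_ge_even_image:
  assumes h: "group_hom Delta G h" and N: "N \<subseteq> kernel Delta G h" "subgroup N Delta" "N \<subseteq> Delta_plus"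
    and fin: "finite (rcosets\<^bsub>Delta\<^esub> N)"
  shows "2 * card (h ` Delta_plus) \<le> index N"
proof -
  interpret group_hom Delta G h by (rule h)
  define f where "f w = (even (length w), if even (length w) then h w else h (w \<otimes>\<^bsub>Delta\<^esub> Rgen I0))" for w
  have const: "f u = f v"
    if uv: "u \<in> carrier Delta" "v \<in> carrier Delta" "u \<otimes>\<^bsub>Delta\<^esub> inv\<^bsub>Delta\<^esub> v \<in> N" for u v
  proof -
    have "even (length (u \<otimes>\<^bsub>Delta\<^esub> inv\<^bsub>Delta\<^esub> v))"
      using N(3) uv(3) by (auto simp: Delta_plus_def)
    then show "f u = f v"
      using kernel_eq[OF h N(1) uv] uv by (simp add: f_def even_length_mult)
  qed
  have le: "finite (f ` carrier Delta)" "card (f ` carrier Delta) \<le> index N"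
    by (rule Delta.card_rcosets_ge_image[OF N(2) fin], erule (2) const)+
  have "UNIV \<times> (h ` Delta_plus) \<subseteq> f ` carrier Delta"
  proof clarify
    fix b w assume w: "w \<in> Delta_plus"
    then have "f w = (True, h w)" "f (w \<otimes>\<^bsub>Delta\<^esub> Rgen I0) = (False, h w)"
      by (auto simp: f_def Delta_plus_def even_length_mult Delta.m_assoc)
    then show "(b, h w) \<in> f ` carrier Delta"
      using w by (cases b) (auto simp: Delta_plus_def intro: image_eqI[of _ _ w] image_eqI[of _ _ "w \<otimes>\<^bsub>Delta\<^esub> Rgen I0"])
  qed
  then have "card ((UNIV :: bool set) \<times> (h ` Delta_plus)) \<le> card (f ` carrier Delta)"
    by (rule card_mono[OF le(1)])
  then show ?thesis using le(2) by (simp add: card_cartesian_product)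
qed

subsection \<open>Large subgroups of the alternating groups\<close>

lemma (in group) four_dvd_order:
  assumes "finite (carrier G)" and yz: "y \<in> carrier G" "z \<in> carrier G"
    and "y \<otimes> y = \<one>" "z \<otimes> z = \<one>" "y \<otimes> z = z \<otimes> y" "y \<noteq> \<one>" "z \<noteq> \<one>" "y \<noteq> z"
  shows "4 dvd order G"
proof -
  let ?V = "{\<one>, y, z, y \<otimes> z}"
  have inv: "inv y = y" "inv z = z" using assms by (auto simp: inv_equality)
  have ne: "y \<otimes> z \<noteq> \<one>" "y \<otimes> z \<noteq> y" "y \<otimes> z \<noteq> z"
    using assms inv inv_equality[of y z] by auto
  have c: "z \<otimes> (y \<otimes> x) = y \<otimes> (z \<otimes> x)" "y \<otimes> (y \<otimes> x) = x" "z \<otimes> (z \<otimes> x) = x" if "x \<in> carrier G" for x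
    using assms that by (metis m_assoc l_one)+
  have "subgroup ?V G"
    by (rule subgroupI) (use assms(1-5,7-9) assms(6)[symmetric] inv c in \<open>auto simp: m_assoc inv_mult_group\<close>)
  then have "card ?V dvd order G"
    using lagrange by (metis dvd_triv_right)
  moreover have "card ?V = 4" using ne assms(7-9) by simp
  ultimately show ?thesis by simp
qed

lemma dvd_3_5: "d dvd 3 \<Longrightarrow> d = 1 \<or> d = (3::nat)" "d dvd 5 \<Longrightarrow> d = 1 \<or> d = (5::nat)"
proof -
  assume d: "d dvd 3"
  then have "d \<le> 3" by (auto dest: dvd_imp_le)
  then have "d = 0 \<or> d = 1 \<or> d = 2 \<or> d = 3" by linarith
  then show "d = 1 \<or> d = 3" using d by auto
next
  assume d: "d dvd 5"
  then have "d \<le> 5" by (auto dest: dvd_imp_le)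
  then have "d = 0 \<or> d = 1 \<or> d = 2 \<or> d = 3 \<or> d = 4 \<or> d = 5" by linarith
  then show "d = 1 \<or> d = 5" using d by auto
qed

text \<open>Lagrange: a subgroup containing a Klein four-group and elements of orders \<open>3\<close> (and \<open>5\<close>)
  has order divisible by \<open>12\<close> (by \<open>60\<close>), so it contains \<open>A\<^sub>4\<close> (is \<open>A\<^sub>5\<close>).\<close>

lemma alt_group_subset:
  assumes P: "subgroup P (sym_group m)" and m: "m = 4 \<or> m = 5"
    and yz: "y \<in> P" "z \<in> P" "evenperm y" "evenperm z"
      "y \<circ> y = id" "z \<circ> z = id" "y \<circ> z = z \<circ> y" "y \<noteq> id" "z \<noteq> id" "y \<noteq> z"
    and x: "x \<in> P" "evenperm x" "x ^^ 3 = id" "x \<noteq> id"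
    and w: "m = 5 \<Longrightarrow> \<exists>w\<in>P. evenperm w \<and> w ^^ 5 = id \<and> w \<noteq> id"
  shows "carrier (alt_group m) \<subseteq> P"
proof -
  let ?A = "P \<inter> carrier (alt_group m)"
  let ?Q = "(alt_group m)\<lparr>carrier := ?A\<rparr>"
  interpret S: group "sym_group m" by (rule sym_group_is_group)
  interpret A: group "alt_group m" by (rule alt_group_is_group)
  have Pc: "p permutes {1..m}" if "p \<in> P" for p
    using subgroup.mem_carrier[OF P that] by (simp add: sym_group_carrier)
  have sub: "subgroup ?A (alt_group m)"
  proof (rule A.subgroupI)
    show "?A \<noteq> {}" using yz Pc by (auto simp: alt_group_carrier)
    show "inv\<^bsub>alt_group m\<^esub> a \<in> ?A" if "a \<in> ?A" for a
    proof -
      have "inv\<^bsub>sym_group m\<^esub> a \<in> P" using that subgroup.m_inv_closed[OF P] by blast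
      moreover have "inv\<^bsub>sym_group m\<^esub> a = inv\<^bsub>alt_group m\<^esub> a"
        using that alt_group_inv_equality sym_group_inv_equality subgroup.mem_carrier[OF P] by simp
      ultimately show ?thesis using that by simp
    qed
    show "a \<otimes>\<^bsub>alt_group m\<^esub> b \<in> ?A" if "a \<in> ?A" "b \<in> ?A" for a b
      using that subgroup.m_closed[OF P, of a b] A.m_closed[of a b]
      by (simp add: alt_group_mult sym_group_mult)
  qed auto
  interpret Q: group ?Q by (rule A.subgroup_imp_group[OF sub])
  have fin: "finite (carrier (alt_group m))"
    by (rule finite_subset[OF _ finite_permutations[of "{1..m}"]]) (auto simp: alt_group_carrier)
  have finQ: "finite (carrier ?Q)" using fin by simp
  have mQ: "a \<otimes>\<^bsub>?Q\<^esub> b = a \<circ> b" "\<one>\<^bsub>?Q\<^esub> = id" for a b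
    by (simp_all add: alt_group_mult alt_group_one)
  have pw: "a [^]\<^bsub>?Q\<^esub> e = a ^^ e" for a and e :: nat
    by (induction e) (simp_all add: nat_pow_def alt_group_one alt_group_mult funpow_Suc_right del: funpow.simps(2))
  have mem: "a \<in> carrier ?Q" if "a \<in> P" "evenperm a" for a
    using that Pc by (simp add: alt_group_carrier)
  have "4 dvd order ?Q"
    by (rule Q.four_dvd_order[OF finQ, of y z]) (use yz mem in \<open>simp_all add: alt_group_mult alt_group_one\<close>)
  moreover have prime_dvd: "p dvd order ?Q" if "a \<in> P" "evenperm a" "a ^^ p = id" "a \<noteq> id" "p = 3 \<or> p = 5" for a p
  proof -
    have "Q.ord a dvd p" using Q.pow_eq_id[OF mem[OF that(1,2)], of p] that pw mQ by simp
    moreover have "Q.ord a \<noteq> 1" using Q.ord_eq_1[OF mem[OF that(1,2)]] that mQ by simp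
    ultimately have "Q.ord a = p" using that(5) dvd_3_5 by blast
    then show ?thesis using Q.ord_dvd_group_order[OF mem[OF that(1,2)]] by simp
  qed
  moreover have "3 dvd order ?Q"
    by (rule prime_dvd[of x]) (use x in auto)
  moreover have "5 dvd order ?Q" if "m = 5"
    using w[OF that] prime_dvd[of _ 5] by auto
  moreover have "order ?Q \<le> card (carrier (alt_group m))"
    unfolding order_def using fin by (simp add: card_mono)
  moreover have "2 * card (carrier (alt_group m)) = fact m"
    using m by (intro alt_group_card_carrier) auto
  moreover have "order ?Q > 0" using Q.order_gt_0_iff_finite finQ by simp
  ultimately have "order ?Q = card (carrier (alt_group m))"
  proof -
    have f: "fact 4 = (24 :: nat)" "fact 5 = (120 :: nat)" by (simp_all add: fact_numeral)
    from m show ?thesis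
    proof
      assume "m = 4"
      have "12 dvd order ?Q"
        using \<open>4 dvd order ?Q\<close> \<open>3 dvd order ?Q\<close> by presburger
      then have "order ?Q \<ge> 12" using \<open>order ?Q > 0\<close> by (rule dvd_imp_le)
      then show ?thesis
        using \<open>m = 4\<close> f \<open>2 * _ = fact m\<close> \<open>order ?Q \<le> _\<close> by simp
    next
      assume "m = 5"
      have "12 dvd order ?Q"
        using \<open>4 dvd order ?Q\<close> \<open>3 dvd order ?Q\<close> by presburger
      then have "60 dvd order ?Q"
        using \<open>m = 5 \<Longrightarrow> 5 dvd order ?Q\<close>[OF \<open>m = 5\<close>] by presburger
      then have "order ?Q \<ge> 60" using \<open>order ?Q > 0\<close> by (rule dvd_imp_le)
      then show ?thesis
        using \<open>m = 5\<close> f \<open>2 * _ = fact m\<close> \<open>order ?Q \<le> _\<close> by simp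
    qed
  qed
  then have "?A = carrier (alt_group m)"
    using fin by (intro card_subset_eq) (auto simp: order_def)
  then show ?thesis by blast
qed

subsection \<open>The Platonic types\<close>

lemma sym_pow: "x [^]\<^bsub>sym_group m\<^esub> (e::nat) = x ^^ e"
  by (induction e) (simp_all add: nat_pow_def sym_group_one sym_group_mult funpow_Suc_right del: funpow.simps(2))

lemma funpow_numeral_apply: "(p ^^ numeral k) x = (p ^^ pred_numeral k) (p x)"
  by (simp add: numeral_eq_Suc funpow_swap1)

lemma permutes_eqI4:
  assumes "p permutes {1..4}" "q permutes {1..4::nat}"
    and "p 1 = q 1" "p 2 = q 2" "p 3 = q 3" "p 4 = q 4"
  shows "p = q"
proof
  fix x :: nat
  consider "x = 1" | "x = 2" | "x = 3" | "x = 4" | "x \<notin> {1..4}" by fastforce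
  then show "p x = q x"
    by cases (use assms in \<open>simp_all add: permutes_not_in\<close>)
qed

lemma permutes_eqI5:
  assumes "p permutes {1..5}" "q permutes {1..5::nat}"
    and "p 1 = q 1" "p 2 = q 2" "p 3 = q 3" "p 4 = q 4" "p 5 = q 5"
  shows "p = q"
proof
  fix x :: nat
  consider "x = 1" | "x = 2" | "x = 3" | "x = 4" | "x = 5" | "x \<notin> {1..5}" by fastforce
  then show "p x = q x"
    by cases (use assms in \<open>simp_all add: permutes_not_in\<close>)
qed

lemma permutes_funpow: "p permutes S \<Longrightarrow> (p ^^ e) permutes S"
  by (induction e) (auto simp: permutes_id[unfolded id_def] permutes_id intro: permutes_compose)

text \<open>The symmetries act on the four vertices of the tetrahedron, the four diagonals of the cube and
  the five cubes inscribed in the dodecahedron. In the last two cases the central inversion acts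
  trivially, so a reflection acts like the half-turn about the perpendicular axis.\<close>

definition tet_perm :: "idx \<Rightarrow> nat \<Rightarrow> nat" where
  "tet_perm i = (case i of I0 \<Rightarrow> transpose 1 2 | I1 \<Rightarrow> transpose 2 3 | I2 \<Rightarrow> transpose 3 4)"

definition cube_perm :: "idx \<Rightarrow> nat \<Rightarrow> nat" where
  "cube_perm i = (case i of I0 \<Rightarrow> transpose 1 2 \<circ> transpose 3 4 | I1 \<Rightarrow> transpose 2 3 | I2 \<Rightarrow> transpose 1 2)"

definition dod_perm :: "idx \<Rightarrow> nat \<Rightarrow> nat" where
  "dod_perm i = (case i of I0 \<Rightarrow> transpose 2 3 \<circ> transpose 4 5 | I1 \<Rightarrow> transpose 1 2 \<circ> transpose 3 4
     | I2 \<Rightarrow> transpose 2 5 \<circ> transpose 3 4)"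

lemmas perm_eval = tet_perm_def cube_perm_def dod_perm_def transpose_def funpow_numeral_apply

lemma perm_permutes:
  "tet_perm i permutes {1..4}" "cube_perm i permutes {1..4}" "dod_perm i permutes {1..5}"
  by (cases i; simp add: tet_perm_def cube_perm_def dod_perm_def permutes_compose permutes_swap_id)+

lemma perm_square:
  "tet_perm i \<circ> tet_perm i = id" "cube_perm i \<circ> cube_perm i = id" "dod_perm i \<circ> dod_perm i = id"
proof -
  show "tet_perm i \<circ> tet_perm i = id"
    by (rule permutes_eqI4[OF permutes_compose[OF perm_permutes(1) perm_permutes(1)] permutes_id])
      (cases i; simp add: perm_eval)+
  show "cube_perm i \<circ> cube_perm i = id"
    by (rule permutes_eqI4[OF permutes_compose[OF perm_permutes(2) perm_permutes(2)] permutes_id])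
      (cases i; simp add: perm_eval)+
  show "dod_perm i \<circ> dod_perm i = id"
    by (rule permutes_eqI5[OF permutes_compose[OF perm_permutes(3) perm_permutes(3)] permutes_id])
      (cases i; simp add: perm_eval)+
qed

definition tet_hom :: "idx list \<Rightarrow> nat \<Rightarrow> nat" where "tet_hom = hom_of (sym_group 4) tet_perm"
definition cube_hom :: "idx list \<Rightarrow> nat \<Rightarrow> nat" where "cube_hom = hom_of (sym_group 4) cube_perm"
definition dod_hom :: "idx list \<Rightarrow> nat \<Rightarrow> nat" where "dod_hom = hom_of (sym_group 5) dod_perm"

lemma perm_homs:
  "group_hom Delta (sym_group 4) tet_hom" "tet_hom (Rgen i) = tet_perm i"
  "group_hom Delta (sym_group 4) cube_hom" "cube_hom (Rgen i) = cube_perm i"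
  "group_hom Delta (sym_group 5) dod_hom" "dod_hom (Rgen i) = dod_perm i"
  unfolding tet_hom_def cube_hom_def dod_hom_def
  using perm_permutes perm_square
  by (auto intro!: hom_of simp: sym_group_is_group sym_group_carrier sym_group_mult sym_group_one)

lemma hom_rot:
  assumes "group_hom Delta (sym_group m) h"
    and "u \<in> carrier Delta" "v \<in> carrier Delta"
  shows "h (u \<otimes>\<^bsub>Delta\<^esub> v) = h u \<circ> h v"
  using group_hom.hom_mult[OF assms] by (simp add: sym_group_mult)

lemmas perm_hom_mult = hom_rot[OF perm_homs(1)] hom_rot[OF perm_homs(3)] hom_rot[OF perm_homs(5)]

lemma rot_permutes:
  "tet_perm i \<circ> tet_perm j permutes {1..4}" "cube_perm i \<circ> cube_perm j permutes {1..4}"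
  "dod_perm i \<circ> dod_perm j permutes {1..5}"
  by (intro permutes_compose perm_permutes)+

lemma rot_orders:
  "(tet_perm I1 \<circ> tet_perm I2) ^^ 3 = id" "(tet_perm I2 \<circ> tet_perm I0) ^^ 2 = id"
  "(tet_perm I0 \<circ> tet_perm I1) ^^ 3 = id"
  "(cube_perm I1 \<circ> cube_perm I2) ^^ 3 = id" "(cube_perm I2 \<circ> cube_perm I0) ^^ 2 = id"
  "(cube_perm I0 \<circ> cube_perm I1) ^^ 4 = id"
  "(dod_perm I1 \<circ> dod_perm I2) ^^ 3 = id" "(dod_perm I2 \<circ> dod_perm I0) ^^ 2 = id"
  "(dod_perm I0 \<circ> dod_perm I1) ^^ 5 = id"
proof -
  show "(tet_perm I1 \<circ> tet_perm I2) ^^ 3 = id"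
    by (rule permutes_eqI4[OF permutes_funpow[OF rot_permutes(1)] permutes_id]) (simp_all add: perm_eval)
  show "(tet_perm I2 \<circ> tet_perm I0) ^^ 2 = id"
    by (rule permutes_eqI4[OF permutes_funpow[OF rot_permutes(1)] permutes_id]) (simp_all add: perm_eval)
  show "(tet_perm I0 \<circ> tet_perm I1) ^^ 3 = id"
    by (rule permutes_eqI4[OF permutes_funpow[OF rot_permutes(1)] permutes_id]) (simp_all add: perm_eval)
  show "(cube_perm I1 \<circ> cube_perm I2) ^^ 3 = id"
    by (rule permutes_eqI4[OF permutes_funpow[OF rot_permutes(2)] permutes_id]) (simp_all add: perm_eval)
  show "(cube_perm I2 \<circ> cube_perm I0) ^^ 2 = id"
    by (rule permutes_eqI4[OF permutes_funpow[OF rot_permutes(2)] permutes_id]) (simp_all add: perm_eval)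
  show "(cube_perm I0 \<circ> cube_perm I1) ^^ 4 = id"
    by (rule permutes_eqI4[OF permutes_funpow[OF rot_permutes(2)] permutes_id]) (simp_all add: perm_eval)
  show "(dod_perm I1 \<circ> dod_perm I2) ^^ 3 = id"
    by (rule permutes_eqI5[OF permutes_funpow[OF rot_permutes(3)] permutes_id]) (simp_all add: perm_eval)
  show "(dod_perm I2 \<circ> dod_perm I0) ^^ 2 = id"
    by (rule permutes_eqI5[OF permutes_funpow[OF rot_permutes(3)] permutes_id]) (simp_all add: perm_eval)
  show "(dod_perm I0 \<circ> dod_perm I1) ^^ 5 = id"
    by (rule permutes_eqI5[OF permutes_funpow[OF rot_permutes(3)] permutes_id]) (simp_all add: perm_eval)
qed

lemma sym_ord:
  assumes "p permutes {1..m}" "n > 0" "p ^^ n = id" "\<And>d. 0 < d \<Longrightarrow> d < n \<Longrightarrow> (p ^^ d) a \<noteq> a"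
  shows "group.ord (sym_group m) p = n"
  by (rule group.ord_eqI[OF sym_group_is_group])
    (use assms in \<open>auto simp: sym_group_carrier sym_pow sym_group_one fun_eq_iff\<close>)

lemma less_small:
  "0 < d \<Longrightarrow> d < 2 \<Longrightarrow> d = (1::nat)" "0 < d \<Longrightarrow> d < 3 \<Longrightarrow> d = (1::nat) \<or> d = 2"
  "0 < d \<Longrightarrow> d < 4 \<Longrightarrow> d = (1::nat) \<or> d = 2 \<or> d = 3"
  "0 < d \<Longrightarrow> d < 5 \<Longrightarrow> d = (1::nat) \<or> d = 2 \<or> d = 3 \<or> d = 4"
  by auto

lemma rot_ords:
  "group.ord (sym_group 4) (tet_perm I1 \<circ> tet_perm I2) = 3"
  "group.ord (sym_group 4) (tet_perm I2 \<circ> tet_perm I0) = 2"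
  "group.ord (sym_group 4) (tet_perm I0 \<circ> tet_perm I1) = 3"
  "group.ord (sym_group 4) (cube_perm I1 \<circ> cube_perm I2) = 3"
  "group.ord (sym_group 4) (cube_perm I2 \<circ> cube_perm I0) = 2"
  "group.ord (sym_group 4) (cube_perm I0 \<circ> cube_perm I1) = 4"
  "group.ord (sym_group 5) (dod_perm I1 \<circ> dod_perm I2) = 3"
  "group.ord (sym_group 5) (dod_perm I2 \<circ> dod_perm I0) = 2"
  "group.ord (sym_group 5) (dod_perm I0 \<circ> dod_perm I1) = 5"
proof -
  show "group.ord (sym_group 4) (tet_perm I1 \<circ> tet_perm I2) = 3"
    by (rule sym_ord[where a = 3, OF rot_permutes(1) _ rot_orders(1)]) (auto dest!: less_small simp: perm_eval)
  show "group.ord (sym_group 4) (tet_perm I2 \<circ> tet_perm I0) = 2"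
    by (rule sym_ord[where a = 3, OF rot_permutes(1) _ rot_orders(2)]) (auto dest!: less_small simp: perm_eval)
  show "group.ord (sym_group 4) (tet_perm I0 \<circ> tet_perm I1) = 3"
    by (rule sym_ord[where a = 2, OF rot_permutes(1) _ rot_orders(3)]) (auto dest!: less_small simp: perm_eval)
  show "group.ord (sym_group 4) (cube_perm I1 \<circ> cube_perm I2) = 3"
    by (rule sym_ord[where a = 2, OF rot_permutes(2) _ rot_orders(4)]) (auto dest!: less_small simp: perm_eval)
  show "group.ord (sym_group 4) (cube_perm I2 \<circ> cube_perm I0) = 2"
    by (rule sym_ord[where a = 3, OF rot_permutes(2) _ rot_orders(5)]) (auto dest!: less_small simp: perm_eval)
  show "group.ord (sym_group 4) (cube_perm I0 \<circ> cube_perm I1) = 4"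
    by (rule sym_ord[where a = 2, OF rot_permutes(2) _ rot_orders(6)]) (auto dest!: less_small simp: perm_eval)
  show "group.ord (sym_group 5) (dod_perm I1 \<circ> dod_perm I2) = 3"
    by (rule sym_ord[where a = 2, OF rot_permutes(3) _ rot_orders(7)]) (auto dest!: less_small simp: perm_eval)
  show "group.ord (sym_group 5) (dod_perm I2 \<circ> dod_perm I0) = 2"
    by (rule sym_ord[where a = 2, OF rot_permutes(3) _ rot_orders(8)]) (auto dest!: less_small simp: perm_eval)
  show "group.ord (sym_group 5) (dod_perm I0 \<circ> dod_perm I1) = 5"
    by (rule sym_ord[where a = 2, OF rot_permutes(3) _ rot_orders(9)]) (auto dest!: less_small simp: perm_eval)
qed

lemma perm_kernels:
  "Tri (ty 3 2 3) \<subseteq> kernel Delta (sym_group 4) tet_hom"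
  "Tri (ty 3 2 4) \<subseteq> kernel Delta (sym_group 4) cube_hom"
  "Tri (ty 3 2 5) \<subseteq> kernel Delta (sym_group 5) dod_hom"
proof -
  show "Tri (ty 3 2 3) \<subseteq> kernel Delta (sym_group 4) tet_hom"
    by (rule Tri_kernel[OF perm_homs(1)]) (simp_all add: perm_hom_mult perm_homs sym_pow sym_group_one rot_orders)
  show "Tri (ty 3 2 4) \<subseteq> kernel Delta (sym_group 4) cube_hom"
    by (rule Tri_kernel[OF perm_homs(3)]) (simp_all add: perm_hom_mult perm_homs sym_pow sym_group_one rot_orders)
  show "Tri (ty 3 2 5) \<subseteq> kernel Delta (sym_group 5) dod_hom"
    by (rule Tri_kernel[OF perm_homs(5)]) (simp_all add: perm_hom_mult perm_homs sym_pow sym_group_one rot_orders)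
qed

lemma perm_even:
  "evenperm (tet_perm i) \<longleftrightarrow> False" "evenperm (cube_perm i) \<longleftrightarrow> i = I0" "evenperm (dod_perm i)"
  by (cases i; simp add: tet_perm_def cube_perm_def dod_perm_def evenperm_comp evenperm_swap
      permutation_compose permutation_swap_id)+

lemma perm_permutation: "permutation (tet_perm i)" "permutation (cube_perm i)" "permutation (dod_perm i)"
  using perm_permutes by (auto simp: permutation_permutes)

lemmas perm_parity = evenperm_comp permutation_compose perm_permutation perm_even

text \<open>The Klein four-group of \<open>A\<^sub>4\<close> is generated by a half-turn and one of its conjugates; likewise
  for the cube.\<close>

lemma A4_subset_tet:
  assumes P: "subgroup P (sym_group 4)"
    and x: "tet_perm I1 \<circ> tet_perm I2 \<in> P" and y: "tet_perm I0 \<circ> tet_perm I2 \<in> P"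
    and z: "tet_perm I1 \<circ> (tet_perm I0 \<circ> tet_perm I2) \<circ> tet_perm I1 \<in> P"
  shows "carrier (alt_group 4) \<subseteq> P"
proof (rule alt_group_subset[OF P _ y z])
  let ?y = "tet_perm I0 \<circ> tet_perm I2" and ?z = "tet_perm I1 \<circ> (tet_perm I0 \<circ> tet_perm I2) \<circ> tet_perm I1"
  have per: "?y permutes {1..4}" "?z permutes {1..4}"
    by (intro permutes_compose perm_permutes)+
  show "?y \<circ> ?y = id" "?z \<circ> ?z = id" "?y \<circ> ?z = ?z \<circ> ?y"
    by (intro permutes_eqI4 permutes_compose per permutes_id; simp add: perm_eval)+
  have "?y 1 = 2" "?z 1 = 3" by (simp_all add: perm_eval)
  then show "?y \<noteq> id" "?z \<noteq> id" "?y \<noteq> ?z" by (metis id_apply numeral_eq_one_iff num.distinct(1) num.distinct(3), metis id_apply numeral_eq_one_iff num.distinct(3), fastforce)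
  show "tet_perm I1 \<circ> tet_perm I2 \<noteq> id"
    using rot_ords(1) group.ord_id[OF sym_group_is_group, of 4] by (metis num.distinct(3) numeral_eq_one_iff sym_group_one)
qed (use x rot_orders in \<open>simp_all add: perm_parity\<close>)

lemma A4_subset_cube:
  assumes P: "subgroup P (sym_group 4)"
    and x: "cube_perm I1 \<circ> cube_perm I2 \<in> P" and y: "(cube_perm I0 \<circ> cube_perm I1) ^^ 2 \<in> P"
  shows "carrier (alt_group 4) \<subseteq> P"
proof (rule alt_group_subset[OF P _ y])
  let ?x = "cube_perm I1 \<circ> cube_perm I2"
  let ?y = "(cube_perm I0 \<circ> cube_perm I1) ^^ 2" and ?z = "?x \<circ> (cube_perm I0 \<circ> cube_perm I1) ^^ 2 \<circ> (?x \<circ> ?x)"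
  have "a \<circ> b \<in> P" if "a \<in> P" "b \<in> P" for a b
    using subgroup.m_closed[OF P that] by (simp add: sym_group_mult)
  then show "?z \<in> P" using x y by blast
  have per: "?y permutes {1..4}" "?z permutes {1..4}"
    by (intro permutes_compose permutes_funpow perm_permutes)+
  show "?y \<circ> ?y = id" "?z \<circ> ?z = id" "?y \<circ> ?z = ?z \<circ> ?y"
    by (intro permutes_eqI4 permutes_compose per permutes_id; simp add: perm_eval)+
  have "?y 1 \<noteq> 1" "?z 1 \<noteq> 1" "?y 1 \<noteq> ?z 1" by (simp_all add: perm_eval)
  then show "?y \<noteq> id" "?z \<noteq> id" "?y \<noteq> ?z" by (metis id_apply)+
  show "?x \<noteq> id"
    using rot_ords(4) group.ord_id[OF sym_group_is_group, of 4] by (metis num.distinct(3) numeral_eq_one_iff sym_group_one)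
qed (use x rot_orders in \<open>simp_all add: perm_parity numeral_2_eq_2\<close>)

lemma A5_subset_dod:
  assumes P: "subgroup P (sym_group 5)" and gen: "\<And>i. dod_perm i \<in> P"
  shows "carrier (alt_group 5) \<subseteq> P"
proof -
  have c: "a \<circ> b \<in> P" if "a \<in> P" "b \<in> P" for a b
    using subgroup.m_closed[OF P that] by (simp add: sym_group_mult)
  show ?thesis
  proof (rule alt_group_subset[OF P _ gen[of I0] gen[of I2]])
    show "dod_perm I0 \<circ> dod_perm I2 = dod_perm I2 \<circ> dod_perm I0"
      by (intro permutes_eqI5 permutes_compose perm_permutes; simp add: perm_eval)
    show "dod_perm I1 \<circ> dod_perm I2 \<in> P" using gen c by blast
    have "dod_perm I0 2 = 3" "dod_perm I2 2 = 5" by (simp_all add: perm_eval)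
    then show "dod_perm I0 \<noteq> id" "dod_perm I2 \<noteq> id" "dod_perm I0 \<noteq> dod_perm I2"
      by (auto simp: fun_eq_iff intro!: exI[of _ 2])
    show "dod_perm I1 \<circ> dod_perm I2 \<noteq> id"
      using rot_ords(7) group.ord_id[OF sym_group_is_group, of 5] by (metis num.distinct(3) numeral_eq_one_iff sym_group_one)
    have "dod_perm I0 \<circ> dod_perm I1 \<noteq> id"
      using rot_ords(9) group.ord_id[OF sym_group_is_group, of 5] by (metis num.distinct(3) numeral_eq_one_iff sym_group_one)
    then show "\<exists>w\<in>P. evenperm w \<and> w ^^ 5 = id \<and> w \<noteq> id"
      using gen c rot_orders by (intro bexI[of _ "dod_perm I0 \<circ> dod_perm I1"]) (simp_all add: perm_parity)
  qed (use rot_orders perm_square in \<open>simp_all add: perm_parity\<close>)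
qed

lemma Delta_plus_subgroup: "subgroup Delta_plus Delta"
  by (rule normal_imp_subgroup[OF Delta_plus_normal])

lemma tet_image: "carrier (alt_group 4) \<subseteq> tet_hom ` Delta_plus"
proof (rule A4_subset_tet)
  show "subgroup (tet_hom ` Delta_plus) (sym_group 4)"
    by (rule group_hom.subgroup_img_is_subgroup[OF perm_homs(1) Delta_plus_subgroup])
  have "tet_perm I1 \<circ> tet_perm I2 = tet_hom (rot I1 I2)" "tet_perm I0 \<circ> tet_perm I2 = tet_hom (rot I0 I2)"
    "tet_perm I1 \<circ> (tet_perm I0 \<circ> tet_perm I2) \<circ> tet_perm I1
      = tet_hom (Rgen I1 \<otimes>\<^bsub>Delta\<^esub> rot I0 I2 \<otimes>\<^bsub>Delta\<^esub> Rgen I1)"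
    by (simp_all add: perm_hom_mult perm_homs)
  then show "tet_perm I1 \<circ> tet_perm I2 \<in> tet_hom ` Delta_plus" "tet_perm I0 \<circ> tet_perm I2 \<in> tet_hom ` Delta_plus"
    "tet_perm I1 \<circ> (tet_perm I0 \<circ> tet_perm I2) \<circ> tet_perm I1 \<in> tet_hom ` Delta_plus"
    by (auto simp: Delta_plus_def even_length_mult)
qed

text \<open>The even words map onto \<open>A\<^sub>4\<close> at least, and the rotation of order four is an odd permutation.\<close>

lemma cube_image: "cube_hom ` Delta_plus = carrier (sym_group 4)"
proof
  let ?P = "cube_hom ` Delta_plus"
  have P: "subgroup ?P (sym_group 4)"
    by (rule group_hom.subgroup_img_is_subgroup[OF perm_homs(3) Delta_plus_subgroup])
  then show "?P \<subseteq> carrier (sym_group 4)"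
    by (rule subgroup.subset)
  have c: "a \<circ> b \<in> ?P" if "a \<in> ?P" "b \<in> ?P" for a b
    using subgroup.m_closed[OF P that] by (simp add: sym_group_mult)
  have rot: "cube_perm i \<circ> cube_perm j \<in> ?P" for i j
  proof -
    have "cube_perm i \<circ> cube_perm j = cube_hom (rot i j)"
      by (simp add: perm_hom_mult perm_homs)
    then show ?thesis by (auto simp: Delta_plus_def even_length_mult)
  qed
  have A4: "carrier (alt_group 4) \<subseteq> ?P"
    by (rule A4_subset_cube[OF P rot]) (use c rot in \<open>simp add: numeral_2_eq_2\<close>)
  show "carrier (sym_group 4) \<subseteq> ?P"
  proof
    fix q assume q: "q \<in> carrier (sym_group 4)"
    then have qp: "q permutes {1..4}" "permutation q"
      by (auto simp: sym_group_carrier permutation_permutes)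
    show "q \<in> ?P"
    proof (cases "evenperm q")
      case True
      then show ?thesis using A4 qp by (auto simp: alt_group_carrier)
    next
      case False
      let ?r = "cube_perm I0 \<circ> cube_perm I1" and ?s = "cube_perm I1 \<circ> cube_perm I0"
      have "q \<circ> ?s permutes {1..4}"
        by (intro permutes_compose perm_permutes qp)
      moreover have "evenperm (q \<circ> ?s)"
        using False qp(2) by (simp add: perm_parity)
      ultimately have "q \<circ> ?s \<in> carrier (alt_group 4)"
        by (simp only: alt_group_carrier)
      then have "(q \<circ> ?s) \<circ> ?r \<in> ?P" by (intro c rot subsetD[OF A4])
      moreover have "(q \<circ> ?s) \<circ> ?r = q"
      proof -
        have "(q \<circ> ?s) \<circ> ?r = q \<circ> (cube_perm I1 \<circ> (cube_perm I0 \<circ> cube_perm I0) \<circ> cube_perm I1)"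
          by (simp only: o_assoc)
        then show ?thesis by (simp add: perm_square)
      qed
      ultimately show ?thesis by simp
    qed
  qed
qed

lemma even_length_pow: "even (length (w [^]\<^bsub>Delta\<^esub> (e::nat))) \<longleftrightarrow> even (length w) \<or> even e"
  by (induction e) (auto simp: even_length_mult)

lemma dod_image: "carrier (alt_group 5) \<subseteq> dod_hom ` Delta_plus"
proof (rule A5_subset_dod)
  show "subgroup (dod_hom ` Delta_plus) (sym_group 5)"
    by (rule group_hom.subgroup_img_is_subgroup[OF perm_homs(5) Delta_plus_subgroup])
  fix i
  \<comment> \<open>\<open>(R\<^sub>0 R\<^sub>1 R\<^sub>2)\<^sup>5\<close> is an odd word acting trivially: it represents the central inversion.\<close>
  let ?z = "(Rgen I0 \<otimes>\<^bsub>Delta\<^esub> (Rgen I1 \<otimes>\<^bsub>Delta\<^esub> Rgen I2)) [^]\<^bsub>Delta\<^esub> (5::nat)"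
  let ?p = "dod_perm I0 \<circ> (dod_perm I1 \<circ> dod_perm I2)"
  have "dod_hom ?z = ?p ^^ 5"
    using group_hom.hom_nat_pow[OF perm_homs(5), of "Rgen I0 \<otimes>\<^bsub>Delta\<^esub> (Rgen I1 \<otimes>\<^bsub>Delta\<^esub> Rgen I2)" 5]
    by (simp add: perm_hom_mult perm_homs sym_pow)
  also have "\<dots> = id"
    by (rule permutes_eqI5; (intro permutes_funpow permutes_compose perm_permutes permutes_id)?)
      (simp_all add: perm_eval)
  finally have "dod_hom (Rgen i \<otimes>\<^bsub>Delta\<^esub> ?z) = dod_perm i"
    by (simp add: perm_hom_mult perm_homs)
  moreover have "Rgen i \<otimes>\<^bsub>Delta\<^esub> ?z \<in> Delta_plus"
    by (simp add: Delta_plus_def even_length_mult even_length_pow)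
  ultimately show "dod_perm i \<in> dod_hom ` Delta_plus" by (metis imageI)
qed

lemma card_alt: "card (carrier (alt_group 4)) = 12" "card (carrier (alt_group 5)) = 60"
    "card (carrier (sym_group 4)) = 24"
  using alt_group_card_carrier[of 4] alt_group_card_carrier[of 5] sym_group_card_carrier[of 4]
  by (simp_all add: fact_numeral)

section \<open>The spherical types\<close>

text \<open>Upper bound by enumeration, lower bound by the image of the even words; if both equal the number
  of flags required by Euler's formula, they are sharp. The homomorphism also witnesses the orders
  of the rotations.\<close>

lemma spherical_typeI:
  assumes h: "group_hom Delta G h" and pos: "\<And>k. t k > 0" and N: "Tri t \<subseteq> kernel Delta G h"
    and ord: "group.ord G (h (rot I1 I2)) = t I0" "group.ord G (h (rot I2 I0)) = t I1"
      "group.ord G (h (rot I0 I1)) = t I2"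
    and ub: "finite (rcosets\<^bsub>Delta\<^esub> (Tri t))" "index (Tri t) \<le> F"
    and lb: "S \<subseteq> h ` Delta_plus" "F \<le> 2 * card S"
    and F: "of_nat F * ((\<Sum>k\<in>UNIV. 1 / of_nat (t k)) - 1) = (4 :: rat)"
  shows "spherical_type t" "index (Tri t) = F"
proof -
  have "h ` Delta_plus \<subseteq> h ` carrier Delta" by (auto simp: Delta_plus_def)
  moreover have "finite (h ` carrier Delta)"
    by (rule Delta.card_rcosets_ge_image(1)[OF Tri_subgroup ub(1)]) (use kernel_eq[OF h N] in blast)
  ultimately have "card S \<le> card (h ` Delta_plus)"
    by (meson card_mono finite_subset lb(1))
  then show "index (Tri t) = F"
    using index_ge_even_image[OF h N Tri_subgroup Tri_Delta_plus ub(1)] ub(2) lb(2) by linarith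
  moreover have "has_type (Tri t) t"
    by (rule has_typeI[OF Tri_subgroup]; rule order_modI[OF h N Tri_subgroup])
      (use ord in \<open>auto intro: relator_in_Tri\<close>)
  ultimately show "spherical_type t"
    using pos ub(1) F by (simp add: spherical_type_def)
qed

lemma ty_pos: "l > 0 \<Longrightarrow> m > 0 \<Longrightarrow> n > 0 \<Longrightarrow> ty l m n k > 0"
  by (cases k) auto

lemma tetrahedron_type: "spherical_type (ty 3 2 3)" "index (Tri (ty 3 2 3)) = 24"
  by (rule spherical_typeI[OF perm_homs(1) _ perm_kernels(1) _ _ _ index_tetrahedron_le tet_image];
      simp add: ty_pos perm_hom_mult perm_homs rot_ords card_alt UNIV_idx)+

lemma cube_type: "spherical_type (ty 3 2 4)" "index (Tri (ty 3 2 4)) = 48"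
  by (rule spherical_typeI[OF perm_homs(3) _ perm_kernels(2) _ _ _ index_cube_le equalityD2[OF cube_image]];
      simp add: ty_pos perm_hom_mult perm_homs rot_ords card_alt UNIV_idx)+

lemma dodecahedron_type: "spherical_type (ty 3 2 5)" "index (Tri (ty 3 2 5)) = 120"
  by (rule spherical_typeI[OF perm_homs(5) _ perm_kernels(3) _ _ _ index_dodecahedron_le dod_image];
      simp add: ty_pos perm_hom_mult perm_homs rot_ords card_alt UNIV_idx)+

subsection \<open>The dihedral types\<close>

text \<open>With \<open>c\<close> equal to the second reflection this is the quotient for type \<open>(1; n; n)\<close>; with \<open>c\<close>
  trivial, and combined with the parity of the letters \<open>R\<^sub>2\<close>, it is the one for type \<open>(2; 2; n)\<close>.\<close>

definition dih_gen :: "nat \<Rightarrow> int \<times> bool \<Rightarrow> idx \<Rightarrow> int \<times> bool" where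
  "dih_gen n c i = (case i of I0 \<Rightarrow> (0, True) | I1 \<Rightarrow> (1 mod int n, True) | I2 \<Rightarrow> c)"

lemma dihedral_pow:
  assumes "n > 0"
  shows "(a, False) [^]\<^bsub>dihedral n\<^esub> (e::nat) = ((a * int e) mod int n, False)"
  by (induction e) (use assms in \<open>simp_all add: nat_pow_def dihedral_simps mod_simps algebra_simps\<close>)

lemma dihedral_ord:
  assumes "n > 0" "0 \<le> a" "a < int n" "a = 1 mod int n \<or> a = (- 1) mod int n"
  shows "group.ord (dihedral n) (a, False) = n"
proof -
  have "(a * int e) mod int n = 0 \<longleftrightarrow> n dvd e" for e
    using assms(4)
  proof
    assume "a = 1 mod int n"
    then have "(a * int e) mod int n = int e mod int n" by (simp add: mod_simps)
    then show ?thesis by (simp flip: zmod_int add: mod_eq_0_iff_dvd)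
  next
    assume "a = (- 1) mod int n"
    then have "(a * int e) mod int n = (- int e) mod int n" by (simp add: mod_simps)
    then show ?thesis by (simp add: mod_eq_0_iff_dvd)
  qed
  then show ?thesis
    using assms group.ord_unique[OF group_dihedral, of n "(a, False)" n]
    by (simp add: dihedral_pow dihedral_simps)
qed

lemma dih_hom:
  assumes "n > 0" "c = (0, False) \<or> c = (1 mod int n, True)"
  shows "group_hom Delta (dihedral n) (hom_of (dihedral n) (dih_gen n c))"
    "hom_of (dihedral n) (dih_gen n c) (Rgen i) = dih_gen n c i"
proof -
  have "dih_gen n c i \<in> carrier (dihedral n)" "dih_gen n c i \<otimes>\<^bsub>dihedral n\<^esub> dih_gen n c i = \<one>\<^bsub>dihedral n\<^esub>" for i
    using assms by (cases i; auto simp: dih_gen_def dihedral_simps)+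
  then show "group_hom Delta (dihedral n) (hom_of (dihedral n) (dih_gen n c))"
    "hom_of (dihedral n) (dih_gen n c) (Rgen i) = dih_gen n c i"
    using hom_of[OF group_dihedral[OF assms(1)], of "dih_gen n c"] by blast+
qed

lemma dih_even_image:
  assumes "n > 0" "c = (0, False) \<or> c = (1 mod int n, True)"
  shows "{0..<int n} \<times> {False} \<subseteq> hom_of (dihedral n) (dih_gen n c) ` Delta_plus"
proof clarify
  fix a assume a: "a \<in> {0..<int n}"
  let ?h = "hom_of (dihedral n) (dih_gen n c)"
  interpret group_hom Delta "dihedral n" ?h by (rule dih_hom[OF assms])
  have "?h (rot I1 I0) = (1 mod int n, False)"
    using dih_hom(2)[OF assms] by (simp add: dih_gen_def dihedral_simps)
  moreover obtain e :: nat where "a = int e" "e < n"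
    using a by (metis atLeastLessThan_iff nonneg_int_cases of_nat_less_iff)
  ultimately have "?h (rot I1 I0 [^]\<^bsub>Delta\<^esub> e) = (a, False)"
    using hom_nat_pow[of "rot I1 I0" e] assms(1) by (simp add: dihedral_pow mod_simps)
  then show "(a, False) \<in> ?h ` Delta_plus"
    using rot_pow_Delta_plus by (metis imageI)
qed

lemma dihedron_type:
  assumes n: "n > 0"
  shows "spherical_type (ty 1 n n)" "index (Tri (ty 1 n n)) = 2 * n"
proof -
  let ?c = "(1 mod int n, True)"
  let ?h = "hom_of (dihedral n) (dih_gen n ?c)"
  have h: "group_hom Delta (dihedral n) ?h" and v: "?h (Rgen i) = dih_gen n ?c i" for i
    using dih_hom[OF n] by auto
  have r: "?h (rot I1 I2) = (0, False)" "?h (rot I2 I0) = (1 mod int n, False)"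
    "?h (rot I0 I1) = ((- 1) mod int n, False)"
    using group_hom.hom_mult[OF h] v by (simp_all add: dih_gen_def dihedral_simps mod_simps)
  have ker: "Tri (ty 1 n n) \<subseteq> kernel Delta (dihedral n) ?h"
    by (rule Tri_kernel[OF h]) (use n in \<open>simp_all only: r dihedral_pow dihedral_simps ty_simps, simp_all add: mod_simps\<close>)
  have ords: "group.ord (dihedral n) (?h (rot I1 I2)) = ty 1 n n I0"
    "group.ord (dihedral n) (?h (rot I2 I0)) = ty 1 n n I1"
    "group.ord (dihedral n) (?h (rot I0 I1)) = ty 1 n n I2"
    using n group.ord_id[OF group_dihedral[OF n]] unfolding r
    by (simp_all add: dihedral_ord dihedral_simps)
  have F: "of_nat (2 * n) * ((\<Sum>k\<in>UNIV. 1 / of_nat (ty 1 n n k)) - 1) = (4 :: rat)"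
    using n by (simp add: UNIV_idx field_simps)
  have c: "2 * n \<le> 2 * card ({0..<int n} \<times> {False})"
    by (simp add: card_cartesian_product)
  have "finite (rcosets\<^bsub>Delta\<^esub> (Tri (ty 1 n n)))" "index (Tri (ty 1 n n)) \<le> 2 * n"
    using index_dihedron_le[OF n] by auto
  from spherical_typeI[OF h ty_pos ker ords this dih_even_image[OF n] c F]
  show "spherical_type (ty 1 n n)" "index (Tri (ty 1 n n)) = 2 * n"
    using n by auto
qed

text \<open>The parity of the number of letters satisfying \<open>P\<close>.\<close>

definition sign_hom :: "(idx \<Rightarrow> bool) \<Rightarrow> idx list \<Rightarrow> int" where
  "sign_hom P = hom_of (cyclic 2) (\<lambda>i. if P i then 1 else 0)"

lemma sign_hom:
  "group_hom Delta (cyclic 2) (sign_hom P)" "sign_hom P (Rgen i) = (if P i then 1 else 0)"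
  unfolding sign_hom_def by (rule hom_of; simp add: carrier_integer_mod_group)+

lemma sign_hom_mult:
  "u \<in> carrier Delta \<Longrightarrow> v \<in> carrier Delta \<Longrightarrow>
    sign_hom P (u \<otimes>\<^bsub>Delta\<^esub> v) = (sign_hom P u + sign_hom P v) mod 2"
  using group_hom.hom_mult[OF sign_hom(1), of u v P] by simp

text \<open>The group is \<open>D\<^sub>n \<times> C\<^sub>2\<close> with \<open>R\<^sub>2\<close> as the second factor. The order of \<open>R\<^sub>0 R\<^sub>1\<close> is visible in \<open>D\<^sub>n\<close>,
  that of the other two rotations in the sign of \<open>R\<^sub>2\<close>.\<close>

lemma prism_type:
  assumes n: "n > 0"
  shows "spherical_type (ty 2 2 n)" "index (Tri (ty 2 2 n)) = 4 * n"
proof -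
  let ?c = "(0, False) :: int \<times> bool"
  let ?h = "hom_of (dihedral n) (dih_gen n ?c)"
  let ?s = "sign_hom (\<lambda>i. i = I2)"
  have h: "group_hom Delta (dihedral n) ?h" and v: "?h (Rgen i) = dih_gen n ?c i" for i
    using dih_hom[OF n] by auto
  note sh = sign_hom(1)[of "\<lambda>i. i = I2"]
  have r: "?h (rot I1 I2) = (1 mod int n, True)" "?h (rot I2 I0) = (0, True)"
    "?h (rot I0 I1) = ((- 1) mod int n, False)"
    using group_hom.hom_mult[OF h] v n by (simp_all add: dih_gen_def dihedral_simps mod_simps)
  have ker: "Tri (ty 2 2 n) \<subseteq> kernel Delta (dihedral n) ?h"
    by (rule Tri_kernel[OF h])
      (use n in \<open>simp_all only: r dihedral_pow ty_simps, simp_all add: numeral_2_eq_2 nat_pow_def dihedral_simps mod_simps\<close>)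
  have kers: "Tri (ty 2 2 n) \<subseteq> kernel Delta (cyclic 2) ?s"
    by (rule Tri_kernel[OF sh]) (simp_all add: sign_hom_mult sign_hom)
  have ub: "finite (rcosets\<^bsub>Delta\<^esub> (Tri (ty 2 2 n)))" "index (Tri (ty 2 2 n)) \<le> 4 * n"
    using index_prism_le[OF n] by auto
  define f where "f w = (?h w, ?s w)" for w
  have f: "finite (f ` carrier Delta)" "card (f ` carrier Delta) \<le> index (Tri (ty 2 2 n))"
    by (rule Delta.card_rcosets_ge_image[OF Tri_subgroup ub(1)];
        use kernel_eq[OF h ker] kernel_eq[OF sh kers] in \<open>simp add: f_def\<close>)+
  have "({0..<int n} \<times> UNIV) \<times> {0, 1} \<subseteq> f ` carrier Delta"
  proof clarify
    fix a :: int and s :: bool and b :: int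
    assume a: "a \<in> {0..<int n}" and b: "b \<in> {0, 1}"
    have "(a, False) \<in> ?h ` Delta_plus"
      using dih_even_image[OF n, of ?c] a by blast
    then obtain w where w: "w \<in> carrier Delta" "?h w = (a, False)"
      unfolding Delta_plus_def by force
    let ?w1 = "w \<otimes>\<^bsub>Delta\<^esub> (if s then Rgen I0 else \<one>\<^bsub>Delta\<^esub>)"
    have w1: "?w1 \<in> carrier Delta" "?h ?w1 = (a, s)"
      using w a v[of I0] group_hom.hom_mult[OF h w(1), of "Rgen I0"] by (auto simp: dih_gen_def dihedral_simps)
    have s01: "?s ?w1 \<in> {0, 1}"
      using group_hom.hom_closed[OF sh w1(1)] by (auto simp: carrier_integer_mod_group)
    let ?w2 = "?w1 \<otimes>\<^bsub>Delta\<^esub> (if ?s ?w1 = b then \<one>\<^bsub>Delta\<^esub> else Rgen I2)"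
    have "?w2 \<in> carrier Delta" using w1 by simp
    moreover have "?h ?w2 = (a, s)"
      using w1 a v[of I2] group_hom.hom_mult[OF h w1(1), of "Rgen I2"] by (auto simp: dih_gen_def dihedral_simps)
    moreover have "?s ?w2 = b"
      using w1(1) s01 b group_hom.hom_one[OF sh]
      by (auto simp: sign_hom_mult[of ?w1] sign_hom simp del: Delta.m_closed)
    ultimately show "((a, s), b) \<in> f ` carrier Delta" by (force simp: f_def)
  qed
  then have "card (({0..<int n} \<times> (UNIV :: bool set)) \<times> {0, 1 :: int}) \<le> index (Tri (ty 2 2 n))"
    using card_mono[OF f(1)] f(2) by (meson le_trans)
  then have idx: "index (Tri (ty 2 2 n)) = 4 * n"
    using ub(2) by (simp add: card_cartesian_product)
  have so: "group.ord (cyclic 2) 1 = 2"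
    by (rule group.ord_eqI) (auto simp: less_Suc_eq numeral_2_eq_2 carrier_integer_mod_group)
  have "has_type (Tri (ty 2 2 n)) (ty 2 2 n)"
  proof (rule has_typeI[OF Tri_subgroup])
    show "order_mod (Tri (ty 2 2 n)) (rot I1 I2) (ty 2 2 n I0)" "order_mod (Tri (ty 2 2 n)) (rot I2 I0) (ty 2 2 n I1)"
      by (rule order_modI[OF sh kers Tri_subgroup _ relator_in_Tri]; simp add: sign_hom_mult sign_hom so)+
    show "order_mod (Tri (ty 2 2 n)) (rot I0 I1) (ty 2 2 n I2)"
      by (rule order_modI[OF h ker Tri_subgroup _ relator_in_Tri]) (use n r in \<open>simp_all add: dihedral_ord\<close>)
  qed
  then show "spherical_type (ty 2 2 n)"
    using ub(1) idx n by (simp add: spherical_type_def ty_pos UNIV_idx field_simps)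
  show "index (Tri (ty 2 2 n)) = 4 * n" by (rule idx)
qed

section \<open>The operations \<open>Pin\<close> and \<open>Wal\<close>\<close>

lemma phi_P: "is_phi (Rgen I0) (Rgen I0) phi_P"
  unfolding phi_P_def by (rule someI_ex[OF is_phi_exists]) simp_all

lemma phi_W: "is_phi (Rgen I0) (Rgen I2) phi_W"
  unfolding phi_W_def by (rule someI_ex[OF is_phi_exists]) simp_all

abbreviation Delta0_group :: "idx list monoid" where
  "Delta0_group \<equiv> Delta\<lparr>carrier := Delta0\<rparr>"

lemma Delta0_group: "group Delta0_group"
  by (rule Delta.subgroup_imp_group[OF Delta0_subgroup])

lemma Delta0_closed: "w \<in> Delta0 \<Longrightarrow> w \<in> carrier Delta"
  by (rule Delta0_even(1))

lemma Delta0_mult: "u \<in> Delta0 \<Longrightarrow> v \<in> Delta0 \<Longrightarrow> u \<otimes>\<^bsub>Delta\<^esub> v \<in> Delta0"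
  by (rule subgroup.m_closed[OF Delta0_subgroup])

lemma Delta0_conj: "g \<in> carrier Delta \<Longrightarrow> w \<in> carrier Delta \<Longrightarrow>
    g \<otimes>\<^bsub>Delta\<^esub> w \<otimes>\<^bsub>Delta\<^esub> inv\<^bsub>Delta\<^esub> g \<in> Delta0 \<longleftrightarrow> w \<in> Delta0"
  by (rule normal_conj_iff[OF Delta0_normal])

lemma R0_shift: "w \<in> carrier Delta \<Longrightarrow> odd0 w \<Longrightarrow> w \<otimes>\<^bsub>Delta\<^esub> Rgen I0 \<in> Delta0"
  by (simp add: Delta0_eq odd0_mult)

lemma odd_rot_pow:
  "odd0 (rot i j [^]\<^bsub>Delta\<^esub> (e::nat)) \<longleftrightarrow> odd e \<and> (i = I0) \<noteq> (j = I0)"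
  by (induction e) (auto simp: odd0_mult)

lemma conj_pow:
  assumes "g \<in> carrier Delta" "x \<in> carrier Delta"
  shows "g \<otimes>\<^bsub>Delta\<^esub> x [^]\<^bsub>Delta\<^esub> (e::nat) \<otimes>\<^bsub>Delta\<^esub> inv\<^bsub>Delta\<^esub> g = (g \<otimes>\<^bsub>Delta\<^esub> x \<otimes>\<^bsub>Delta\<^esub> inv\<^bsub>Delta\<^esub> g) [^]\<^bsub>Delta\<^esub> e"
proof -
  have "g \<otimes>\<^bsub>Delta\<^esub> y \<otimes>\<^bsub>Delta\<^esub> inv\<^bsub>Delta\<^esub> g \<otimes>\<^bsub>Delta\<^esub> (g \<otimes>\<^bsub>Delta\<^esub> x \<otimes>\<^bsub>Delta\<^esub> inv\<^bsub>Delta\<^esub> g)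
      = g \<otimes>\<^bsub>Delta\<^esub> (y \<otimes>\<^bsub>Delta\<^esub> x) \<otimes>\<^bsub>Delta\<^esub> inv\<^bsub>Delta\<^esub> g" if "y \<in> carrier Delta" for y
  proof -
    have "inv\<^bsub>Delta\<^esub> g \<otimes>\<^bsub>Delta\<^esub> (g \<otimes>\<^bsub>Delta\<^esub> z) = z" if "z \<in> carrier Delta" for z
      using that assms by (simp add: Delta.m_assoc[symmetric])
    then show ?thesis using assms that by (simp add: Delta.m_assoc)
  qed
  note step = this
  show ?thesis
  proof (induction e)
    case (Suc e)
    then show ?case
      using step[of "x [^]\<^bsub>Delta\<^esub> e"] assms by simp
  qed (use assms in simp)
qed

lemma even_pow: "x [^]\<^bsub>Delta\<^esub> (2 * e :: nat) = (x \<otimes>\<^bsub>Delta\<^esub> x) [^]\<^bsub>Delta\<^esub> e" if "x \<in> carrier Delta"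
proof -
  have "x \<otimes>\<^bsub>Delta\<^esub> x = x [^]\<^bsub>Delta\<^esub> (2::nat)"
    using that by (simp add: numeral_2_eq_2)
  then show ?thesis using that by (simp add: Delta.nat_pow_pow)
qed

lemma (in group) card_rcosets_1:
  assumes "subgroup K G"
  shows "card (rcosets K) = 1 \<longleftrightarrow> K = carrier G"
proof
  assume "card (rcosets K) = 1"
  then obtain C where C: "rcosets K = {C}" by (rule card_1_singletonE)
  have "x \<in> K" if x: "x \<in> carrier G" for x
  proof -
    have "K #> x \<in> rcosets K" "K #> \<one> \<in> rcosets K"
      using x rcosetsI[OF subgroup.subset[OF assms]] by auto
    then have "K #> x = K #> \<one>" using C by simp
    then show ?thesis using rcoset_eq_iff[OF assms x one_closed] x by simp
  qed
  then show "K = carrier G" using subgroup.subset[OF assms] by blast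
next
  assume K: "K = carrier G"
  have "rcosets K = {K}"
    unfolding RCOSETS_def using coset_join2[OF _ assms] K by force
  then show "card (rcosets K) = 1" by simp
qed

text \<open>Both operations pull back along an epimorphism \<open>\<phi>\<close> of \<open>Delta0\<close> onto \<open>\<Delta>\<close>; they differ only in
  the image \<open>R\<^sub>j\<close> of \<open>R\<^sub>2\<close> conjugated by \<open>R\<^sub>0\<close>.\<close>

locale lifting =
  fixes j :: idx and \<phi> :: "idx list \<Rightarrow> idx list" and t :: "idx \<Rightarrow> nat"
  assumes j: "j = I0 \<or> j = I2" and phi: "is_phi (Rgen I0) (Rgen j) \<phi>" and t: "spherical_type t"
begin

abbreviation N :: "idx list set" where "N \<equiv> Tri t"

definition K0 :: "idx list set" where
  "K0 = {w \<in> Delta0. \<phi> w \<in> N}"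

lemma phi_gens:
  "\<phi> (Rgen I1) = Rgen I1" "\<phi> (Rgen I2) = Rgen I2"
  "\<phi> (Rgen I0 \<otimes>\<^bsub>Delta\<^esub> Rgen I1 \<otimes>\<^bsub>Delta\<^esub> Rgen I0) = Rgen I0"
  "\<phi> (Rgen I0 \<otimes>\<^bsub>Delta\<^esub> Rgen I2 \<otimes>\<^bsub>Delta\<^esub> Rgen I0) = Rgen j"
  using phi by (simp_all add: is_phi_def conjg_R0)

lemma phi_hom: "group_hom Delta0_group Delta \<phi>"
  using phi by (simp add: is_phi_def group_hom_def group_hom_axioms_def group_Delta Delta0_group)

lemma phi_closed: "w \<in> Delta0 \<Longrightarrow> \<phi> w \<in> carrier Delta"
  using group_hom.hom_closed[OF phi_hom] by simp

lemma phi_mult: "u \<in> Delta0 \<Longrightarrow> v \<in> Delta0 \<Longrightarrow> \<phi> (u \<otimes>\<^bsub>Delta\<^esub> v) = \<phi> u \<otimes>\<^bsub>Delta\<^esub> \<phi> v"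
  using group_hom.hom_mult[OF phi_hom] by simp

lemma phi_one: "\<phi> \<one>\<^bsub>Delta\<^esub> = \<one>\<^bsub>Delta\<^esub>"
  using group_hom.hom_one[OF phi_hom] by simp

lemma phi_inv: "u \<in> Delta0 \<Longrightarrow> \<phi> (inv\<^bsub>Delta\<^esub> u) = inv\<^bsub>Delta\<^esub> (\<phi> u)"
  using group_hom.hom_inv[OF phi_hom, of u] Delta.m_inv_consistent[OF Delta0_subgroup, of u] by simp

lemma phi_pow: "u \<in> Delta0 \<Longrightarrow> \<phi> (u [^]\<^bsub>Delta\<^esub> (e::nat)) = \<phi> u [^]\<^bsub>Delta\<^esub> e \<and> u [^]\<^bsub>Delta\<^esub> e \<in> Delta0"
  by (induction e) (auto simp: phi_one phi_mult Delta0_mult subgroup.one_closed[OF Delta0_subgroup])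

lemma gens_in_Delta0:
  "Rgen I1 \<in> Delta0" "Rgen I2 \<in> Delta0" "Rgen I0 \<otimes>\<^bsub>Delta\<^esub> Rgen I1 \<otimes>\<^bsub>Delta\<^esub> Rgen I0 \<in> Delta0"
  "Rgen I0 \<otimes>\<^bsub>Delta\<^esub> Rgen I2 \<otimes>\<^bsub>Delta\<^esub> Rgen I0 \<in> Delta0"
  by (simp_all add: Delta0_eq odd0_mult)

lemma phi_surj:
  assumes "w \<in> carrier Delta"
  shows "\<exists>u\<in>Delta0. \<phi> u = w"
  using assms
proof (induction w rule: Delta_induct)
  case one
  show ?case using phi_one subgroup.one_closed[OF Delta0_subgroup] by blast
next
  case (step i w)
  then obtain u where u: "u \<in> Delta0" "\<phi> u = w" by blast
  have "\<exists>g\<in>Delta0. \<phi> g = Rgen i"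
    using gens_in_Delta0 phi_gens by (cases i) blast+
  then obtain g where "g \<in> Delta0" "\<phi> g = Rgen i" by blast
  then show ?case
    using u phi_mult Delta0_mult by (intro bexI[of _ "g \<otimes>\<^bsub>Delta\<^esub> u"]) simp_all
qed

lemma phi_parity:
  assumes "w \<in> Delta0"
  shows "even (length (\<phi> w)) \<longleftrightarrow> even (length w)"
proof -
  define p where "p w = (if even (length w) then 0 else 1 :: int)" for w :: "idx list"
  have p: "p (u \<otimes>\<^bsub>Delta\<^esub> v) = (p u + p v) mod 2" for u v
    by (simp add: p_def even_length_mult)
  have "p (\<phi> w) = p w"
  proof (rule Delta0_hom_unique[of "cyclic 2" "\<lambda>w. p (\<phi> w)" p])
    show "(\<lambda>w. p (\<phi> w)) \<in> hom Delta0_group (cyclic 2)" "p \<in> hom Delta0_group (cyclic 2)"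
      by (auto simp: hom_def phi_mult p) (auto simp: p_def carrier_integer_mod_group)
    show "p (\<phi> x) = p x" if "x \<in> Delta0_gens" for x
      using that phi_gens by (auto simp: Delta0_gens_def conjg_R0 p_def even_length_mult)
  qed (use assms in auto)
  then show ?thesis by (auto simp: p_def split: if_splits)
qed

lemma K0_Delta0: "K0 \<subseteq> Delta0"
  by (auto simp: K0_def)

lemma K0_normal: "K0 \<lhd> Delta0_group"
  using group_hom.vimage_normal[OF phi_hom Tri_normal, of t] by (simp add: K0_def)

lemma K0_subgroup: "subgroup K0 Delta"
  using Delta.incl_subgroup[OF Delta0_subgroup] K0_normal normal_imp_subgroup by blast

lemma K0_Delta_plus: "K0 \<subseteq> Delta_plus"
proof
  fix w assume w: "w \<in> K0"
  then have "\<phi> w \<in> Delta_plus" using Tri_Delta_plus by (auto simp: K0_def)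
  then show "w \<in> Delta_plus"
    using w phi_parity[of w] Delta0_closed by (simp add: K0_def Delta_plus_def)
qed

lemma K0_conj:
  assumes "g \<in> Delta0" "w \<in> carrier Delta"
  shows "g \<otimes>\<^bsub>Delta\<^esub> w \<otimes>\<^bsub>Delta\<^esub> inv\<^bsub>Delta\<^esub> g \<in> K0 \<longleftrightarrow> w \<in> K0"
proof (cases "w \<in> Delta0")
  case True
  have "\<phi> (g \<otimes>\<^bsub>Delta\<^esub> w \<otimes>\<^bsub>Delta\<^esub> inv\<^bsub>Delta\<^esub> g) = \<phi> g \<otimes>\<^bsub>Delta\<^esub> \<phi> w \<otimes>\<^bsub>Delta\<^esub> inv\<^bsub>Delta\<^esub> (\<phi> g)"
    using True assms subgroup.m_inv_closed[OF Delta0_subgroup] by (simp add: phi_mult Delta0_mult phi_inv)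
  then show ?thesis
    using True assms normal_conj_iff[OF Tri_normal, of "\<phi> g" "\<phi> w"] Delta0_conj[of g w]
    by (simp add: K0_def phi_closed Delta0_closed)
next
  case False
  then show ?thesis
    using assms Delta0_conj[of g w] Delta0_closed by (auto simp: K0_def)
qed

text \<open>Since \<open>K0\<close> is normal in the subgroup \<open>Delta0\<close> of index two, a conjugate depends only on the parity
  of the conjugating element, so this is the only other one.\<close>

definition K0_swap :: "idx list set" where
  "K0_swap = {w \<in> carrier Delta. Rgen I0 \<otimes>\<^bsub>Delta\<^esub> w \<otimes>\<^bsub>Delta\<^esub> Rgen I0 \<in> K0}"

lemma K0_conj_iff:
  assumes g: "g \<in> carrier Delta" and w: "w \<in> carrier Delta"
  shows "g \<otimes>\<^bsub>Delta\<^esub> w \<otimes>\<^bsub>Delta\<^esub> inv\<^bsub>Delta\<^esub> g \<in> K0 \<longleftrightarrow> w \<in> (if odd0 g then K0_swap else K0)"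
proof (cases "odd0 g")
  case True
  have "g \<otimes>\<^bsub>Delta\<^esub> w \<otimes>\<^bsub>Delta\<^esub> inv\<^bsub>Delta\<^esub> g = (g \<otimes>\<^bsub>Delta\<^esub> Rgen I0) \<otimes>\<^bsub>Delta\<^esub> (Rgen I0 \<otimes>\<^bsub>Delta\<^esub> w \<otimes>\<^bsub>Delta\<^esub> Rgen I0)
      \<otimes>\<^bsub>Delta\<^esub> inv\<^bsub>Delta\<^esub> (g \<otimes>\<^bsub>Delta\<^esub> Rgen I0)"
    using g w by (simp add: Delta.m_assoc Delta.inv_mult_group)
  then show ?thesis
    using True K0_conj[OF R0_shift[OF g True], of "Rgen I0 \<otimes>\<^bsub>Delta\<^esub> w \<otimes>\<^bsub>Delta\<^esub> Rgen I0"] w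
    by (simp add: K0_swap_def)
next
  case False
  then have "g \<in> Delta0" using g by (simp add: Delta0_eq)
  then show ?thesis using False K0_conj[of g w] w by simp
qed

subsection \<open>Orders of the rotations\<close>

text \<open>\<open>\<phi>\<close> maps \<open>R\<^sub>1 R\<^sub>2\<close> conjugated by \<open>R\<^sub>0\<close> to \<open>R\<^sub>0 R\<^sub>j\<close>, and \<open>(R\<^sub>2 R\<^sub>0)\<^sup>2\<close> to \<open>R\<^sub>2 R\<^sub>j\<close>. These have the
  orders \<open>e0\<close> and \<open>e1\<close> modulo \<open>N\<close>; one of the two elements is trivial and the other is the rotation
  \<open>R\<^sub>2 R\<^sub>0\<close> up to inversion.\<close>

definition e0 :: nat where "e0 = (if j = I0 then 1 else t I1)"
definition e1 :: nat where "e1 = (if j = I0 then t I1 else 1)"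

lemma t_pos: "t k > 0"
  using t by (simp add: spherical_type_def)

lemma e_pos: "e0 > 0" "e1 > 0"
  using t_pos by (simp_all add: e0_def e1_def)

lemma N_order: "i \<noteq> k \<Longrightarrow> k \<noteq> l \<Longrightarrow> i \<noteq> l \<Longrightarrow> rot i k [^]\<^bsub>Delta\<^esub> (e::nat) \<in> N \<longleftrightarrow> t l dvd e"
  using t by (simp add: spherical_type_def has_type_def order_mod_def)

lemma one_pow_N: "\<one>\<^bsub>Delta\<^esub> [^]\<^bsub>Delta\<^esub> (e::nat) \<in> N"
  using subgroup.one_closed[OF Tri_subgroup] by simp

lemma K0_rot12: "rot I1 I2 [^]\<^bsub>Delta\<^esub> (e::nat) \<in> K0 \<longleftrightarrow> t I0 dvd e"
proof -
  have "rot I1 I2 \<in> Delta0" using gens_in_Delta0 Delta0_mult by blast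
  then show ?thesis
    using phi_pow[of "rot I1 I2" e] N_order[of I1 I2 I0 e]
    by (simp add: K0_def phi_mult gens_in_Delta0 phi_gens)
qed

lemma K0_swap_rot12: "rot I1 I2 [^]\<^bsub>Delta\<^esub> (e::nat) \<in> K0_swap \<longleftrightarrow> e0 dvd e"
proof -
  let ?x = "Rgen I0 \<otimes>\<^bsub>Delta\<^esub> Rgen I1 \<otimes>\<^bsub>Delta\<^esub> Rgen I0 \<otimes>\<^bsub>Delta\<^esub> (Rgen I0 \<otimes>\<^bsub>Delta\<^esub> Rgen I2 \<otimes>\<^bsub>Delta\<^esub> Rgen I0)"
  have "Rgen I0 \<otimes>\<^bsub>Delta\<^esub> rot I1 I2 [^]\<^bsub>Delta\<^esub> e \<otimes>\<^bsub>Delta\<^esub> Rgen I0 = ?x [^]\<^bsub>Delta\<^esub> e"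
    using conj_pow[of "Rgen I0" "rot I1 I2" e] by (simp add: Delta.m_assoc)
  moreover have "?x \<in> Delta0" using gens_in_Delta0 Delta0_mult by blast
  moreover have "\<phi> ?x = rot I0 j" by (simp only: phi_mult gens_in_Delta0 phi_gens)
  ultimately have "rot I1 I2 [^]\<^bsub>Delta\<^esub> e \<in> K0_swap \<longleftrightarrow> rot I0 j [^]\<^bsub>Delta\<^esub> e \<in> N"
    using phi_pow[of ?x e] by (simp add: K0_swap_def K0_def)
  also have "\<dots> \<longleftrightarrow> e0 dvd e"
    using j N_order[of I0 I2 I1 e] one_pow_N by (auto simp: e0_def)
  finally show ?thesis .
qed

lemma K0_rot20: "rot I2 I0 [^]\<^bsub>Delta\<^esub> (e::nat) \<in> K0 \<longleftrightarrow> 2 * e1 dvd e"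
proof (cases "even e")
  case True
  then obtain d where d: "e = 2 * d" by (elim evenE)
  let ?x = "Rgen I2 \<otimes>\<^bsub>Delta\<^esub> (Rgen I0 \<otimes>\<^bsub>Delta\<^esub> Rgen I2 \<otimes>\<^bsub>Delta\<^esub> Rgen I0)"
  have "rot I2 I0 [^]\<^bsub>Delta\<^esub> e = ?x [^]\<^bsub>Delta\<^esub> d"
    unfolding d by (simp add: even_pow Delta.m_assoc)
  moreover have "?x \<in> Delta0" using gens_in_Delta0 Delta0_mult by blast
  moreover have "\<phi> ?x = rot I2 j" by (simp only: phi_mult gens_in_Delta0 phi_gens)
  ultimately have "rot I2 I0 [^]\<^bsub>Delta\<^esub> e \<in> K0 \<longleftrightarrow> rot I2 j [^]\<^bsub>Delta\<^esub> d \<in> N"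
    using phi_pow[of ?x d] by (simp add: K0_def)
  also have "\<dots> \<longleftrightarrow> e1 dvd d"
    using j N_order[of I2 I0 I1 d] one_pow_N by (auto simp: e1_def)
  finally show ?thesis by (simp add: d)
next
  case False
  then have "rot I2 I0 [^]\<^bsub>Delta\<^esub> e \<notin> Delta0"
    by (simp add: Delta0_eq odd_rot_pow)
  then show ?thesis using False K0_Delta0 by (meson dvd_mult_left subsetD)
qed

lemma K0_rot01: "rot I0 I1 [^]\<^bsub>Delta\<^esub> (e::nat) \<in> K0 \<longleftrightarrow> 2 * t I2 dvd e"
proof (cases "even e")
  case True
  then obtain d where d: "e = 2 * d" by (elim evenE)
  let ?x = "Rgen I0 \<otimes>\<^bsub>Delta\<^esub> Rgen I1 \<otimes>\<^bsub>Delta\<^esub> Rgen I0 \<otimes>\<^bsub>Delta\<^esub> Rgen I1"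
  have "rot I0 I1 [^]\<^bsub>Delta\<^esub> e = ?x [^]\<^bsub>Delta\<^esub> d"
    unfolding d by (simp add: even_pow Delta.m_assoc)
  moreover have "?x \<in> Delta0" using gens_in_Delta0 Delta0_mult by blast
  moreover have "\<phi> ?x = rot I0 I1" by (simp only: phi_mult gens_in_Delta0 phi_gens)
  ultimately have "rot I0 I1 [^]\<^bsub>Delta\<^esub> e \<in> K0 \<longleftrightarrow> rot I0 I1 [^]\<^bsub>Delta\<^esub> d \<in> N"
    using phi_pow[of ?x d] by (simp add: K0_def)
  also have "\<dots> \<longleftrightarrow> t I2 dvd d"
    by (rule N_order) auto
  finally show ?thesis by (simp add: d)
next
  case False
  then have "rot I0 I1 [^]\<^bsub>Delta\<^esub> e \<notin> Delta0"
    by (simp add: Delta0_eq odd_rot_pow)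
  then show ?thesis using False K0_Delta0 by (meson dvd_mult_left subsetD)
qed

text \<open>\<open>R\<^sub>0\<close> inverts the rotations in which it takes part.\<close>

lemma K0_swap_rot0: "k \<noteq> I0 \<Longrightarrow> rot I0 k [^]\<^bsub>Delta\<^esub> (e::nat) \<in> K0_swap \<longleftrightarrow> rot I0 k [^]\<^bsub>Delta\<^esub> e \<in> K0"
proof -
  have "Rgen I0 \<otimes>\<^bsub>Delta\<^esub> rot I0 k [^]\<^bsub>Delta\<^esub> e \<otimes>\<^bsub>Delta\<^esub> Rgen I0 = rot k I0 [^]\<^bsub>Delta\<^esub> e"
    using conj_pow[of "Rgen I0" "rot I0 k" e] by (simp add: Delta.m_assoc)
  then show ?thesis
    using rot_pow_swap[OF K0_subgroup] by (simp add: K0_swap_def)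
qed

subsection \<open>The lifted hypermap is spherical\<close>

text \<open>A coset of \<open>K0\<close> is a parity together with the coset of \<open>N\<close> met after moving its elements into
  \<open>Delta0\<close> and applying \<open>\<phi>\<close>.\<close>

lemma index_K0: "finite (rcosets\<^bsub>Delta\<^esub> K0)" "index K0 = 2 * index N"
proof -
  define f where "f g = (odd0 g, N #>\<^bsub>Delta\<^esub> \<phi> (if odd0 g then g \<otimes>\<^bsub>Delta\<^esub> Rgen I0 else g))" for g
  let ?s = "\<lambda>g. if odd0 g then g \<otimes>\<^bsub>Delta\<^esub> Rgen I0 else g"
  have s: "?s g \<in> Delta0" if "g \<in> carrier Delta" for g
    using that R0_shift by (simp add: Delta0_eq odd0_mult)
  have f: "u \<otimes>\<^bsub>Delta\<^esub> inv\<^bsub>Delta\<^esub> v \<in> K0 \<longleftrightarrow> f u = f v" if uv: "u \<in> carrier Delta" "v \<in> carrier Delta" for u v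
  proof (cases "odd0 u = odd0 v")
    case True
    have "u \<otimes>\<^bsub>Delta\<^esub> inv\<^bsub>Delta\<^esub> v = ?s u \<otimes>\<^bsub>Delta\<^esub> inv\<^bsub>Delta\<^esub> (?s v)"
      using uv True by (simp add: Delta.inv_mult_group Delta.m_assoc)
    moreover have "?s u \<otimes>\<^bsub>Delta\<^esub> inv\<^bsub>Delta\<^esub> (?s v) \<in> K0 \<longleftrightarrow> \<phi> (?s u) \<otimes>\<^bsub>Delta\<^esub> inv\<^bsub>Delta\<^esub> (\<phi> (?s v)) \<in> N"
      using s[OF uv(1)] s[OF uv(2)] subgroup.m_inv_closed[OF Delta0_subgroup]
      by (simp only: K0_def mem_Collect_eq Delta0_mult phi_mult phi_inv simp_thms)
    ultimately show ?thesis
      using Delta.rcoset_eq_iff[OF Tri_subgroup phi_closed[OF s[OF uv(1)]] phi_closed[OF s[OF uv(2)]], of t] True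
      by (simp only: f_def prod.inject simp_thms)
  next
    case False
    then have "u \<otimes>\<^bsub>Delta\<^esub> inv\<^bsub>Delta\<^esub> v \<notin> Delta0"
      using uv by (simp add: Delta0_eq odd0_mult)
    then show ?thesis using False K0_Delta0 by (auto simp: f_def)
  qed
  have "f ` carrier Delta = UNIV \<times> rcosets\<^bsub>Delta\<^esub> N"
  proof
    show "f ` carrier Delta \<subseteq> UNIV \<times> rcosets\<^bsub>Delta\<^esub> N"
      using phi_closed[OF s] coset_flags[OF Tri_subgroup] unfolding f_def by blast
    show "UNIV \<times> rcosets\<^bsub>Delta\<^esub> N \<subseteq> f ` carrier Delta"
    proof clarify
      fix b C assume "C \<in> rcosets\<^bsub>Delta\<^esub> N"
      then obtain g where "g \<in> carrier Delta" "C = N #>\<^bsub>Delta\<^esub> g"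
        using coset_flags[OF Tri_subgroup] by blast
      then obtain u where u: "u \<in> Delta0" "C = N #>\<^bsub>Delta\<^esub> \<phi> u" using phi_surj by metis
      have "f (if b then u \<otimes>\<^bsub>Delta\<^esub> Rgen I0 else u) = (b, C)"
        using u Delta0_even[OF u(1)] by (simp add: f_def odd0_mult Delta.m_assoc)
      then show "(b, C) \<in> f ` carrier Delta"
        using Delta0_closed[OF u(1)] by (metis Delta.m_closed Rgen_closed imageI)
    qed
  qed
  moreover obtain h where h: "bij_betw h (rcosets\<^bsub>Delta\<^esub> K0) (f ` carrier Delta)"
    by (rule Delta.bij_betw_rcosets_image[OF K0_subgroup f])
  ultimately have "bij_betw h (rcosets\<^bsub>Delta\<^esub> K0) ((UNIV :: bool set) \<times> rcosets\<^bsub>Delta\<^esub> N)" by simp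
  then show "finite (rcosets\<^bsub>Delta\<^esub> K0)" "index K0 = 2 * index N"
    using t bij_betw_finite[of h "rcosets\<^bsub>Delta\<^esub> K0"] bij_betw_same_card[of h "rcosets\<^bsub>Delta\<^esub> K0"]
    by (simp_all add: spherical_type_def card_cartesian_product)
qed

lemma K0_hypermap: "hypermap (coset_hypermap K0)"
  by (rule hypermap_coset[OF K0_subgroup index_K0(1) K0_Delta_plus])

lemma face_K0:
  assumes g: "g \<in> carrier Delta"
  shows "card (face (coset_hypermap K0) I0 (K0 #>\<^bsub>Delta\<^esub> g)) = 2 * (if odd0 g then e0 else t I0)"
    "card (face (coset_hypermap K0) I1 (K0 #>\<^bsub>Delta\<^esub> g)) = 2 * (2 * e1)"
    "card (face (coset_hypermap K0) I2 (K0 #>\<^bsub>Delta\<^esub> g)) = 2 * (2 * t I2)"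
proof -
  have C: "K0 #>\<^bsub>Delta\<^esub> g \<in> flags (coset_hypermap K0)"
    using g coset_flags[OF K0_subgroup] by auto
  have fix_iff: "act (coset_hypermap K0) w (K0 #>\<^bsub>Delta\<^esub> g) = K0 #>\<^bsub>Delta\<^esub> g \<longleftrightarrow>
      w \<in> (if odd0 g then K0_swap else K0)" if "w \<in> carrier Delta" for w
    using act_coset_fixes[OF K0_subgroup that g] K0_conj_iff[OF g that] by simp
  show "card (face (coset_hypermap K0) I0 (K0 #>\<^bsub>Delta\<^esub> g)) = 2 * (if odd0 g then e0 else t I0)"
    by (rule card_face[OF K0_hypermap C, of I1 I2])
      (simp_all add: fix_iff K0_rot12 K0_swap_rot12 t_pos e_pos)
  show "card (face (coset_hypermap K0) I1 (K0 #>\<^bsub>Delta\<^esub> g)) = 2 * (2 * e1)"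
    by (rule card_face[OF K0_hypermap C, of I0 I2])
      (simp_all add: fix_iff K0_swap_rot0 rot_pow_swap[OF K0_subgroup, of I0 I2] K0_rot20 e_pos)
  show "card (face (coset_hypermap K0) I2 (K0 #>\<^bsub>Delta\<^esub> g)) = 2 * (2 * t I2)"
    by (rule card_face[OF K0_hypermap C, of I0 I1])
      (simp_all add: fix_iff K0_swap_rot0 K0_rot01 t_pos)
qed

text \<open>The hypervertices on even and odd flags have different sizes, so the Euler characteristic is
  computed by summing over flags, half of which are of each parity. Compared with the hypermap of
  \<open>N\<close>, the term of the hyperedges splits as \<open>1/e0 + 1/e1 = 1 + 1/m\<close>, and the superfluous \<open>1\<close> makes up
  for the doubled number of flags.\<close>

lemma K0_spherical: "spherical (coset_hypermap K0)"
proof -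
  let ?X = "rcosets\<^bsub>Delta\<^esub> K0"
  define A where "A = (\<lambda>g. K0 #>\<^bsub>Delta\<^esub> g) ` {g \<in> carrier Delta. \<not> odd0 g}"
  define B where "B = (\<lambda>g. K0 #>\<^bsub>Delta\<^esub> g) ` {g \<in> carrier Delta. odd0 g}"
  have X: "?X = A \<union> B"
  proof -
    have "carrier Delta = {g \<in> carrier Delta. \<not> odd0 g} \<union> {g \<in> carrier Delta. odd0 g}" by blast
    then have "(\<lambda>g. K0 #>\<^bsub>Delta\<^esub> g) ` carrier Delta = A \<union> B"
      unfolding A_def B_def by (metis image_Un)
    then show ?thesis unfolding RCOSETS_def by blast
  qed
  have finAB: "finite A" "finite B"
    using index_K0(1) by (simp_all add: X)
  have disj: "A \<inter> B = {}"
  proof (rule equals0I)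
    fix C assume "C \<in> A \<inter> B"
    then obtain g h where gh: "g \<in> carrier Delta" "\<not> odd0 g" "h \<in> carrier Delta" "odd0 h"
      "K0 #>\<^bsub>Delta\<^esub> g = K0 #>\<^bsub>Delta\<^esub> h" by (auto simp: A_def B_def)
    then have "g \<otimes>\<^bsub>Delta\<^esub> inv\<^bsub>Delta\<^esub> h \<in> Delta0"
      using Delta.rcoset_eq_iff[OF K0_subgroup] K0_Delta0 by blast
    then show False using gh by (simp add: Delta0_eq odd0_mult)
  qed
  have "bij_betw (\<lambda>C. C #>\<^bsub>Delta\<^esub> Rgen I0) A B"
    by (rule bij_betw_byWitness[where f' = "\<lambda>C. C #>\<^bsub>Delta\<^esub> Rgen I0"])
      (auto simp: A_def B_def Delta.coset_mult_assoc[OF M_sub[OF K0_subgroup]] Delta.m_assoc odd0_mult)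
  then have "card A = card B" by (rule bij_betw_same_card)
  then have cards: "card A = index N" "card B = index N"
    using index_K0(2) card_Un_disjoint[OF finAB disj] by (simp_all add: X)
  have vA: "card (face (coset_hypermap K0) I0 C) = 2 * t I0" if "C \<in> A" for C
    using that face_K0(1) by (auto simp: A_def)
  have vB: "card (face (coset_hypermap K0) I0 C) = 2 * e0" if "C \<in> B" for C
    using that face_K0(1) by (auto simp: B_def)
  have eX: "card (face (coset_hypermap K0) I1 C) = 2 * (2 * e1)" "card (face (coset_hypermap K0) I2 C) = 2 * (2 * t I2)"
    if "C \<in> A \<union> B" for C
    using that face_K0(2,3) by (auto simp: A_def B_def)
  have V: "(\<Sum>C\<in>A \<union> B. 1 / of_nat (card (face (coset_hypermap K0) I0 C)) :: rat)
      = of_nat (index N) / (2 * of_nat (t I0)) + of_nat (index N) / (2 * of_nat e0)"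
    unfolding sum.union_disjoint[OF finAB disj] using vA vB cards by simp
  have E: "(\<Sum>C\<in>A \<union> B. 1 / of_nat (card (face (coset_hypermap K0) I1 C)) :: rat) = of_nat (index N) / (2 * of_nat e1)"
    and F: "(\<Sum>C\<in>A \<union> B. 1 / of_nat (card (face (coset_hypermap K0) I2 C)) :: rat) = of_nat (index N) / (2 * of_nat (t I2))"
    using eX index_K0(2) by (simp_all add: X)
  have e: "1 / of_nat e0 + 1 / of_nat e1 = (1 :: rat) + 1 / of_nat (t I1)"
    by (simp add: e0_def e1_def)
  have sp: "of_nat (index N) * (1 / of_nat (t I0) + 1 / of_nat (t I1) + 1 / of_nat (t I2) - 1) = (4 :: rat)"
    using t by (simp add: spherical_type_def UNIV_idx add.assoc)
  have "(of_int (euler_char (coset_hypermap K0)) :: rat)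
      = of_nat (index N) / 2 * (1 / of_nat (t I0) + (1 / of_nat e0 + 1 / of_nat e1) + 1 / of_nat (t I2)) - of_nat (index N)"
    unfolding euler_char_sum[OF K0_hypermap] UNIV_idx using V E F index_K0(2)
    by (simp add: X algebra_simps)
  also have "\<dots> = of_nat (index N) * (1 / of_nat (t I0) + 1 / of_nat (t I1) + 1 / of_nat (t I2) - 1) / 2"
    unfolding e by (simp add: algebra_simps)
  finally show ?thesis
    unfolding sp spherical_def by simp
qed

end

section \<open>Closure cover, covering core and irregularity group\<close>

text \<open>\<open>tau\<close> replaces \<open>R\<^sub>0\<close> by the conjugate of \<open>R\<^sub>1\<close> that \<open>\<phi>\<close> maps to \<open>R\<^sub>0\<close>. So \<open>tau \<circ> \<phi>\<close> fixes \<open>R\<^sub>1\<close>, \<open>R\<^sub>2\<close>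
  and that conjugate; only the fourth generator of \<open>Delta0\<close> is moved.\<close>

definition tau_gen :: "idx \<Rightarrow> idx list" where
  "tau_gen i = (if i = I0 then Rgen I0 \<otimes>\<^bsub>Delta\<^esub> Rgen I1 \<otimes>\<^bsub>Delta\<^esub> Rgen I0 else Rgen i)"

definition tau :: "idx list \<Rightarrow> idx list" where
  "tau = hom_of Delta tau_gen"

lemma tau_hom: "group_hom Delta Delta tau" and tau_Rgen: "tau (Rgen i) = tau_gen i"
  unfolding tau_def by (rule hom_of; simp add: tau_gen_def Delta.m_assoc group_Delta)+

lemma normal_mem_iff:
  assumes "N \<lhd> Delta" "w \<in> carrier Delta"
  shows "w \<in> N \<longleftrightarrow> N #>\<^bsub>Delta\<^esub> w = \<one>\<^bsub>Delta Mod N\<^esub>"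
  using Delta.rcoset_eq_iff[OF normal_imp_subgroup[OF assms(1)] assms(2) Delta.one_closed]
    assms subgroup.subset[OF normal_imp_subgroup[OF assms(1)]] by (simp add: FactGroup_def)

lemma Mod_hom: "N \<lhd> Delta \<Longrightarrow> group_hom Delta (Delta Mod N) (\<lambda>w. N #>\<^bsub>Delta\<^esub> w)"
  by (simp add: group_hom_def group_hom_axioms_def group_Delta normal.factorgroup_is_group
      normal.r_coset_hom_Mod)

definition Theta :: "idx list set \<Rightarrow> idx list set" where
  "Theta M = {w \<in> carrier Delta. tau w \<in> M}"

lemma Theta_normal: "M \<lhd> Delta \<Longrightarrow> Theta M \<lhd> Delta"
  unfolding Theta_def by (rule group_hom.vimage_normal[OF tau_hom])

text \<open>Conditions that make \<open>M\<close> the normal closure of \<open>K0\<close>. The last one says that \<open>tau \<circ> \<phi>\<close> fixes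
  also the fourth generator of \<open>Delta0\<close>, modulo \<open>M\<close>.\<close>

locale lifting_cover = lifting +
  fixes M :: "idx list set"
  assumes M: "M \<lhd> Delta" and M_closure: "M \<subseteq> normal_closure Delta K0"
    and N_tau: "\<And>w. w \<in> Tri t \<Longrightarrow> tau w \<in> M"
    and twist: "Rgen I0 \<otimes>\<^bsub>Delta\<^esub> Rgen I2 \<otimes>\<^bsub>Delta\<^esub> Rgen I0 \<otimes>\<^bsub>Delta\<^esub> inv\<^bsub>Delta\<^esub> (tau (Rgen j)) \<in> M"
begin

lemma Theta_subgroup: "subgroup (Theta M) Delta"
  by (rule normal_imp_subgroup[OF Theta_normal[OF M]])

lemma M_subgroup: "subgroup M Delta"
  by (rule normal_imp_subgroup[OF M])

lemma N_Theta: "N \<subseteq> Theta M"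
  using N_tau subgroup.mem_carrier[OF Tri_subgroup] by (auto simp: Theta_def)

lemma tau_phi:
  assumes "w \<in> Delta0"
  shows "M #>\<^bsub>Delta\<^esub> tau (\<phi> w) = M #>\<^bsub>Delta\<^esub> w"
proof (rule Delta0_hom_unique[of "Delta Mod M" "\<lambda>w. M #>\<^bsub>Delta\<^esub> tau (\<phi> w)" "\<lambda>w. M #>\<^bsub>Delta\<^esub> w"])
  interpret m: group_hom Delta "Delta Mod M" "\<lambda>w. M #>\<^bsub>Delta\<^esub> w" by (rule Mod_hom[OF M])
  interpret tau: group_hom Delta Delta tau by (rule tau_hom)
  show "group (Delta Mod M)" ..
  show "(\<lambda>w. M #>\<^bsub>Delta\<^esub> tau (\<phi> w)) \<in> hom Delta0_group (Delta Mod M)"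
    using m.hom_closed m.hom_mult by (auto simp: hom_def phi_mult phi_closed)
  show "(\<lambda>w. M #>\<^bsub>Delta\<^esub> w) \<in> hom Delta0_group (Delta Mod M)"
    using m.hom_closed m.hom_mult by (auto simp: hom_def Delta0_closed)
  fix x assume "x \<in> Delta0_gens"
  moreover have "M #>\<^bsub>Delta\<^esub> tau (Rgen j) = M #>\<^bsub>Delta\<^esub> (Rgen I0 \<otimes>\<^bsub>Delta\<^esub> Rgen I2 \<otimes>\<^bsub>Delta\<^esub> Rgen I0)"
    using twist Delta.rcoset_eq_iff[OF M_subgroup, of "Rgen I0 \<otimes>\<^bsub>Delta\<^esub> Rgen I2 \<otimes>\<^bsub>Delta\<^esub> Rgen I0" "tau (Rgen j)"]
    by simp
  ultimately show "M #>\<^bsub>Delta\<^esub> tau (\<phi> x) = M #>\<^bsub>Delta\<^esub> x"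
    by (auto simp: Delta0_gens_def conjg_R0 phi_gens tau_Rgen tau_gen_def)
qed (rule assms)

lemma M_iff_Theta:
  assumes "w \<in> Delta0"
  shows "w \<in> M \<longleftrightarrow> \<phi> w \<in> Theta M"
proof -
  have "tau (\<phi> w) \<in> carrier Delta"
    using group_hom.hom_closed[OF tau_hom] phi_closed[OF assms] by simp
  then show ?thesis
    using normal_mem_iff[OF M] tau_phi[OF assms] phi_closed[OF assms] Delta0_closed[OF assms]
    by (simp add: Theta_def)
qed

lemma K0_M: "K0 \<subseteq> M"
  using M_iff_Theta N_Theta by (auto simp: K0_def)

lemma closure_K0: "normal_closure Delta K0 = M"
  using normal_closure_least[OF M K0_M] M_closure by blast

lemma M_Delta0: "M \<subseteq> Delta0"
  unfolding closure_K0[symmetric] by (rule normal_closure_least[OF Delta0_normal K0_Delta0])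

lemma finite_M: "finite (rcosets\<^bsub>Delta\<^esub> M)"
proof -
  have "(\<lambda>u. M #>\<^bsub>Delta\<^esub> u) ` carrier Delta = rcosets\<^bsub>Delta\<^esub> M"
    by (auto simp: RCOSETS_def)
  moreover have "finite ((\<lambda>u. M #>\<^bsub>Delta\<^esub> u) ` carrier Delta)"
    by (rule Delta.card_rcosets_ge_image(1)[OF K0_subgroup index_K0(1)])
      (use K0_M Delta.rcoset_eq_iff[OF M_subgroup] in blast)
  ultimately show ?thesis by simp
qed

text \<open>As the choice made by \<open>hsub\<close> is unknown, the invariants are computed for every conjugate.\<close>

definition K_conj :: "idx list \<Rightarrow> idx list set" where
  "K_conj g = {w \<in> carrier Delta. g \<otimes>\<^bsub>Delta\<^esub> w \<otimes>\<^bsub>Delta\<^esub> inv\<^bsub>Delta\<^esub> g \<in> K0}"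

lemma conj_group_hom:
  assumes "g \<in> carrier Delta"
  shows "group_hom Delta Delta (\<lambda>w. g \<otimes>\<^bsub>Delta\<^esub> w \<otimes>\<^bsub>Delta\<^esub> inv\<^bsub>Delta\<^esub> g)"
proof -
  have "inv\<^bsub>Delta\<^esub> g \<otimes>\<^bsub>Delta\<^esub> (g \<otimes>\<^bsub>Delta\<^esub> z) = z" if "z \<in> carrier Delta" for z
    using that assms by (simp add: Delta.m_assoc[symmetric])
  then show ?thesis
    using assms by (auto simp: group_hom_def group_hom_axioms_def hom_def group_Delta Delta.m_assoc)
qed

lemma inv_conj_eq:
  assumes "g \<in> carrier Delta" "w \<in> carrier Delta"
  shows "g \<otimes>\<^bsub>Delta\<^esub> (inv\<^bsub>Delta\<^esub> g \<otimes>\<^bsub>Delta\<^esub> w \<otimes>\<^bsub>Delta\<^esub> g) \<otimes>\<^bsub>Delta\<^esub> inv\<^bsub>Delta\<^esub> g = w"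
proof -
  have "g \<otimes>\<^bsub>Delta\<^esub> (inv\<^bsub>Delta\<^esub> g \<otimes>\<^bsub>Delta\<^esub> z) = z" if "z \<in> carrier Delta" for z
    using that assms by (simp add: Delta.m_assoc[symmetric])
  then show ?thesis using assms by (simp add: Delta.m_assoc)
qed

context
  fixes g assumes g: "g \<in> carrier Delta"
begin

lemma K_conj_subgroup: "subgroup (K_conj g) Delta"
proof -
  interpret c: group_hom Delta Delta "\<lambda>w. g \<otimes>\<^bsub>Delta\<^esub> w \<otimes>\<^bsub>Delta\<^esub> inv\<^bsub>Delta\<^esub> g" by (rule conj_group_hom[OF g])
  note K = K0_subgroup
  have inv: "inv\<^bsub>Delta\<^esub> w \<in> K_conj g" if "w \<in> K_conj g" for w
    using that subgroup.m_inv_closed[OF K, of "g \<otimes>\<^bsub>Delta\<^esub> w \<otimes>\<^bsub>Delta\<^esub> inv\<^bsub>Delta\<^esub> g"] c.hom_inv[of w]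
    by (simp add: K_conj_def)
  have mult: "u \<otimes>\<^bsub>Delta\<^esub> v \<in> K_conj g" if "u \<in> K_conj g" "v \<in> K_conj g" for u v
    using that subgroup.m_closed[OF K, of "g \<otimes>\<^bsub>Delta\<^esub> u \<otimes>\<^bsub>Delta\<^esub> inv\<^bsub>Delta\<^esub> g" "g \<otimes>\<^bsub>Delta\<^esub> v \<otimes>\<^bsub>Delta\<^esub> inv\<^bsub>Delta\<^esub> g"]
      c.hom_mult[of u v] by (simp add: K_conj_def)
  have "\<one>\<^bsub>Delta\<^esub> \<in> K_conj g"
    using g subgroup.one_closed[OF K] by (simp add: K_conj_def)
  then show ?thesis
    by (intro Delta.subgroupI) (use inv mult in \<open>auto simp: K_conj_def\<close>)
qed

lemma K_conj_M: "K_conj g \<subseteq> M"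
  using K0_M normal_conj_iff[OF M g] by (auto simp: K_conj_def)

lemma closure_K_conj: "normal_closure Delta (K_conj g) = M"
proof
  show "normal_closure Delta (K_conj g) \<subseteq> M"
    by (rule normal_closure_least[OF M K_conj_M])
  have nc: "normal_closure Delta (K_conj g) \<lhd> Delta"
    by (rule Delta.normal_closure_normal) (auto simp: K_conj_def)
  have "K0 \<subseteq> normal_closure Delta (K_conj g)"
  proof
    fix w assume w: "w \<in> K0"
    then have wc: "w \<in> carrier Delta" by (rule subgroup.mem_carrier[OF K0_subgroup])
    let ?w = "inv\<^bsub>Delta\<^esub> g \<otimes>\<^bsub>Delta\<^esub> w \<otimes>\<^bsub>Delta\<^esub> g"
    have "?w \<in> K_conj g"
      using w wc g inv_conj_eq[OF g wc] by (simp add: K_conj_def)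
    then have "?w \<in> normal_closure Delta (K_conj g)"
      by (rule subsetD[OF normal_closure_subset])
    then show "w \<in> normal_closure Delta (K_conj g)"
      using normal_conj_iff[OF nc g, of ?w] inv_conj_eq[OF g wc] g wc by simp
  qed
  then show "M \<subseteq> normal_closure Delta (K_conj g)"
    unfolding closure_K0[symmetric] by (rule normal_closure_least[OF nc])
qed

text \<open>Conjugation by \<open>g\<close> followed by \<open>\<phi>\<close> maps \<open>M\<close> onto \<open>Theta M\<close>, and the preimage of \<open>N\<close> there is
  \<open>K_conj g\<close>.\<close>

lemma irregularity_iso:
  "Delta\<lparr>carrier := M\<rparr> Mod K_conj g \<cong> Delta\<lparr>carrier := Theta M\<rparr> Mod N"
proof -
  let ?Th = "Delta\<lparr>carrier := Theta M\<rparr>"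
  have Th: "group ?Th" by (rule Delta.subgroup_imp_group[OF Theta_subgroup])
  have NTh: "N \<lhd> ?Th"
    by (rule Delta.normal_restrict_supergroup[OF Theta_subgroup Tri_normal N_Theta])
  interpret c: group_hom Delta Delta "\<lambda>w. g \<otimes>\<^bsub>Delta\<^esub> w \<otimes>\<^bsub>Delta\<^esub> inv\<^bsub>Delta\<^esub> g" by (rule conj_group_hom[OF g])
  interpret q: group_hom ?Th "?Th Mod N" "\<lambda>w. N #>\<^bsub>?Th\<^esub> w"
    using Th normal.factorgroup_is_group[OF NTh] normal.r_coset_hom_Mod[OF NTh]
    by (simp add: group_hom_def group_hom_axioms_def)
  define c where "c w = g \<otimes>\<^bsub>Delta\<^esub> w \<otimes>\<^bsub>Delta\<^esub> inv\<^bsub>Delta\<^esub> g" for w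
  have cM: "c w \<in> M \<longleftrightarrow> w \<in> M" if "w \<in> carrier Delta" for w
    using normal_conj_iff[OF M g that] by (simp add: c_def)
  have Mc: "w \<in> carrier Delta" if "w \<in> M" for w
    by (rule subgroup.mem_carrier[OF M_subgroup that])
  have c0: "c w \<in> Delta0" if "w \<in> M" for w
    using cM[OF Mc[OF that]] that M_Delta0 by blast
  have cT: "\<phi> (c w) \<in> Theta M" if "w \<in> M" for w
    using M_iff_Theta[OF c0[OF that]] cM[OF Mc[OF that]] that by simp
  define \<psi> where "\<psi> w = N #>\<^bsub>?Th\<^esub> \<phi> (c w)" for w
  have hom: "group_hom (Delta\<lparr>carrier := M\<rparr>) (?Th Mod N) \<psi>"
  proof -
    have "\<psi> w \<in> carrier (?Th Mod N)" if "w \<in> M" for w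
      using q.hom_closed[of "\<phi> (c w)"] cT[OF that] by (simp add: \<psi>_def)
    moreover have "\<psi> (u \<otimes>\<^bsub>Delta\<^esub> v) = \<psi> u \<otimes>\<^bsub>?Th Mod N\<^esub> \<psi> v" if "u \<in> M" "v \<in> M" for u v
    proof -
      have "c (u \<otimes>\<^bsub>Delta\<^esub> v) = c u \<otimes>\<^bsub>Delta\<^esub> c v"
        using c.hom_mult[of u v] Mc that by (simp add: c_def)
      then show ?thesis
        using q.hom_mult[of "\<phi> (c u)" "\<phi> (c v)"] cT that c0 by (simp add: \<psi>_def phi_mult)
    qed
    ultimately show ?thesis
      by (auto simp: group_hom_def group_hom_axioms_def hom_def Delta.subgroup_imp_group[OF M_subgroup]
          normal.factorgroup_is_group[OF NTh])
  qed
  have ker: "kernel (Delta\<lparr>carrier := M\<rparr>) (?Th Mod N) \<psi> = K_conj g"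
  proof -
    have "\<psi> w = \<one>\<^bsub>?Th Mod N\<^esub> \<longleftrightarrow> c w \<in> K0" if "w \<in> M" for w
    proof -
      have "N #>\<^bsub>?Th\<^esub> x = N #>\<^bsub>Delta\<^esub> x" for x
        by (simp add: r_coset_def)
      then have "\<psi> w = \<one>\<^bsub>?Th Mod N\<^esub> \<longleftrightarrow> \<phi> (c w) \<in> N"
        using normal_mem_iff[OF Tri_normal phi_closed[OF c0[OF that]], of t]
        by (simp add: \<psi>_def FactGroup_def)
      then show ?thesis using c0[OF that] by (simp add: K0_def)
    qed
    then show ?thesis
      using K_conj_M Mc by (auto simp: kernel_def K_conj_def c_def)
  qed
  have surj: "\<psi> ` carrier (Delta\<lparr>carrier := M\<rparr>) = carrier (?Th Mod N)"
  proof
    show "\<psi> ` carrier (Delta\<lparr>carrier := M\<rparr>) \<subseteq> carrier (?Th Mod N)"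
      using group_hom.hom_closed[OF hom] by blast
    show "carrier (?Th Mod N) \<subseteq> \<psi> ` carrier (Delta\<lparr>carrier := M\<rparr>)"
    proof
      fix C assume "C \<in> carrier (?Th Mod N)"
      then obtain x where x: "x \<in> Theta M" "C = N #>\<^bsub>?Th\<^esub> x"
        by (auto simp: FactGroup_def RCOSETS_def)
      then have "x \<in> carrier Delta" by (simp add: Theta_def)
      then obtain u where u: "u \<in> Delta0" "\<phi> u = x" using phi_surj by blast
      then have uM: "u \<in> M" using M_iff_Theta x by simp
      let ?w = "inv\<^bsub>Delta\<^esub> g \<otimes>\<^bsub>Delta\<^esub> u \<otimes>\<^bsub>Delta\<^esub> g"
      have "c ?w = u" "?w \<in> carrier Delta"
        using inv_conj_eq[OF g Mc[OF uM]] g Mc[OF uM] by (simp_all add: c_def)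
      then have "?w \<in> M" "\<psi> ?w = C" using cM[of ?w] uM u x by (simp_all add: \<psi>_def)
      then show "C \<in> \<psi> ` carrier (Delta\<lparr>carrier := M\<rparr>)" by auto
    qed
  qed
  show ?thesis
    using group_hom.FactGroup_iso[OF hom surj] by (simp add: ker)
qed

end

lemma K_conj_one: "K_conj \<one>\<^bsub>Delta\<^esub> = K0"
  using subgroup.subset[OF K0_subgroup] by (auto simp: K_conj_def)

lemma K_conj_R0: "K_conj (Rgen I0) = K0_swap"
  by (simp add: K_conj_def K0_swap_def)

lemma K_conj_cases: "g \<in> carrier Delta \<Longrightarrow> K_conj g = (if odd0 g then K0_swap else K0)"
  using K0_conj_iff[of g] subgroup.subset[OF K0_subgroup] by (auto simp: K_conj_def K0_swap_def)

text \<open>By the isomorphism above this is the index in \<open>M\<close> of each conjugate of \<open>K0\<close>.\<close>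

definition iota :: nat where
  "iota = order (Delta\<lparr>carrier := Theta M\<rparr> Mod N)"

lemma card_rcosets_iota:
  "g \<in> carrier Delta \<Longrightarrow> card (rcosets\<^bsub>Delta\<lparr>carrier := M\<rparr>\<^esub> (K_conj g)) = iota"
  using iso_same_card[OF irregularity_iso[of g]] by (simp add: iota_def order_def FactGroup_def)

lemma iota_1:
  assumes "g \<in> carrier Delta"
  shows "iota = 1 \<longleftrightarrow> K_conj g = M"
  using group.card_rcosets_1[OF Delta.subgroup_imp_group[OF M_subgroup]
      Delta.subgroup_incl[OF K_conj_subgroup[OF assms] M_subgroup K_conj_M[OF assms]]]
    card_rcosets_iota[OF assms] by simp

lemma index_iota: "2 * index N = index M * iota"
  using Delta.card_rcosets_tower[OF K0_subgroup M_subgroup K0_M] card_rcosets_iota[of "\<one>\<^bsub>Delta\<^esub>"]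
  by (simp add: K_conj_one index_K0)

definition core :: "idx list set" where
  "core = K0 \<inter> K0_swap"

lemma K0_swap_normal: "K0_swap \<lhd> Delta0_group"
proof -
  have sub: "K0_swap \<subseteq> Delta0"
    using K_conj_M[of "Rgen I0"] M_Delta0 by (simp add: K_conj_R0)
  have "subgroup K0_swap Delta" using K_conj_subgroup[of "Rgen I0"] by (simp add: K_conj_R0)
  then have "subgroup K0_swap Delta0_group" using Delta.subgroup_incl Delta0_subgroup sub by blast
  moreover have "x \<otimes>\<^bsub>Delta\<^esub> h \<otimes>\<^bsub>Delta\<^esub> inv\<^bsub>Delta\<^esub> x \<in> K0_swap" if x: "x \<in> Delta0" "h \<in> K0_swap" for x h
  proof -
    have xc: "x \<in> carrier Delta" "\<not> odd0 x" using Delta0_even[OF x(1)] by auto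
    have hc: "h \<in> carrier Delta" using x by (simp add: K0_swap_def)
    have "(Rgen I0 \<otimes>\<^bsub>Delta\<^esub> x) \<otimes>\<^bsub>Delta\<^esub> h \<otimes>\<^bsub>Delta\<^esub> inv\<^bsub>Delta\<^esub> (Rgen I0 \<otimes>\<^bsub>Delta\<^esub> x) \<in> K0"
      using K0_conj_iff[of "Rgen I0 \<otimes>\<^bsub>Delta\<^esub> x" h] xc hc x(2) by (simp add: odd0_mult)
    then show ?thesis
      using xc hc by (simp add: K0_swap_def Delta.inv_mult_group Delta.m_assoc)
  qed
  ultimately show ?thesis
    using Delta.m_inv_consistent[OF Delta0_subgroup]
    by (intro group.normal_invI[OF Delta0_group]) simp_all
qed

lemma normal_core_K_conj:
  assumes g: "g \<in> carrier Delta"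
  shows "normal_core Delta (K_conj g) = core"
proof -
  have mem: "x \<in> (\<lambda>x. conjg Delta x h) ` K_conj g \<longleftrightarrow> x \<in> K_conj (g \<otimes>\<^bsub>Delta\<^esub> h)"
    if h: "h \<in> carrier Delta" for x h
  proof
    assume "x \<in> (\<lambda>x. conjg Delta x h) ` K_conj g"
    then obtain y where y: "y \<in> K_conj g" "x = inv\<^bsub>Delta\<^esub> h \<otimes>\<^bsub>Delta\<^esub> y \<otimes>\<^bsub>Delta\<^esub> h"
      by (auto simp: conjg_def)
    then have yc: "y \<in> carrier Delta" by (simp add: K_conj_def)
    have xc: "x \<in> carrier Delta" using y(2) yc h by simp
    have "(g \<otimes>\<^bsub>Delta\<^esub> h) \<otimes>\<^bsub>Delta\<^esub> x \<otimes>\<^bsub>Delta\<^esub> inv\<^bsub>Delta\<^esub> (g \<otimes>\<^bsub>Delta\<^esub> h)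
        = g \<otimes>\<^bsub>Delta\<^esub> (h \<otimes>\<^bsub>Delta\<^esub> x \<otimes>\<^bsub>Delta\<^esub> inv\<^bsub>Delta\<^esub> h) \<otimes>\<^bsub>Delta\<^esub> inv\<^bsub>Delta\<^esub> g"
      using g h xc by (simp add: Delta.inv_mult_group Delta.m_assoc)
    also have "\<dots> = g \<otimes>\<^bsub>Delta\<^esub> y \<otimes>\<^bsub>Delta\<^esub> inv\<^bsub>Delta\<^esub> g"
      unfolding y(2) inv_conj_eq[OF h yc] ..
    finally show "x \<in> K_conj (g \<otimes>\<^bsub>Delta\<^esub> h)"
      using y g h yc by (simp add: K_conj_def)
  next
    assume x: "x \<in> K_conj (g \<otimes>\<^bsub>Delta\<^esub> h)"
    then have xc: "x \<in> carrier Delta" by (simp add: K_conj_def)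
    let ?y = "h \<otimes>\<^bsub>Delta\<^esub> x \<otimes>\<^bsub>Delta\<^esub> inv\<^bsub>Delta\<^esub> h"
    have "(g \<otimes>\<^bsub>Delta\<^esub> h) \<otimes>\<^bsub>Delta\<^esub> x \<otimes>\<^bsub>Delta\<^esub> inv\<^bsub>Delta\<^esub> (g \<otimes>\<^bsub>Delta\<^esub> h)
        = g \<otimes>\<^bsub>Delta\<^esub> ?y \<otimes>\<^bsub>Delta\<^esub> inv\<^bsub>Delta\<^esub> g"
      using g h xc by (simp add: Delta.inv_mult_group Delta.m_assoc)
    then have "?y \<in> K_conj g" using x g h by (simp add: K_conj_def)
    moreover have "conjg Delta ?y h = x"
      using inv_conj_eq[of "inv\<^bsub>Delta\<^esub> h" x] h xc by (simp add: conjg_def)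
    ultimately show "x \<in> (\<lambda>x. conjg Delta x h) ` K_conj g" by (metis imageI)
  qed
  have "normal_core Delta (K_conj g) = (\<Inter>h\<in>carrier Delta. K_conj (g \<otimes>\<^bsub>Delta\<^esub> h))"
    unfolding normal_core_def using mem by (intro INF_cong refl set_eqI) auto
  also have "\<dots> = (\<Inter>h\<in>carrier Delta. K_conj h)"
  proof -
    have "(\<lambda>h. g \<otimes>\<^bsub>Delta\<^esub> h) ` carrier Delta = carrier Delta"
      by (rule Delta.surj_const_mult[OF g])
    then have "K_conj ` carrier Delta = K_conj ` (\<lambda>h. g \<otimes>\<^bsub>Delta\<^esub> h) ` carrier Delta" by simp
    then show ?thesis by (simp add: image_image)
  qed
  also have "\<dots> = core"
  proof
    show "(\<Inter>h\<in>carrier Delta. K_conj h) \<subseteq> core"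
      unfolding core_def K_conj_one[symmetric] K_conj_R0[symmetric]
      by (intro Int_greatest INT_lower) simp_all
    show "core \<subseteq> (\<Inter>h\<in>carrier Delta. K_conj h)"
    proof (rule INT_greatest)
      fix h assume "h \<in> carrier Delta"
      then show "core \<subseteq> K_conj h" by (simp add: K_conj_cases core_def)
    qed
  qed
  finally show ?thesis .
qed

lemma core_normal: "core \<lhd> Delta"
proof (rule Delta.normal_invI)
  show sg: "subgroup core Delta"
    unfolding core_def using K0_subgroup K_conj_subgroup[of "Rgen I0"]
    by (simp add: K_conj_R0 Delta.subgroups_Inter_pair)
  fix x h assume x: "x \<in> carrier Delta" and h: "h \<in> core"
  have hc: "h \<in> carrier Delta" by (rule subgroup.mem_carrier[OF sg h])
  have both: "y \<otimes>\<^bsub>Delta\<^esub> h \<otimes>\<^bsub>Delta\<^esub> inv\<^bsub>Delta\<^esub> y \<in> K0" if "y \<in> carrier Delta" for y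
    using K0_conj_iff[OF that hc] h by (simp add: core_def)
  then show "x \<otimes>\<^bsub>Delta\<^esub> h \<otimes>\<^bsub>Delta\<^esub> inv\<^bsub>Delta\<^esub> x \<in> core"
    using both[of x] both[of "Rgen I0 \<otimes>\<^bsub>Delta\<^esub> x"] x hc
    by (simp add: core_def K0_swap_def Delta.inv_mult_group Delta.m_assoc)
qed

text \<open>The product of the two conjugates is normal, hence equal to the normal closure; so the second
  isomorphism theorem identifies the index of the core in \<open>K0\<close> with \<open>\<iota>\<close>.\<close>

lemma index_core: "finite (rcosets\<^bsub>Delta\<^esub> core)" "index core = 2 * index N * iota"
proof -
  interpret D0: group Delta0_group by (rule Delta0_group)
  interpret S: second_isomorphism_grp K0_swap Delta0_group K0
    using K0_swap_normal normal_imp_subgroup[OF K0_normal]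
    by (simp add: second_isomorphism_grp_def second_isomorphism_grp_axioms_def)
  define P where "P = K0_swap <#>\<^bsub>Delta0_group\<^esub> K0"
  have P: "P = {a \<otimes>\<^bsub>Delta\<^esub> b | a b. a \<in> K0_swap \<and> b \<in> K0}"
    by (auto simp: P_def set_mult_def)
  have PD: "P \<lhd> Delta0_group"
    unfolding P_def by (rule D0.normal_subgroup_set_mult_closed[OF K0_swap_normal K0_normal])
  have P0: "P \<subseteq> Delta0"
    using subgroup.subset[OF normal_imp_subgroup[OF PD]] by simp
  have Psub: "subgroup P Delta"
    using Delta.incl_subgroup[OF Delta0_subgroup normal_imp_subgroup[OF PD]] .
  have Pc: "p \<in> carrier Delta" if "p \<in> P" for p by (rule subgroup.mem_carrier[OF Psub that])
  have P_conj0: "x \<otimes>\<^bsub>Delta\<^esub> p \<otimes>\<^bsub>Delta\<^esub> inv\<^bsub>Delta\<^esub> x \<in> P" if "x \<in> Delta0" "p \<in> P" for x p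
    using D0.normal_invE(2)[OF PD, of x p] that Delta.m_inv_consistent[OF Delta0_subgroup that(1)] by simp
  have K0c: "w \<in> carrier Delta" if "w \<in> K0" for w by (rule subgroup.mem_carrier[OF K0_subgroup that])
  have swap: "Rgen I0 \<otimes>\<^bsub>Delta\<^esub> w \<otimes>\<^bsub>Delta\<^esub> Rgen I0 \<in> K0_swap" if "w \<in> K0" for w
    using that K0c[OF that] by (simp add: K0_swap_def Delta.m_assoc)
  have inP: "K0 \<subseteq> P" "K0_swap \<subseteq> P"
    unfolding P_def using S.S_contained_in_set_mult S.H_contained_in_set_mult by auto
  have P_R0: "Rgen I0 \<otimes>\<^bsub>Delta\<^esub> p \<otimes>\<^bsub>Delta\<^esub> Rgen I0 \<in> P" if "p \<in> P" for p
  proof -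
    obtain a b where ab: "a \<in> K0_swap" "b \<in> K0" "p = a \<otimes>\<^bsub>Delta\<^esub> b"
      using \<open>p \<in> P\<close> by (auto simp: P)
    have ac: "a \<in> carrier Delta" using ab by (simp add: K0_swap_def)
    have "Rgen I0 \<otimes>\<^bsub>Delta\<^esub> p \<otimes>\<^bsub>Delta\<^esub> Rgen I0
        = (Rgen I0 \<otimes>\<^bsub>Delta\<^esub> a \<otimes>\<^bsub>Delta\<^esub> Rgen I0) \<otimes>\<^bsub>Delta\<^esub> (Rgen I0 \<otimes>\<^bsub>Delta\<^esub> b \<otimes>\<^bsub>Delta\<^esub> Rgen I0)"
      using ab ac K0c by (simp add: Delta.m_assoc)
    moreover have "Rgen I0 \<otimes>\<^bsub>Delta\<^esub> a \<otimes>\<^bsub>Delta\<^esub> Rgen I0 \<in> P"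
      using ab inP by (auto simp: K0_swap_def)
    moreover have "Rgen I0 \<otimes>\<^bsub>Delta\<^esub> b \<otimes>\<^bsub>Delta\<^esub> Rgen I0 \<in> P"
      using swap[OF ab(2)] inP by blast
    ultimately show ?thesis using subgroup.m_closed[OF Psub] by metis
  qed
  have "P \<lhd> Delta"
  proof (rule Delta.normal_invI[OF Psub])
    fix x p assume x: "x \<in> carrier Delta" and p: "p \<in> P"
    show "x \<otimes>\<^bsub>Delta\<^esub> p \<otimes>\<^bsub>Delta\<^esub> inv\<^bsub>Delta\<^esub> x \<in> P"
    proof (cases "odd0 x")
      case True
      have "x \<otimes>\<^bsub>Delta\<^esub> p \<otimes>\<^bsub>Delta\<^esub> inv\<^bsub>Delta\<^esub> x
          = (x \<otimes>\<^bsub>Delta\<^esub> Rgen I0) \<otimes>\<^bsub>Delta\<^esub> (Rgen I0 \<otimes>\<^bsub>Delta\<^esub> p \<otimes>\<^bsub>Delta\<^esub> Rgen I0) \<otimes>\<^bsub>Delta\<^esub> inv\<^bsub>Delta\<^esub> (x \<otimes>\<^bsub>Delta\<^esub> Rgen I0)"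
        using x Pc[OF p] by (simp add: Delta.inv_mult_group Delta.m_assoc)
      then show ?thesis using P_conj0[OF R0_shift[OF x True] P_R0[OF p]] by simp
    next
      case False
      then show ?thesis using P_conj0[of x p] x p by (simp add: Delta0_eq)
    qed
  qed
  then have "M \<subseteq> P"
    unfolding closure_K0[symmetric] using inP(1) by (rule normal_closure_least)
  moreover have "P \<subseteq> M"
    using K0_M K_conj_M[of "Rgen I0"] subgroup.m_closed[OF M_subgroup] by (auto simp: P K_conj_R0)
  ultimately have PM: "P = M" by blast
  have "Delta\<lparr>carrier := K0\<rparr> Mod (K0_swap \<inter> K0) \<cong> Delta\<lparr>carrier := M\<rparr> Mod K0_swap"
    using S.normal_intersection_quotient_isom unfolding P_def[symmetric] PM is_iso_def by auto
  from iso_same_card[OF this] have "card (rcosets\<^bsub>Delta\<lparr>carrier := K0\<rparr>\<^esub> core) = iota"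
    using card_rcosets_iota[of "Rgen I0"] by (simp add: FactGroup_def K_conj_R0 core_def Int_commute)
  then show idx: "index core = 2 * index N * iota"
    using Delta.card_rcosets_tower[OF normal_imp_subgroup[OF core_normal] K0_subgroup]
    by (simp add: core_def index_K0)
  have "index N > 0" "iota > 0"
  proof -
    show "index N > 0" using t by (auto simp: spherical_type_def intro: gr0I)
    then show "iota > 0" using index_iota by (auto intro: gr0I)
  qed
  then show "finite (rcosets\<^bsub>Delta\<^esub> core)"
    using idx by (metis card.infinite mult_is_0 neq0_conv numeral_neq_zero)
qed

text \<open>\<open>R\<^sub>1 R\<^sub>2\<close> has different orders modulo \<open>K0\<close> and \<open>K0_swap\<close>, whence the least common multiple; the other
  two rotations are inverted by \<open>R\<^sub>0\<close>, so their orders agree.\<close>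

definition core_type :: "idx \<Rightarrow> nat" where
  "core_type = ty (lcm (t I0) e0) (2 * e1) (2 * t I2)"

lemma core_has_type: "has_type core core_type"
proof (rule has_typeI[OF normal_imp_subgroup[OF core_normal]])
  show "order_mod core (rot I1 I2) (core_type I0)"
    by (simp add: order_mod_def core_def K0_rot12 K0_swap_rot12 core_type_def)
  have sw: "subgroup K0_swap Delta" using K_conj_subgroup[of "Rgen I0"] by (simp add: K_conj_R0)
  show "order_mod core (rot I2 I0) (core_type I1)"
    using rot_pow_swap[OF sw, of I2 I0] K0_swap_rot0[of I2] rot_pow_swap[OF K0_subgroup, of I2 I0]
    by (auto simp: order_mod_def core_def K0_rot20 core_type_def)
  show "order_mod core (rot I0 I1) (core_type I2)"
    by (simp add: order_mod_def core_def K0_rot01 K0_swap_rot0 core_type_def)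
qed

lemma core_hypermap:
  "hypermap (coset_hypermap core)" "uniform (coset_hypermap core) (lcm (t I0) e0) (2 * e1) (2 * t I2)"
  "(of_int (euler_char (coset_hypermap core)) :: rat) =
    of_nat (index N * iota) * (1 / of_nat (lcm (t I0) e0) + 1 / of_nat (2 * e1) + 1 / of_nat (2 * t I2) - 1)"
proof -
  have pos: "core_type k > 0" for k
    using t_pos[of I0] t_pos[of I2] e_pos by (cases k) (simp_all add: core_type_def lcm_pos_nat)
  have "core \<subseteq> Delta_plus" using K0_Delta_plus by (auto simp: core_def)
  note r = regular_hypermap[OF core_normal this index_core(1) core_has_type pos]
  show "hypermap (coset_hypermap core)" "uniform (coset_hypermap core) (lcm (t I0) e0) (2 * e1) (2 * t I2)"
    using r(1,2) by (simp_all add: core_type_def)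
  show "(of_int (euler_char (coset_hypermap core)) :: rat) =
    of_nat (index N * iota) * (1 / of_nat (lcm (t I0) e0) + 1 / of_nat (2 * e1) + 1 / of_nat (2 * t I2) - 1)"
    unfolding r(3) UNIV_idx by (simp add: core_type_def index_core(2) add.assoc)
qed

text \<open>The irregularity index enters through the equation \<open>index M * i = 2 * index N\<close>, so that the
  numerical entries of a row can be verified by arithmetic alone.\<close>

theorem lifted_table_row:
  assumes \<L>: "hypermap_iso (coset_hypermap M) \<L>"
    and ty: "(l, m, n) = (lcm (t I0) e0, 2 * e1, 2 * t I2)"
    and size: "s = 2 * index N * i" "index M * i = 2 * index N"
    and genus: "2 - 2 * \<gamma> = of_nat (index N * i) * (1 / of_nat l + 1 / of_nat m + 1 / of_nat n - 1)"
    and \<Upsilon>: "Delta\<lparr>carrier := Theta M\<rparr> Mod N \<cong> \<Upsilon>"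
  shows "table_row (coset_hypermap K0) \<L> (l, m, n) s \<gamma> i \<Upsilon>"
proof -
  have "index M > 0"
    using finite_M Delta.rcosetsI[OF subgroup.subset[OF M_subgroup] Delta.one_closed]
    by (auto simp: card_gt_0_iff)
  then have i: "i = iota" using index_iota size(2) by simp
  obtain g where g: "g \<in> carrier Delta" and K: "hsub (coset_hypermap K0) = K_conj g"
    unfolding K_conj_def by (rule hsub_coset[OF K0_subgroup])
  let ?K = "coset_hypermap K0"
  have Kg: "subgroup (K_conj g) Delta" by (rule K_conj_subgroup[OF g])
  have closure: "closure_cover ?K = coset_hypermap M"
    by (simp add: closure_cover_def K closure_K_conj[OF g])
  have cc: "covering_core ?K = coset_hypermap core"
    by (simp add: covering_core_def K normal_core_K_conj[OF g])
  have irr: "irregularity_group ?K = Delta\<lparr>carrier := M\<rparr> Mod K_conj g"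
    by (simp add: irregularity_group_def K closure_K_conj[OF g])
  have "K_conj g \<lhd> Delta0_group"
    using K_conj_cases[OF g] K0_normal K0_swap_normal by simp
  then have bip: "bipartite_regular ?K"
    using K_conj_M[OF g] M_Delta0 by (auto simp: bipartite_regular_def bipartite_def K)
  have ori: "orientable (covering_core ?K)"
  proof -
    have "core \<subseteq> generate Delta {rot I1 I2, rot I2 I0}"
      using K0_Delta_plus Delta_plus_generated by (auto simp: core_def)
    then show ?thesis
      by (simp add: orientable_def cc hsub_coset_normal[OF core_normal])
  qed
  have gen: "genus (covering_core ?K) = \<gamma>"
    using core_hypermap(3) genus ty by (simp add: genus_def cc i)
  have index: "irregularity_index ?K = i"
    using card_rcosets_iota[OF g] i by (simp add: irregularity_index_def irr order_def FactGroup_def)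
  note iota1 = iota_1[OF g]
  have reg: "i = 1 \<longleftrightarrow> regular ?K"
  proof
    assume "i = 1"
    then show "regular ?K" using iota1 i M by (simp add: regular_def K)
  next
    assume "regular ?K"
    then have "normal_closure Delta (K_conj g) \<subseteq> K_conj g"
      by (intro normal_closure_least) (auto simp: regular_def K)
    then show "i = 1" using iota1 i closure_K_conj[OF g] K_conj_M[OF g] by blast
  qed
  have isos: "hypermap_iso (covering_core ?K) (closure_cover ?K) \<and> hypermap_iso (closure_cover ?K) ?K" if "i = 1"
  proof -
    have KM: "K_conj g = M" using iota1 i that by simp
    have "normal_core Delta M = M"
    proof -
      have "core \<subseteq> M" using K0_M by (auto simp: core_def)
      moreover have "K_conj g = K0 \<or> K_conj g = K0_swap" using K_conj_cases[OF g] by simp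
      moreover have "w \<in> core" if w: "w \<in> M" for w
      proof -
        have wc: "w \<in> carrier Delta" by (rule subgroup.mem_carrier[OF M_subgroup w])
        have "K0 = M" "K0_swap = M"
          using iota_1[of "\<one>\<^bsub>Delta\<^esub>"] iota_1[of "Rgen I0"] \<open>i = 1\<close> i
          by (simp_all add: K_conj_one K_conj_R0)
        then show ?thesis using w by (simp add: core_def)
      qed
      ultimately show ?thesis using normal_core_K_conj[OF g] KM by auto
    qed
    then have "covering_core ?K = closure_cover ?K"
      by (simp add: covering_core_def closure K KM)
    moreover have "hypermap_iso (closure_cover ?K) ?K"
      using hypermap_iso_coset[OF K0_hypermap] by (simp add: closure K KM)
    ultimately show ?thesis using hypermap_iso_refl by simp
  qed
  have "irregularity_group ?K \<cong> \<Upsilon>"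
    unfolding irr using irregularity_iso[OF g] \<Upsilon> by (rule iso_trans)
  then show ?thesis
    unfolding table_row_def
    using K0_hypermap K0_spherical bip \<L> core_hypermap(1,2) index_core(2) ori gen index reg isos ty size(1) i
    by (simp add: closure cc)
qed

end

subsection \<open>The closure covers of \<open>Pin\<close> and \<open>Wal\<close>\<close>

lemma order_mod_dvd: "order_mod N x d \<Longrightarrow> x [^]\<^bsub>Delta\<^esub> (e::nat) \<in> N \<longleftrightarrow> d dvd e"
  by (simp add: order_mod_def)

lemma normal_pow_iff:
  assumes "N \<lhd> Delta" "w \<in> carrier Delta"
  shows "w [^]\<^bsub>Delta\<^esub> (e::nat) \<in> N \<longleftrightarrow> group.ord (Delta Mod N) (N #>\<^bsub>Delta\<^esub> w) dvd e"
proof -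
  interpret q: group_hom Delta "Delta Mod N" "\<lambda>w. N #>\<^bsub>Delta\<^esub> w" by (rule Mod_hom[OF assms(1)])
  show ?thesis
    using normal_mem_iff[OF assms(1), of "w [^]\<^bsub>Delta\<^esub> e"] q.hom_nat_pow[OF assms(2), of e]
      q.H.pow_eq_id[OF q.hom_closed[OF assms(2)], of e] assms(2) by simp
qed

lemma normal_pow_gcd:
  assumes "N \<lhd> Delta" "w \<in> carrier Delta"
    and "w [^]\<^bsub>Delta\<^esub> (a::nat) \<in> N" "w [^]\<^bsub>Delta\<^esub> (b::nat) \<in> N"
  shows "w [^]\<^bsub>Delta\<^esub> gcd a b \<in> N"
  using assms by (simp add: normal_pow_iff)

lemma normal_pow_dvd:
  assumes "N \<lhd> Delta" "w \<in> carrier Delta" "w [^]\<^bsub>Delta\<^esub> (a::nat) \<in> N" "a dvd b"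
  shows "w [^]\<^bsub>Delta\<^esub> (b::nat) \<in> N"
  using assms by (auto simp: normal_pow_iff intro: dvd_trans)

lemma normal_pow_cong:
  assumes N: "N \<lhd> Delta" and uv: "u \<in> carrier Delta" "v \<in> carrier Delta" "u \<otimes>\<^bsub>Delta\<^esub> inv\<^bsub>Delta\<^esub> v \<in> N"
  shows "u [^]\<^bsub>Delta\<^esub> (e::nat) \<in> N \<longleftrightarrow> v [^]\<^bsub>Delta\<^esub> e \<in> N"
  using Delta.rcoset_eq_iff[OF normal_imp_subgroup[OF N] uv(1,2)] uv by (simp add: normal_pow_iff[OF N])

lemma rot_pow_cong12:
  assumes N: "N \<lhd> Delta" and "rot I1 I2 \<in> N"
  shows "rot I2 I0 [^]\<^bsub>Delta\<^esub> (e::nat) \<in> N \<longleftrightarrow> rot I0 I1 [^]\<^bsub>Delta\<^esub> e \<in> N"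
proof -
  have "rot I2 I0 \<otimes>\<^bsub>Delta\<^esub> inv\<^bsub>Delta\<^esub> (rot I1 I0) \<in> N"
    using assms(2) subgroup.m_inv_closed[OF normal_imp_subgroup[OF N] assms(2)]
    by (simp add: Delta.inv_mult_group Delta.m_assoc)
  then show ?thesis
    using normal_pow_cong[OF N, of "rot I2 I0" "rot I1 I0" e] rot_pow_swap[OF normal_imp_subgroup[OF N]] by simp
qed

lemma tau_rot_pow:
  "tau (rot i j [^]\<^bsub>Delta\<^esub> (e::nat)) = (tau_gen i \<otimes>\<^bsub>Delta\<^esub> tau_gen j) [^]\<^bsub>Delta\<^esub> e"
proof -
  interpret group_hom Delta Delta tau by (rule tau_hom)
  show ?thesis by (simp add: hom_nat_pow tau_Rgen)
qed

lemma tau_rot01: "tau (rot I0 I1 [^]\<^bsub>Delta\<^esub> (e::nat)) = rot I0 I1 [^]\<^bsub>Delta\<^esub> (2 * e)"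
  by (simp add: tau_rot_pow even_pow tau_gen_def Delta.m_assoc)

lemma tau_rot12: "tau (rot I1 I2 [^]\<^bsub>Delta\<^esub> (e::nat)) = rot I1 I2 [^]\<^bsub>Delta\<^esub> e"
  by (simp add: tau_rot_pow tau_gen_def)

lemma tau_rot20: "tau (rot I2 I0 [^]\<^bsub>Delta\<^esub> (e::nat)) = (rot I2 I0 \<otimes>\<^bsub>Delta\<^esub> rot I1 I0) [^]\<^bsub>Delta\<^esub> e"
  by (simp add: tau_rot_pow tau_gen_def Delta.m_assoc)

context lifting
begin

abbreviation KD :: "idx list set" where "KD \<equiv> normal_closure Delta K0"

lemma KD_normal: "KD \<lhd> Delta"
  by (rule Delta.normal_closure_normal[OF subgroup.subset[OF K0_subgroup]])

lemma K0_KD: "w \<in> K0 \<Longrightarrow> w \<in> KD"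
  by (rule subsetD[OF normal_closure_subset])

lemma K0_swap_KD: "w \<in> K0_swap \<Longrightarrow> w \<in> KD"
  using normal_conj_iff[OF KD_normal, of "Rgen I0" w] K0_KD by (simp add: K0_swap_def)

lemma KD_rotations:
  "rot I1 I2 [^]\<^bsub>Delta\<^esub> gcd (t I0) e0 \<in> KD" "rot I2 I0 [^]\<^bsub>Delta\<^esub> (2 * e1) \<in> KD"
  "rot I0 I1 [^]\<^bsub>Delta\<^esub> (2 * t I2) \<in> KD"
  by (intro normal_pow_gcd[OF KD_normal] K0_KD K0_swap_KD; simp add: K0_rot12 K0_swap_rot12)
    (intro K0_KD; simp add: K0_rot20 K0_rot01)+

end

text \<open>\<open>\<phi>\<^sub>P\<close> sends the conjugates of \<open>R\<^sub>1\<close> and \<open>R\<^sub>2\<close> by \<open>R\<^sub>0\<close> both to \<open>R\<^sub>0\<close>, so \<open>R\<^sub>1\<close> and \<open>R\<^sub>2\<close> coincide modulo the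
  closure. Then so do the rotations \<open>R\<^sub>0 R\<^sub>1\<close> and \<open>R\<^sub>0 R\<^sub>2\<close>, whose orders divide \<open>2n\<close> and \<open>2m\<close>.\<close>

lemma lifting_cover_Pin:
  assumes t: "spherical_type t" and k: "k = gcd (t I1) (t I2)"
  shows "lifting_cover I0 phi_P t (Tri (ty 1 (2 * k) (2 * k)))"
proof -
  interpret lifting I0 phi_P t
    using t phi_P by unfold_locales auto
  let ?M = "Tri (ty 1 (2 * k) (2 * k))"
  have M12: "rot I1 I2 \<in> ?M"
    using relator_in_Tri[of I1 I2 I0 "ty 1 (2 * k) (2 * k)"] by simp
  have M01: "rot I0 I1 [^]\<^bsub>Delta\<^esub> (2 * k) \<in> ?M"
    using relator_in_Tri[of I0 I1 I2 "ty 1 (2 * k) (2 * k)"] by simp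
  show ?thesis
  proof (intro lifting_cover.intro lifting_axioms lifting_cover_axioms.intro)
    show "?M \<lhd> Delta" by (rule Tri_normal)
    have KD12: "rot I1 I2 \<in> KD" using KD_rotations(1) by (simp add: e0_def)
    have "rot I0 I1 [^]\<^bsub>Delta\<^esub> gcd (2 * t I1) (2 * t I2) \<in> KD"
      using KD_rotations(2,3) rot_pow_cong12[OF KD_normal KD12]
      by (intro normal_pow_gcd[OF KD_normal]) (simp_all add: e1_def)
    moreover have "gcd (2 * t I1) (2 * t I2) = 2 * k" by (simp add: k gcd_mult_distrib_nat)
    ultimately have KD01: "rot I0 I1 [^]\<^bsub>Delta\<^esub> (2 * k) \<in> KD" by simp
    show "?M \<subseteq> KD"
      by (rule Tri_least[OF KD_normal])
        (use KD12 KD01 rot_pow_cong12[OF KD_normal KD12, of "2 * k"] in simp_all)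
    have dv: "2 * k dvd 2 * t I1" "2 * k dvd 2 * t I2" by (simp_all add: k)
    have "Tri t \<subseteq> Theta ?M"
    proof (rule Tri_least[OF Theta_normal[OF Tri_normal]])
      show "rot I1 I2 [^]\<^bsub>Delta\<^esub> t I0 \<in> Theta ?M"
        using normal_pow_dvd[OF Tri_normal, of "rot I1 I2" 1] M12 by (simp add: Theta_def tau_rot12)
      have "rot I2 I0 \<otimes>\<^bsub>Delta\<^esub> rot I1 I0 \<otimes>\<^bsub>Delta\<^esub> inv\<^bsub>Delta\<^esub> (rot I1 I0 \<otimes>\<^bsub>Delta\<^esub> rot I1 I0) = rot I2 I1"
        by (simp add: Delta.inv_mult_group Delta.m_assoc)
      moreover have "rot I2 I1 \<in> ?M" using M12 subgroup.m_inv_closed[OF Tri_subgroup M12] inv_rot by simp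
      ultimately have "(rot I2 I0 \<otimes>\<^bsub>Delta\<^esub> rot I1 I0) [^]\<^bsub>Delta\<^esub> t I1 \<in> ?M
          \<longleftrightarrow> (rot I1 I0 \<otimes>\<^bsub>Delta\<^esub> rot I1 I0) [^]\<^bsub>Delta\<^esub> t I1 \<in> ?M"
        by (intro normal_pow_cong[OF Tri_normal]) simp_all
      also have "\<dots> \<longleftrightarrow> rot I0 I1 [^]\<^bsub>Delta\<^esub> (2 * t I1) \<in> ?M"
        by (simp add: even_pow[symmetric] rot_pow_swap[OF Tri_subgroup])
      also have "\<dots>" using normal_pow_dvd[OF Tri_normal _ M01 dv(1)] by simp
      finally show "rot I2 I0 [^]\<^bsub>Delta\<^esub> t I1 \<in> Theta ?M" by (simp add: Theta_def tau_rot20)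
      show "rot I0 I1 [^]\<^bsub>Delta\<^esub> t I2 \<in> Theta ?M"
        using normal_pow_dvd[OF Tri_normal _ M01 dv(2)] by (simp add: Theta_def tau_rot01)
    qed
    then show "tau w \<in> ?M" if "w \<in> Tri t" for w using that by (auto simp: Theta_def)
    have "Rgen I0 \<otimes>\<^bsub>Delta\<^esub> Rgen I2 \<otimes>\<^bsub>Delta\<^esub> Rgen I0 \<otimes>\<^bsub>Delta\<^esub> inv\<^bsub>Delta\<^esub> (tau (Rgen I0))
        = Rgen I0 \<otimes>\<^bsub>Delta\<^esub> inv\<^bsub>Delta\<^esub> (rot I1 I2) \<otimes>\<^bsub>Delta\<^esub> inv\<^bsub>Delta\<^esub> (Rgen I0)"
      by (simp add: tau_Rgen tau_gen_def Delta.inv_mult_group Delta.m_assoc)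
    then show "Rgen I0 \<otimes>\<^bsub>Delta\<^esub> Rgen I2 \<otimes>\<^bsub>Delta\<^esub> Rgen I0 \<otimes>\<^bsub>Delta\<^esub> inv\<^bsub>Delta\<^esub> (tau (Rgen I0)) \<in> ?M"
      using Delta.normal_invE(2)[OF Tri_normal Rgen_closed subgroup.m_inv_closed[OF Tri_subgroup M12]] by simp
  qed
qed

text \<open>\<open>R\<^sub>1 R\<^sub>2\<close> has order \<open>l\<close> modulo \<open>K0\<close> and \<open>m\<close> modulo \<open>K0_swap\<close>, hence order dividing \<open>g\<close> modulo the
  closure. If \<open>g = 1\<close>, then \<open>R\<^sub>1\<close> and \<open>R\<^sub>2\<close> coincide there, and \<open>R\<^sub>0 R\<^sub>1\<close> has order two like \<open>R\<^sub>0 R\<^sub>2\<close>.\<close>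

lemma lifting_cover_Wal:
  assumes t: "spherical_type t" and g: "g = gcd (t I0) (t I1)" and p: "p = 2 * t I2 \<or> g = 1 \<and> p = 2"
  shows "lifting_cover I2 phi_W t (Tri (ty g 2 p))"
proof -
  interpret lifting I2 phi_W t
    using t phi_W by unfold_locales auto
  let ?M = "Tri (ty g 2 p)"
  have M12: "rot I1 I2 [^]\<^bsub>Delta\<^esub> g \<in> ?M"
    using relator_in_Tri[of I1 I2 I0 "ty g 2 p"] by simp
  have M20: "rot I2 I0 [^]\<^bsub>Delta\<^esub> (2::nat) \<in> ?M"
    using relator_in_Tri[of I2 I0 I1 "ty g 2 p"] by simp
  have M01: "rot I0 I1 [^]\<^bsub>Delta\<^esub> p \<in> ?M"
    using relator_in_Tri[of I0 I1 I2 "ty g 2 p"] by simp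
  show ?thesis
  proof (intro lifting_cover.intro lifting_axioms lifting_cover_axioms.intro)
    show "?M \<lhd> Delta" by (rule Tri_normal)
    have KD12: "rot I1 I2 [^]\<^bsub>Delta\<^esub> g \<in> KD" using KD_rotations(1) by (simp add: e0_def g)
    have KD20: "rot I2 I0 [^]\<^bsub>Delta\<^esub> (2::nat) \<in> KD" using KD_rotations(2) by (simp add: e1_def)
    have KD01: "rot I0 I1 [^]\<^bsub>Delta\<^esub> p \<in> KD"
      using p
    proof
      assume "g = 1 \<and> p = 2"
      then show ?thesis using rot_pow_cong12[OF KD_normal, of 2] KD12 KD20 by simp
    qed (use KD_rotations(3) in simp)
    show "?M \<subseteq> KD"
      by (rule Tri_least[OF KD_normal]) (use KD12 KD20 KD01 in simp_all)
    have dv: "g dvd t I0" "g dvd t I1" "p dvd 2 * t I2" using p by (auto simp: g)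
    have "Tri t \<subseteq> Theta ?M"
    proof (rule Tri_least[OF Theta_normal[OF Tri_normal]])
      show "rot I1 I2 [^]\<^bsub>Delta\<^esub> t I0 \<in> Theta ?M"
        using normal_pow_dvd[OF Tri_normal _ M12 dv(1)] by (simp add: Theta_def tau_rot12)
      let ?c = "Rgen I0 \<otimes>\<^bsub>Delta\<^esub> rot I2 I1 \<otimes>\<^bsub>Delta\<^esub> inv\<^bsub>Delta\<^esub> (Rgen I0)"
      have "rot I2 I0 \<otimes>\<^bsub>Delta\<^esub> rot I1 I0 \<otimes>\<^bsub>Delta\<^esub> inv\<^bsub>Delta\<^esub> ?c = rot I2 I0 [^]\<^bsub>Delta\<^esub> (2::nat)"
        by (simp add: Delta.inv_mult_group Delta.m_assoc numeral_2_eq_2)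
      then have "(rot I2 I0 \<otimes>\<^bsub>Delta\<^esub> rot I1 I0) [^]\<^bsub>Delta\<^esub> t I1 \<in> ?M \<longleftrightarrow> ?c [^]\<^bsub>Delta\<^esub> t I1 \<in> ?M"
        using M20 by (intro normal_pow_cong[OF Tri_normal]) simp_all
      also have "\<dots> \<longleftrightarrow> rot I2 I1 [^]\<^bsub>Delta\<^esub> t I1 \<in> ?M"
        unfolding conj_pow[OF Rgen_closed rot_closed, symmetric]
        by (rule normal_conj_iff[OF Tri_normal Rgen_closed]) simp
      also have "\<dots>"
        using normal_pow_dvd[OF Tri_normal _ M12 dv(2)] rot_pow_swap[OF Tri_subgroup, of I2 I1] by simp
      finally show "rot I2 I0 [^]\<^bsub>Delta\<^esub> t I1 \<in> Theta ?M" by (simp add: Theta_def tau_rot20)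
      show "rot I0 I1 [^]\<^bsub>Delta\<^esub> t I2 \<in> Theta ?M"
        using normal_pow_dvd[OF Tri_normal _ M01 dv(3)] by (simp add: Theta_def tau_rot01)
    qed
    then show "tau w \<in> ?M" if "w \<in> Tri t" for w using that by (auto simp: Theta_def)
    have "Rgen I0 \<otimes>\<^bsub>Delta\<^esub> Rgen I2 \<otimes>\<^bsub>Delta\<^esub> Rgen I0 \<otimes>\<^bsub>Delta\<^esub> inv\<^bsub>Delta\<^esub> (tau (Rgen I2)) = rot I0 I2 [^]\<^bsub>Delta\<^esub> (2::nat)"
      by (simp add: tau_Rgen tau_gen_def Delta.m_assoc numeral_2_eq_2)
    then show "Rgen I0 \<otimes>\<^bsub>Delta\<^esub> Rgen I2 \<otimes>\<^bsub>Delta\<^esub> Rgen I0 \<otimes>\<^bsub>Delta\<^esub> inv\<^bsub>Delta\<^esub> (tau (Rgen I2)) \<in> ?M"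
      using M20 rot_pow_swap[OF Tri_subgroup, of I2 I0] by simp
  qed
qed

subsection \<open>Recognising the irregularity group\<close>

text \<open>The irregularity group in the form given by \<open>irregularity_iso\<close>.\<close>

definition Ups :: "(idx \<Rightarrow> nat) \<Rightarrow> idx list set \<Rightarrow> idx list set monoid" where
  "Ups t M = Delta\<lparr>carrier := Theta M\<rparr> Mod Tri t"

context
  fixes t M
  assumes M: "M \<lhd> Delta" and sub: "Tri t \<subseteq> Theta M"
begin

lemma Theta_sub: "subgroup (Theta M) Delta"
  by (rule normal_imp_subgroup[OF Theta_normal[OF M]])

lemma Tri_normal_Theta: "Tri t \<lhd> Delta\<lparr>carrier := Theta M\<rparr>"
  by (rule Delta.normal_restrict_supergroup[OF Theta_sub Tri_normal sub])

lemma group_Ups: "group (Ups t M)"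
  unfolding Ups_def by (rule normal.factorgroup_is_group[OF Tri_normal_Theta])

definition cls :: "idx list \<Rightarrow> idx list set" where
  "cls w = Tri t #>\<^bsub>Delta\<^esub> w"

lemma cls_hom: "group_hom (Delta\<lparr>carrier := Theta M\<rparr>) (Ups t M) cls"
proof -
  have "(\<lambda>w. Tri t #>\<^bsub>Delta\<lparr>carrier := Theta M\<rparr>\<^esub> w) = cls"
    by (simp add: fun_eq_iff cls_def r_coset_def)
  then show ?thesis
    using normal.r_coset_hom_Mod[OF Tri_normal_Theta] group_Ups Delta.subgroup_imp_group[OF Theta_sub]
    by (simp add: group_hom_def group_hom_axioms_def Ups_def)
qed

lemma cls_closed: "w \<in> Theta M \<Longrightarrow> cls w \<in> carrier (Ups t M)"
  using group_hom.hom_closed[OF cls_hom] by simp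

lemma cls_mult: "u \<in> Theta M \<Longrightarrow> v \<in> Theta M \<Longrightarrow> cls u \<otimes>\<^bsub>Ups t M\<^esub> cls v = cls (u \<otimes>\<^bsub>Delta\<^esub> v)"
  using group_hom.hom_mult[OF cls_hom] by simp

lemma Theta_closed: "w \<in> Theta M \<Longrightarrow> w \<in> carrier Delta"
  by (simp add: Theta_def)

lemma cls_eq: "u \<in> Theta M \<Longrightarrow> v \<in> Theta M \<Longrightarrow> cls u = cls v \<longleftrightarrow> u \<otimes>\<^bsub>Delta\<^esub> inv\<^bsub>Delta\<^esub> v \<in> Tri t"
  using Delta.rcoset_eq_iff[OF Tri_subgroup] Theta_closed by (simp add: cls_def)

lemma cls_one: "w \<in> Theta M \<Longrightarrow> cls w = \<one>\<^bsub>Ups t M\<^esub> \<longleftrightarrow> w \<in> Tri t"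
  using normal_mem_iff[OF Tri_normal Theta_closed, of w t] by (simp add: cls_def Ups_def FactGroup_def)

lemma Theta_pow: "w \<in> Theta M \<Longrightarrow> w [^]\<^bsub>Delta\<^esub> (e::nat) \<in> Theta M"
  by (induction e) (auto intro: subgroup.one_closed[OF Theta_sub] subgroup.m_closed[OF Theta_sub])

lemma cls_pow: "w \<in> Theta M \<Longrightarrow> cls w [^]\<^bsub>Ups t M\<^esub> (e::nat) = cls (w [^]\<^bsub>Delta\<^esub> e)"
proof (induction e)
  case 0
  then show ?case
    using cls_one[of "\<one>\<^bsub>Delta\<^esub>"] subgroup.one_closed[OF Theta_sub] subgroup.one_closed[OF Tri_subgroup]
    by (simp add: nat_pow_def)
next
  case (Suc e)
  then show ?case
    using cls_mult[OF Theta_pow[OF Suc.prems] Suc.prems, of e] by (simp add: nat_pow_def)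
qed

lemma cls_ord:
  assumes "w \<in> Theta M" "order_mod (Tri t) w d"
  shows "group.ord (Ups t M) (cls w) = d"
  using group.ord_unique[OF group_Ups cls_closed[OF assms(1)]] cls_pow[OF assms(1)]
    cls_one[OF Theta_pow[OF assms(1)]] assms(2) by (simp add: order_mod_def)

lemma Ups_cyclic:
  assumes "u \<in> Theta M" "order_mod (Tri t) u k" "order (Ups t M) = k" "k > 0"
  shows "Ups t M \<cong> cyclic k"
  using group.iso_cyclic[OF group_Ups cls_closed[OF assms(1)] cls_ord[OF assms(1,2)] assms(3,4)] .

text \<open>The sign character keeps the reflection \<open>v\<close> apart from all powers of \<open>u\<close>.\<close>

lemma Ups_dihedral:
  assumes u: "u \<in> Theta M" "order_mod (Tri t) u k" and v: "v \<in> Theta M" "v \<otimes>\<^bsub>Delta\<^esub> v \<in> Tri t"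
    and vu: "v \<otimes>\<^bsub>Delta\<^esub> u \<otimes>\<^bsub>Delta\<^esub> v \<otimes>\<^bsub>Delta\<^esub> u \<in> Tri t"
    and s: "Tri t \<subseteq> kernel Delta (cyclic 2) (sign_hom P)" "sign_hom P u = 0" "sign_hom P v = 1"
    and ord: "order (Ups t M) = 2 * k" "k > 0"
  shows "Ups t M \<cong> dihedral k"
proof (rule group.iso_dihedral[OF group_Ups cls_closed[OF u(1)] cls_ord[OF u] cls_closed[OF v(1)] _ _ _ ord])
  interpret U: group "Ups t M" by (rule group_Ups)
  have cl: "v \<otimes>\<^bsub>Delta\<^esub> u \<in> Theta M" "v \<otimes>\<^bsub>Delta\<^esub> u \<otimes>\<^bsub>Delta\<^esub> v \<in> Theta M" "v \<otimes>\<^bsub>Delta\<^esub> v \<in> Theta M"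
    "v \<otimes>\<^bsub>Delta\<^esub> u \<otimes>\<^bsub>Delta\<^esub> v \<otimes>\<^bsub>Delta\<^esub> u \<in> Theta M"
    using u v subgroup.m_closed[OF Theta_sub] by auto
  show "cls v \<otimes>\<^bsub>Ups t M\<^esub> cls v = \<one>\<^bsub>Ups t M\<^esub>"
    using cls_mult v cls_one[OF cl(3)] by simp
  have "cls v \<otimes>\<^bsub>Ups t M\<^esub> cls u \<otimes>\<^bsub>Ups t M\<^esub> cls v \<otimes>\<^bsub>Ups t M\<^esub> cls u = \<one>\<^bsub>Ups t M\<^esub>"
    using cls_mult u v cl cls_one[OF cl(4)] vu by simp
  then show "cls v \<otimes>\<^bsub>Ups t M\<^esub> cls u \<otimes>\<^bsub>Ups t M\<^esub> cls v = inv\<^bsub>Ups t M\<^esub> (cls u)"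
    using U.inv_equality[of "cls v \<otimes>\<^bsub>Ups t M\<^esub> cls u \<otimes>\<^bsub>Ups t M\<^esub> cls v" "cls u"] cls_closed u v by simp
  fix i :: int
  have "cls u [^]\<^bsub>Ups t M\<^esub> i = cls u [^]\<^bsub>Ups t M\<^esub> nat (i mod int k)"
  proof -
    have "int k dvd i - i mod int k" by (simp add: minus_mod_eq_mult_div)
    then have "cls u [^]\<^bsub>Ups t M\<^esub> (i mod int k) = cls u [^]\<^bsub>Ups t M\<^esub> i"
      using U.int_pow_eq[OF cls_closed[OF u(1)]] cls_ord[OF u] by simp
    moreover have "int (nat (i mod int k)) = i mod int k" using ord(2) by simp
    ultimately show ?thesis by (metis int_pow_int)
  qed
  also have "\<dots> = cls (u [^]\<^bsub>Delta\<^esub> nat (i mod int k))" by (rule cls_pow[OF u(1)])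
  also have "\<dots> \<noteq> cls v"
  proof
    let ?p = "u [^]\<^bsub>Delta\<^esub> nat (i mod int k)"
    interpret s: group_hom Delta "cyclic 2" "sign_hom P" by (rule sign_hom(1))
    have "sign_hom P ?p = 0"
      using s.hom_nat_pow[OF Theta_closed[OF u(1)]] s(2) by simp
    assume "cls ?p = cls v"
    then have "?p \<otimes>\<^bsub>Delta\<^esub> inv\<^bsub>Delta\<^esub> v \<in> Tri t" using cls_eq[OF Theta_pow[OF u(1)] v(1)] by simp
    then have "sign_hom P ?p = sign_hom P v"
      by (intro kernel_eq[OF sign_hom(1) s(1)]) (use u v Theta_closed in simp_all)
    then show False using \<open>sign_hom P ?p = 0\<close> s(3) by simp
  qed
  finally show "cls v \<noteq> cls u [^]\<^bsub>Ups t M\<^esub> i" by simp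
qed

lemma Ups_V4:
  assumes u: "u \<in> Theta M" "u \<otimes>\<^bsub>Delta\<^esub> u \<in> Tri t" "u \<notin> Tri t"
    and v: "v \<in> Theta M" "v \<otimes>\<^bsub>Delta\<^esub> v \<in> Tri t" "v \<notin> Tri t"
    and uv: "u \<otimes>\<^bsub>Delta\<^esub> inv\<^bsub>Delta\<^esub> v \<notin> Tri t" and ord: "order (Ups t M) = 4"
  shows "Ups t M \<cong> V4"
proof (rule group.iso_V4[OF group_Ups ord cls_closed[OF u(1)] cls_closed[OF v(1)]])
  have cl: "u \<otimes>\<^bsub>Delta\<^esub> u \<in> Theta M" "v \<otimes>\<^bsub>Delta\<^esub> v \<in> Theta M"
    using u v subgroup.m_closed[OF Theta_sub] by auto
  show "cls u \<otimes>\<^bsub>Ups t M\<^esub> cls u = \<one>\<^bsub>Ups t M\<^esub>" "cls v \<otimes>\<^bsub>Ups t M\<^esub> cls v = \<one>\<^bsub>Ups t M\<^esub>"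
    using cls_mult u v cls_one cl by simp_all
  show "cls u \<noteq> \<one>\<^bsub>Ups t M\<^esub>" "cls v \<noteq> \<one>\<^bsub>Ups t M\<^esub>" "cls u \<noteq> cls v"
    using cls_one u v cls_eq uv by simp_all
qed

text \<open>Modulo its kernel in \<open>Theta M\<close>, the homomorphism gives a group with as many elements as \<open>Ups t M\<close>; so
  the kernel cannot be larger than \<open>Tri t\<close>.\<close>

lemma Ups_image:
  assumes h: "group_hom Delta S h" and ker: "Tri t \<subseteq> kernel Delta S h"
    and T: "subgroup T S" "T \<subseteq> h ` Theta M" and ord: "order (Ups t M) = card T" "finite T"
  shows "Ups t M \<cong> S\<lparr>carrier := T\<rparr>"
proof -
  let ?Th = "Delta\<lparr>carrier := Theta M\<rparr>"
  interpret Th: group ?Th by (rule Delta.subgroup_imp_group[OF Theta_sub])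
  interpret h: group_hom Delta S h by (rule h)
  have Tri_Th: "subgroup (Tri t) ?Th" by (rule normal_imp_subgroup[OF Tri_normal_Theta])
  have ord': "card (rcosets\<^bsub>?Th\<^esub> (Tri t)) = card T"
    using ord(1) by (simp add: Ups_def order_def FactGroup_def)
  have "T \<noteq> {}" using subgroup.one_closed[OF T(1)] by blast
  then have fin: "finite (rcosets\<^bsub>?Th\<^esub> (Tri t))"
    using ord' ord(2) by (metis card.infinite card_0_eq)
  have const: "h u = h v" if "u \<in> carrier ?Th" "v \<in> carrier ?Th" "u \<otimes>\<^bsub>?Th\<^esub> inv\<^bsub>?Th\<^esub> v \<in> Tri t" for u v
    using kernel_eq[OF h ker, of u v] that Theta_closed Delta.m_inv_consistent[OF Theta_sub, of v] by simp
  have "finite (h ` carrier ?Th)" "card (h ` carrier ?Th) \<le> card T"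
    using Th.card_rcosets_ge_image[OF Tri_Th fin, of h] const ord' by metis+
  then have im: "h ` Theta M = T"
    using T(2) by (intro card_seteq[symmetric]) simp_all
  have hT: "group_hom ?Th (S\<lparr>carrier := T\<rparr>) h"
    using im Th.group_axioms h.H.subgroup_imp_group[OF T(1)] Theta_closed
    by (auto simp: group_hom_def group_hom_axioms_def hom_def)
  let ?K = "kernel ?Th (S\<lparr>carrier := T\<rparr>) h"
  have iso: "?Th Mod ?K \<cong> S\<lparr>carrier := T\<rparr>"
    by (rule group_hom.FactGroup_iso[OF hT]) (simp add: im)
  then have "card (rcosets\<^bsub>?Th\<^esub> ?K) = card T"
    using iso_same_card by (fastforce simp: FactGroup_def)
  moreover have "Tri t \<subseteq> ?K"
    using ker sub by (auto simp: kernel_def)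
  ultimately have "Tri t = ?K"
    using Th.subgroup_eq_of_index_le[OF Tri_Th group_hom.subgroup_kernel[OF hT]] fin ord' by simp
  then show ?thesis using iso by (simp add: Ups_def)
qed

end

section \<open>Rows of the table\<close>

lemma Pin_row:
  assumes H: "hsub \<H> = Tri (ty l m n)" and T: "spherical_type (ty l m n)" "index (Tri (ty l m n)) = F"
    and \<L>: "hypermap_iso (coset_hypermap (Tri (ty 1 d d))) \<L>"
    and \<Upsilon>: "Tri (ty l m n) \<subseteq> Theta (Tri (ty 1 d d)) \<Longrightarrow> order (Ups (ty l m n) (Tri (ty 1 d d))) = i \<Longrightarrow>
      Ups (ty l m n) (Tri (ty 1 d d)) \<cong> \<Upsilon>"
    and d: "d = 2 * gcd m n" and size: "d * i = F" "s = 2 * F * i" and mn: "m' = 2 * m" "n' = 2 * n"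
    and genus: "2 - 2 * \<gamma> = of_nat (F * i) * (1 / of_nat l + 1 / of_nat m' + 1 / of_nat n' - 1)"
  shows "table_row (Pin \<H>) \<L> (l, m', n') s \<gamma> i \<Upsilon>"
proof -
  let ?t = "ty l m n" and ?M = "Tri (ty 1 d d)"
  have "?t k > 0" for k using T(1) by (simp add: spherical_type_def)
  from this[of I1] have d0: "d > 0" by (simp add: d)
  interpret lifting_cover I0 phi_P ?t ?M
    unfolding d by (rule lifting_cover_Pin[OF T(1)]) simp
  have M: "index ?M = 2 * d" using dihedron_type(2)[OF d0] .
  have size': "index ?M * i = 2 * index (Tri ?t)" unfolding M T(2) using size(1) by simp
  moreover have "index ?M > 0" unfolding M using d0 by simp
  ultimately have "iota = i" using index_iota by simp
  then have "order (Ups ?t ?M) = i"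
    unfolding iota_def Ups_def .
  from \<Upsilon>[OF N_Theta this] have "Delta\<lparr>carrier := Theta ?M\<rparr> Mod Tri ?t \<cong> \<Upsilon>"
    unfolding Ups_def .
  then have "table_row (coset_hypermap K0) \<L> (l, m', n') s \<gamma> i \<Upsilon>"
    using size size' \<L> genus T(2) mn by (intro lifted_table_row) (simp_all add: e0_def e1_def)
  moreover have "Pin \<H> = coset_hypermap K0"
    by (simp add: Pin_def H K0_def)
  ultimately show ?thesis by simp
qed

lemma Wal_row:
  assumes H: "hsub \<H> = Tri (ty l m n)" and T: "spherical_type (ty l m n)" "index (Tri (ty l m n)) = F"
    and q: "index (Tri (ty g 2 p)) = q" and \<L>: "hypermap_iso (coset_hypermap (Tri (ty g 2 p))) \<L>"
    and \<Upsilon>: "Tri (ty l m n) \<subseteq> Theta (Tri (ty g 2 p)) \<Longrightarrow> order (Ups (ty l m n) (Tri (ty g 2 p))) = i \<Longrightarrow>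
      Ups (ty l m n) (Tri (ty g 2 p)) \<cong> \<Upsilon>"
    and g: "g = gcd l m" and p: "p = 2 * n \<or> g = 1 \<and> p = 2"
    and size: "q * i = 2 * F" "q > 0" "s = 2 * F * i" and ln: "l' = lcm l m" "n' = 2 * n"
    and genus: "2 - 2 * \<gamma> = of_nat (F * i) * (1 / of_nat l' + 1 / 2 + 1 / of_nat n' - 1)"
  shows "table_row (Wal \<H>) \<L> (l', 2, n') s \<gamma> i \<Upsilon>"
proof -
  let ?t = "ty l m n" and ?M = "Tri (ty g 2 p)"
  interpret lifting_cover I2 phi_W ?t ?M
    by (rule lifting_cover_Wal[OF T(1)]) (use g p in simp_all)
  have size': "index ?M * i = 2 * index (Tri ?t)" unfolding q T(2) by (rule size(1))
  then have "iota = i" using index_iota size(2) by (simp add: q)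
  then have "order (Ups ?t ?M) = i"
    unfolding iota_def Ups_def .
  from \<Upsilon>[OF N_Theta this] have "Delta\<lparr>carrier := Theta ?M\<rparr> Mod Tri ?t \<cong> \<Upsilon>"
    unfolding Ups_def .
  then have "table_row (coset_hypermap K0) \<L> (l', 2, n') s \<gamma> i \<Upsilon>"
    using size size' \<L> genus T(2) ln by (intro lifted_table_row) (simp_all add: e0_def e1_def)
  moreover have "Wal \<H> = coset_hypermap K0"
    by (simp add: Wal_def H K0_def)
  ultimately show ?thesis by simp
qed

subsection \<open>Types and subgroups of the spherical hypermaps\<close>

lemma ty_transpose:
  "ty l m n \<circ> transpose I0 I1 = ty m l n" "ty l m n \<circ> transpose I0 I2 = ty n m l"
  "ty l m n \<circ> transpose I1 I2 = ty l n m"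
  by (rule ext, case_tac x; simp add: transpose_def)+

lemma transpose_twice: "transpose a b (transpose a b i) = i"
  by simp

lemma type_swap:
  assumes "spherical_type (ty l m n)" "index (Tri (ty l m n)) = N"
  shows "spherical_type (ty m l n) \<and> index (Tri (ty m l n)) = N"
    "spherical_type (ty n m l) \<and> index (Tri (ty n m l)) = N"
    "spherical_type (ty l n m) \<and> index (Tri (ty l n m)) = N"
  using spherical_type_perm[of "transpose I0 I1", OF transpose_twice assms(1)]
    spherical_type_perm[of "transpose I0 I2", OF transpose_twice assms(1)]
    spherical_type_perm[of "transpose I1 I2", OF transpose_twice assms(1)] assms(2)
  by (simp_all add: ty_transpose)

lemma hsub_Dop:
  assumes "hsub \<H> = Tri (ty l m n)"
  shows "hsub (D01 \<H>) = Tri (ty m l n)" "hsub (D02 \<H>) = Tri (ty n m l)" "hsub (D12 \<H>) = Tri (ty l n m)"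
  using Dop_Tri(2)[of "transpose I0 I1", OF transpose_twice assms]
    Dop_Tri(2)[of "transpose I0 I2", OF transpose_twice assms]
    Dop_Tri(2)[of "transpose I1 I2", OF transpose_twice assms] by (simp_all add: ty_transpose)

lemma hsub_platonic:
  "hsub Tetrahedron = Tri (ty 3 2 3)" "hsub Cube = Tri (ty 3 2 4)" "hsub Dodecahedron = Tri (ty 3 2 5)"
  unfolding Tetrahedron_def Cube_def Dodecahedron_def
  using uniform_spherical_type(2) tetrahedron_type(1) cube_type(1) dodecahedron_type(1) by blast+

lemma DD_type: "n > 0 \<Longrightarrow> spherical_type (ty n n 1) \<and> index (Tri (ty n n 1)) = 2 * n"
  using type_swap(2)[OF dihedron_type] by blast

lemma hsub_DD: "n > 0 \<Longrightarrow> hsub (DD n) = Tri (ty n n 1)"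
  unfolding DD_def using uniform_spherical_type(2) DD_type by blast

lemma hsub_PP: "n > 0 \<Longrightarrow> hsub (PP n) = Tri (ty 2 2 n)"
  unfolding PP_def using uniform_spherical_type(2) prism_type(1) by blast

lemma D02_PP_type: "n > 0 \<Longrightarrow> spherical_type (ty n 2 2) \<and> index (Tri (ty n 2 2)) = 4 * n"
  using type_swap(2)[OF prism_type] by blast

lemma iso_D02:
  assumes "hsub \<H> = Tri (ty l m n)"
  shows "hypermap_iso (coset_hypermap (Tri (ty n m l))) (D02 \<H>)"
  using Dop_Tri(1)[of "transpose I0 I2", OF transpose_twice assms] hypermap_iso_refl by (simp add: ty_transpose)

lemma iso_D02_DD: "k > 0 \<Longrightarrow> hypermap_iso (coset_hypermap (Tri (ty 1 k k))) (D02 (DD k))"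
  by (rule iso_D02[OF hsub_DD])

lemma iso_PP: "n > 0 \<Longrightarrow> hypermap_iso (coset_hypermap (Tri (ty 2 2 n))) (PP n)"
  using hypermap_iso_coset[of "PP n"] uniform_spherical_type(1)[OF prism_type(1)] hsub_PP
  by (simp add: PP_def)

lemma iso_Cube: "hypermap_iso (coset_hypermap (Tri (ty 3 2 4))) Cube"
  using hypermap_iso_coset[of Cube] uniform_spherical_type(1)[OF cube_type(1)] hsub_platonic(2)
  by (simp add: Cube_def)

subsection \<open>Irregularity groups\<close>

lemma Ups_trivial:
  assumes "M \<lhd> Delta" "Tri t \<subseteq> Theta M" "order (Ups t M) = 1"
  shows "Ups t M \<cong> trivial_grp"
  using group.iso_trivial_grp[OF group_Ups[OF assms(1,2)] assms(3)] .

lemma rot_in_Theta: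
  "rot I1 I2 [^]\<^bsub>Delta\<^esub> (e::nat) \<in> Theta M \<longleftrightarrow> rot I1 I2 [^]\<^bsub>Delta\<^esub> e \<in> M"
  "rot I0 I1 [^]\<^bsub>Delta\<^esub> (e::nat) \<in> Theta M \<longleftrightarrow> rot I0 I1 [^]\<^bsub>Delta\<^esub> (2 * e) \<in> M"
  by (simp_all add: Theta_def tau_rot12 tau_rot01)

lemma rot12_in_Theta: "rot I1 I2 \<in> Theta (Tri (ty 1 m n))"
  using rot_in_Theta(1)[of 1] relator_in_Tri[of I1 I2 I0 "ty 1 m n"] by simp

lemma rot01_in_Theta: "n = 2 * e \<Longrightarrow> rot I0 I1 [^]\<^bsub>Delta\<^esub> e \<in> Theta (Tri (ty l m n))"
  using rot_in_Theta(2)[of e] relator_in_Tri[of I0 I1 I2 "ty l m n"] by simp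

text \<open>\<open>M\<close> contains \<open>R\<^sub>1 R\<^sub>2\<close> and \<open>(R\<^sub>0 R\<^sub>1)\<^sup>2\<close>, and \<open>tau\<close> sends \<open>R\<^sub>1 R\<^sub>2\<close> and \<open>R\<^sub>0 R\<^sub>1\<close> to these. So for this \<open>M\<close> all
  even words take part in the irregularity group.\<close>

lemma Delta_plus_Theta: "Delta_plus \<subseteq> Theta (Tri (ty 1 2 2))"
proof -
  let ?T = "Theta (Tri (ty 1 2 2))"
  have T: "subgroup ?T Delta" by (rule normal_imp_subgroup[OF Theta_normal[OF Tri_normal]])
  have 12: "rot I1 I2 \<in> ?T" by (rule rot12_in_Theta)
  have 01: "rot I0 I1 \<in> ?T" using rot01_in_Theta[of 2 1 1 2] by simp
  have "rot I2 I1 \<in> ?T" "rot I1 I0 \<in> ?T"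
    using subgroup.m_inv_closed[OF T 12] subgroup.m_inv_closed[OF T 01] by (simp_all only: inv_rot)
  from subgroup.m_closed[OF T this] have "rot I2 I0 \<in> ?T"
    by (simp add: Delta.m_assoc)
  then have "generate Delta {rot I1 I2, rot I2 I0} \<subseteq> ?T"
    using 12 by (intro Delta.generate_subgroup_incl[OF _ T]) simp
  then show ?thesis using Delta_plus_generated by blast
qed

lemma map_Delta_plus:
  assumes "\<And>i. \<sigma> (\<sigma> i) = i"
  shows "map \<sigma> ` Delta_plus = Delta_plus"
proof -
  have inj: "inj \<sigma>" using assms by (metis injI)
  have cl: "map \<sigma> w \<in> Delta_plus" if "w \<in> Delta_plus" for w
    using that group_hom.hom_closed[OF map_hom[OF inj]] by (simp add: Delta_plus_def)
  moreover have "w \<in> map \<sigma> ` Delta_plus" if "w \<in> Delta_plus" for w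
    using cl[OF that] assms by (intro image_eqI[of _ _ "map \<sigma> w"]) (simp_all add: o_def)
  ultimately show ?thesis by blast
qed

text \<open>The image of the even words under \<open>h\<close> is not changed by permuting the generators, so one
  homomorphism serves all permutations of its type.\<close>

lemma Ups_rotations:
  assumes s: "\<And>i. \<sigma> (\<sigma> i) = i" and h: "group_hom Delta S h" and ker: "Tri t \<subseteq> kernel Delta S h"
    and T: "subgroup T S" "T \<subseteq> h ` Delta_plus" "finite T"
    and sub: "Tri (t \<circ> \<sigma>) \<subseteq> Theta (Tri (ty 1 2 2))" and ord: "order (Ups (t \<circ> \<sigma>) (Tri (ty 1 2 2))) = card T"
  shows "Ups (t \<circ> \<sigma>) (Tri (ty 1 2 2)) \<cong> S\<lparr>carrier := T\<rparr>"
proof (rule Ups_image[OF Tri_normal sub, of S "\<lambda>w. h (map \<sigma> w)"])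
  have inj: "inj \<sigma>" using s by (metis injI)
  interpret m: group_hom Delta Delta "map \<sigma>" by (rule map_hom[OF inj])
  interpret h: group_hom Delta S h by (rule h)
  show "group_hom Delta S (\<lambda>w. h (map \<sigma> w))"
    by (auto simp: group_hom_def group_hom_axioms_def hom_def group_Delta map_mult[OF inj]
        m.hom_closed[simplified])
  show "Tri (t \<circ> \<sigma>) \<subseteq> kernel Delta S (\<lambda>w. h (map \<sigma> w))"
  proof
    fix w assume "w \<in> Tri (t \<circ> \<sigma>)"
    then obtain v where v: "v \<in> Tri t" "w = map \<sigma> v" using map_Tri[OF s, of t] by blast
    have vc: "v \<in> carrier Delta" by (rule subgroup.mem_carrier[OF Tri_subgroup v(1)])
    have "map \<sigma> w = v" using s by (simp add: v(2) o_def)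
    then show "w \<in> kernel Delta S (\<lambda>w. h (map \<sigma> w))"
      using ker v m.hom_closed[OF vc] by (auto simp: kernel_def)
  qed
  have "h ` Delta_plus = (\<lambda>w. h (map \<sigma> w)) ` Delta_plus"
    by (simp add: image_image[of h "map \<sigma>", symmetric] map_Delta_plus[OF s])
  then have "T \<subseteq> (\<lambda>w. h (map \<sigma> w)) ` Delta_plus" using T(2) by simp
  also have "\<dots> \<subseteq> (\<lambda>w. h (map \<sigma> w)) ` Theta (Tri (ty 1 2 2))"
    by (rule image_mono[OF Delta_plus_Theta])
  finally show "T \<subseteq> (\<lambda>w. h (map \<sigma> w)) ` Theta (Tri (ty 1 2 2))" .
qed (use T ord in auto)

lemma alt_as_sub: "(sym_group m)\<lparr>carrier := carrier (alt_group m)\<rparr> = alt_group m"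
  by (simp add: alt_group_def)

lemma finite_alt: "finite (carrier (alt_group m))" "finite (carrier (sym_group m))"
  by (rule finite_subset[OF _ finite_permutations[of "{1..m}"]]; auto simp: alt_group_carrier sym_group_carrier)+

lemma Ups_A4:
  assumes "Tri (ty 3 2 3) \<subseteq> Theta (Tri (ty 1 2 2))" "order (Ups (ty 3 2 3) (Tri (ty 1 2 2))) = 12"
  shows "Ups (ty 3 2 3) (Tri (ty 1 2 2)) \<cong> alt_group 4"
  using Ups_rotations[of "\<lambda>i. i", OF _ perm_homs(1) perm_kernels(1) alt_group_is_subgroup tet_image finite_alt(1)]
    assms by (simp add: alt_as_sub card_alt o_def)

lemma Ups_S4:
  assumes s: "\<And>i. \<sigma> (\<sigma> i) = i" and t: "t = ty 3 2 4 \<circ> \<sigma>"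
    and "Tri t \<subseteq> Theta (Tri (ty 1 2 2))" "order (Ups t (Tri (ty 1 2 2))) = 24"
  shows "Ups t (Tri (ty 1 2 2)) \<cong> sym_group 4"
  using Ups_rotations[OF s perm_homs(3) perm_kernels(2) group.subgroup_self[OF sym_group_is_group]
      equalityD2[OF cube_image] finite_alt(2)] assms by (simp add: card_alt)

lemma Ups_A5:
  assumes s: "\<And>i. \<sigma> (\<sigma> i) = i" and t: "t = ty 3 2 5 \<circ> \<sigma>"
    and "Tri t \<subseteq> Theta (Tri (ty 1 2 2))" "order (Ups t (Tri (ty 1 2 2))) = 60"
  shows "Ups t (Tri (ty 1 2 2)) \<cong> alt_group 5"
  using Ups_rotations[OF s perm_homs(5) perm_kernels(3) alt_group_is_subgroup dod_image finite_alt(1)]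
    assms by (simp add: alt_as_sub card_alt)

text \<open>Here \<open>Theta M\<close> contains \<open>R\<^sub>1 R\<^sub>2\<close> of order three, but only the square of the rotation \<open>R\<^sub>0 R\<^sub>1\<close> of order
  four; this is the index two subgroup \<open>A\<^sub>4\<close> of the rotation group.\<close>

lemma Ups_A4_cube:
  assumes sub: "Tri (ty 3 2 4) \<subseteq> Theta (Tri (ty 1 4 4))" and ord: "order (Ups (ty 3 2 4) (Tri (ty 1 4 4))) = 12"
  shows "Ups (ty 3 2 4) (Tri (ty 1 4 4)) \<cong> alt_group 4"
proof -
  let ?T = "Theta (Tri (ty 1 4 4))"
  have T: "subgroup ?T Delta" by (rule normal_imp_subgroup[OF Theta_normal[OF Tri_normal]])
  have "carrier (alt_group 4) \<subseteq> cube_hom ` ?T"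
  proof (rule A4_subset_cube)
    show "subgroup (cube_hom ` ?T) (sym_group 4)"
      by (rule group_hom.subgroup_img_is_subgroup[OF perm_homs(3) T])
    have "cube_perm I1 \<circ> cube_perm I2 = cube_hom (rot I1 I2)"
      by (simp add: perm_hom_mult perm_homs)
    then show "cube_perm I1 \<circ> cube_perm I2 \<in> cube_hom ` ?T"
      by (simp only:) (intro imageI rot12_in_Theta)
    have "(cube_perm I0 \<circ> cube_perm I1) ^^ 2 = cube_hom (rot I0 I1 [^]\<^bsub>Delta\<^esub> (2::nat))"
      using group_hom.hom_nat_pow[OF perm_homs(3), of "rot I0 I1" 2]
      by (simp add: perm_hom_mult perm_homs sym_pow)
    then show "(cube_perm I0 \<circ> cube_perm I1) ^^ 2 \<in> cube_hom ` ?T"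
      by (simp only:) (intro imageI rot01_in_Theta, simp)
  qed
  then show ?thesis
    using Ups_image[OF Tri_normal sub perm_homs(3) perm_kernels(2) alt_group_is_subgroup _ _ finite_alt(1)] ord
    by (simp add: alt_as_sub card_alt)
qed

lemma type_order_mod:
  "spherical_type t \<Longrightarrow> i \<noteq> j \<Longrightarrow> j \<noteq> k \<Longrightarrow> i \<noteq> k \<Longrightarrow> order_mod (Tri t) (rot i j) (t k)"
  by (simp add: spherical_type_def has_type_def)

lemma order_mod_double:
  assumes "order_mod N x n" "even n" "x \<in> carrier Delta"
  shows "order_mod N (x [^]\<^bsub>Delta\<^esub> (2::nat)) (n div 2)"
  unfolding order_mod_def
proof
  fix e :: nat
  obtain q where q: "n = 2 * q" using assms(2) by (elim evenE)
  have "(x [^]\<^bsub>Delta\<^esub> (2::nat)) [^]\<^bsub>Delta\<^esub> e = x [^]\<^bsub>Delta\<^esub> (2 * e)"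
    using assms(3) by (simp add: Delta.nat_pow_pow)
  then show "(x [^]\<^bsub>Delta\<^esub> (2::nat)) [^]\<^bsub>Delta\<^esub> e \<in> N \<longleftrightarrow> n div 2 dvd e"
    using order_mod_dvd[OF assms(1), of "2 * e"] by (simp add: q)
qed

text \<open>A half-turn in \<open>Theta M\<close> and its conjugate by \<open>R\<^sub>0\<close> generate the whole group, provided they differ.\<close>

lemma Ups_V4_half_turns:
  assumes M: "M \<lhd> Delta" and sub: "Tri t \<subseteq> Theta M" and ord: "order (Ups t M) = 4"
    and u: "u \<in> Theta M" "order_mod (Tri t) u 2"
    and h: "group_hom Delta S h" "Tri t \<subseteq> kernel Delta S h" "h u \<noteq> h (Rgen I0 \<otimes>\<^bsub>Delta\<^esub> u \<otimes>\<^bsub>Delta\<^esub> Rgen I0)"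
  shows "Ups t M \<cong> V4"
proof -
  let ?v = "Rgen I0 \<otimes>\<^bsub>Delta\<^esub> u \<otimes>\<^bsub>Delta\<^esub> inv\<^bsub>Delta\<^esub> Rgen I0"
  have uc: "u \<in> carrier Delta" using u(1) by (simp add: Theta_def)
  have v: "?v \<in> Theta M" using normal_conj_iff[OF Theta_normal[OF M] Rgen_closed uc] u(1) by blast
  have vv: "?v \<otimes>\<^bsub>Delta\<^esub> ?v = Rgen I0 \<otimes>\<^bsub>Delta\<^esub> (u \<otimes>\<^bsub>Delta\<^esub> u) \<otimes>\<^bsub>Delta\<^esub> inv\<^bsub>Delta\<^esub> Rgen I0"
    using uc by (simp add: Delta.m_assoc)
  have uu: "u \<otimes>\<^bsub>Delta\<^esub> u \<in> Tri t" "u \<notin> Tri t"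
    using order_mod_dvd[OF u(2), of 2] order_mod_dvd[OF u(2), of 1] uc by (simp_all add: numeral_2_eq_2)
  have "?v \<otimes>\<^bsub>Delta\<^esub> ?v \<in> Tri t" "?v \<notin> Tri t"
    unfolding vv using uu uc
    by (simp_all only: normal_conj_iff[OF Tri_normal Rgen_closed] Delta.m_closed simp_thms)
  moreover have "u \<otimes>\<^bsub>Delta\<^esub> inv\<^bsub>Delta\<^esub> ?v \<notin> Tri t"
    using kernel_eq[OF h(1,2), of u ?v] uc h(3) by auto
  ultimately show ?thesis
    by (rule Ups_V4[OF M sub u(1) uu v _ _ _ ord])
qed

lemma Ups_V4_tetrahedron:
  assumes sub: "Tri (ty 2 3 3) \<subseteq> Theta (Tri (ty 1 6 6))" and ord: "order (Ups (ty 2 3 3) (Tri (ty 1 6 6))) = 4"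
  shows "Ups (ty 2 3 3) (Tri (ty 1 6 6)) \<cong> V4"
proof -
  have t: "spherical_type (ty 2 3 3)" using type_swap(1)[OF tetrahedron_type] by blast
  let ?f = "tet_perm \<circ> transpose I0 I1"
  have hf: "group_hom Delta (sym_group 4) (hom_of (sym_group 4) ?f)" "hom_of (sym_group 4) ?f (Rgen i) = ?f i" for i
    by (rule hom_of; simp add: sym_group_is_group sym_group_carrier sym_group_mult sym_group_one perm_square
        perm_permutes[simplified])+
  have ker: "Tri (ty 2 3 3) \<subseteq> kernel Delta (sym_group 4) (hom_of (sym_group 4) ?f)"
    by (rule Tri_kernel[OF hf(1)])
      (simp_all add: hom_rot[OF hf(1)] hf(2) sym_pow sym_group_one, (intro permutes_eqI4 permutes_funpow rot_permutes permutes_id; simp add: perm_eval)+)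
  have om: "order_mod (Tri (ty 2 3 3)) (rot I1 I2) 2"
    using type_order_mod[OF t, of I1 I2 I0] by simp
  have "hom_of (sym_group 4) ?f (rot I1 I2) 1 \<noteq> hom_of (sym_group 4) ?f (Rgen I0 \<otimes>\<^bsub>Delta\<^esub> rot I1 I2 \<otimes>\<^bsub>Delta\<^esub> Rgen I0) 1"
    by (simp add: hom_rot[OF hf(1)] hf(2) perm_eval)
  then have "hom_of (sym_group 4) ?f (rot I1 I2) \<noteq> hom_of (sym_group 4) ?f (Rgen I0 \<otimes>\<^bsub>Delta\<^esub> rot I1 I2 \<otimes>\<^bsub>Delta\<^esub> Rgen I0)"
    by metis
  then show ?thesis
    by (rule Ups_V4_half_turns[OF Tri_normal sub ord rot12_in_Theta om hf(1) ker])
qed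

lemma Ups_V4_cube:
  assumes sub: "Tri (ty 4 2 3) \<subseteq> Theta (Tri (ty 2 2 6))" and ord: "order (Ups (ty 4 2 3) (Tri (ty 2 2 6))) = 4"
  shows "Ups (ty 4 2 3) (Tri (ty 2 2 6)) \<cong> V4"
proof -
  have t: "spherical_type (ty 4 2 3)" using type_swap(2)[OF cube_type] by blast
  let ?f = "cube_perm \<circ> transpose I0 I2" and ?u = "rot I1 I2 [^]\<^bsub>Delta\<^esub> (2::nat)"
  have hf: "group_hom Delta (sym_group 4) (hom_of (sym_group 4) ?f)" "hom_of (sym_group 4) ?f (Rgen i) = ?f i" for i
    by (rule hom_of; simp add: sym_group_is_group sym_group_carrier sym_group_mult sym_group_one perm_square
        perm_permutes[simplified])+
  have ker: "Tri (ty 4 2 3) \<subseteq> kernel Delta (sym_group 4) (hom_of (sym_group 4) ?f)"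
    by (rule Tri_kernel[OF hf(1)])
      (simp_all add: hom_rot[OF hf(1)] hf(2) sym_pow sym_group_one, (intro permutes_eqI4 permutes_funpow rot_permutes permutes_id; simp add: perm_eval)+)
  have om: "order_mod (Tri (ty 4 2 3)) ?u 2"
    using order_mod_double[OF type_order_mod[OF t, of I1 I2 I0]] by simp
  have uT: "?u \<in> Theta (Tri (ty 2 2 6))"
    using rot_in_Theta(1)[of 2] relator_in_Tri[of I1 I2 I0 "ty 2 2 6"] by simp
  have hu: "hom_of (sym_group 4) ?f ?u = (?f I1 \<circ> ?f I2) ^^ 2"
    using group_hom.hom_nat_pow[OF hf(1), of "rot I1 I2" 2] by (simp add: hom_rot[OF hf(1)] hf(2) sym_pow)
  have "hom_of (sym_group 4) ?f ?u 1 \<noteq> hom_of (sym_group 4) ?f (Rgen I0 \<otimes>\<^bsub>Delta\<^esub> ?u \<otimes>\<^bsub>Delta\<^esub> Rgen I0) 1"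
    by (simp add: hom_rot[OF hf(1)] hf(2) hu perm_eval)
  then have "hom_of (sym_group 4) ?f ?u \<noteq> hom_of (sym_group 4) ?f (Rgen I0 \<otimes>\<^bsub>Delta\<^esub> ?u \<otimes>\<^bsub>Delta\<^esub> Rgen I0)"
    by metis
  then show ?thesis
    by (rule Ups_V4_half_turns[OF Tri_normal sub ord uT om hf(1) ker])
qed

lemma (in group) invert_pow:
  assumes "v \<in> carrier G" "w \<in> carrier G" "v \<otimes> v = \<one>" "v \<otimes> w \<otimes> v \<otimes> w = \<one>"
  shows "v \<otimes> w [^] (e::nat) \<otimes> v \<otimes> w [^] e = \<one>"
proof -
  have vv: "v \<otimes> (v \<otimes> x) = x" if "x \<in> carrier G" for x
    using assms that by (simp add: m_assoc[symmetric])
  have "v \<otimes> w \<otimes> v = inv w" using assms inv_equality[of "v \<otimes> w \<otimes> v" w] by simp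
  then have "v \<otimes> w [^] e \<otimes> v = inv w [^] e"
  proof (induction e)
    case (Suc e)
    have "v \<otimes> w [^] Suc e \<otimes> v = (v \<otimes> w [^] e \<otimes> v) \<otimes> (v \<otimes> w \<otimes> v)"
      using assms(1,2) vv by (simp add: m_assoc)
    then show ?case using Suc by simp
  qed (use assms in simp)
  then show ?thesis using assms(2) by (simp add: nat_pow_inv)
qed

lemma normal_invert_pow:
  assumes N: "N \<lhd> Delta" and vw: "v \<in> carrier Delta" "w \<in> carrier Delta"
    and "v \<otimes>\<^bsub>Delta\<^esub> v \<in> N" "v \<otimes>\<^bsub>Delta\<^esub> w \<otimes>\<^bsub>Delta\<^esub> v \<otimes>\<^bsub>Delta\<^esub> w \<in> N"
  shows "v \<otimes>\<^bsub>Delta\<^esub> w [^]\<^bsub>Delta\<^esub> (e::nat) \<otimes>\<^bsub>Delta\<^esub> v \<otimes>\<^bsub>Delta\<^esub> w [^]\<^bsub>Delta\<^esub> e \<in> N"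
proof -
  interpret q: group_hom Delta "Delta Mod N" "\<lambda>w. N #>\<^bsub>Delta\<^esub> w" by (rule Mod_hom[OF N])
  show ?thesis
    using q.H.invert_pow[of "N #>\<^bsub>Delta\<^esub> v" "N #>\<^bsub>Delta\<^esub> w" e] assms(4,5) vw
    by (simp add: normal_mem_iff[OF N] q.hom_nat_pow)
qed

text \<open>\<open>R\<^sub>1 R\<^sub>2\<close> is a half-turn of the prism that inverts the rotation \<open>R\<^sub>0 R\<^sub>1\<close>; how large a power of the
  latter lies in \<open>Theta M\<close> depends on the parity of \<open>n\<close>.\<close>

lemma Ups_dihedral_prism:
  assumes n: "n > 0" and M: "M \<lhd> Delta" and sub: "Tri (ty 2 2 n) \<subseteq> Theta M"
    and 12: "rot I1 I2 \<in> Theta M" and u: "rot I0 I1 [^]\<^bsub>Delta\<^esub> e \<in> Theta M"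
      "order_mod (Tri (ty 2 2 n)) (rot I0 I1 [^]\<^bsub>Delta\<^esub> (e::nat)) k"
    and ord: "order (Ups (ty 2 2 n) M) = 2 * k" "k > 0"
  shows "Ups (ty 2 2 n) M \<cong> dihedral k"
proof (rule Ups_dihedral[OF M sub u 12 _ _ _ _ _ ord])
  let ?N = "Tri (ty 2 2 n)" and ?P = "\<lambda>i. i = I2"
  have sq: "rot I1 I2 [^]\<^bsub>Delta\<^esub> (2::nat) \<in> ?N" "rot I2 I0 [^]\<^bsub>Delta\<^esub> (2::nat) \<in> ?N"
    using relator_in_Tri[of I1 I2 I0 "ty 2 2 n"] relator_in_Tri[of I2 I0 I1 "ty 2 2 n"] by simp_all
  then show v: "rot I1 I2 \<otimes>\<^bsub>Delta\<^esub> rot I1 I2 \<in> ?N" by (simp add: numeral_2_eq_2)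
  have "rot I1 I2 \<otimes>\<^bsub>Delta\<^esub> rot I0 I1 \<otimes>\<^bsub>Delta\<^esub> rot I1 I2 \<otimes>\<^bsub>Delta\<^esub> rot I0 I1
      = Rgen I1 \<otimes>\<^bsub>Delta\<^esub> rot I2 I0 [^]\<^bsub>Delta\<^esub> (2::nat) \<otimes>\<^bsub>Delta\<^esub> inv\<^bsub>Delta\<^esub> (Rgen I1)"
    by (simp add: Delta.m_assoc numeral_2_eq_2)
  then have "rot I1 I2 \<otimes>\<^bsub>Delta\<^esub> rot I0 I1 \<otimes>\<^bsub>Delta\<^esub> rot I1 I2 \<otimes>\<^bsub>Delta\<^esub> rot I0 I1 \<in> ?N"
    using Delta.normal_invE(2)[OF Tri_normal Rgen_closed sq(2)] by simp
  then show "rot I1 I2 \<otimes>\<^bsub>Delta\<^esub> rot I0 I1 [^]\<^bsub>Delta\<^esub> e \<otimes>\<^bsub>Delta\<^esub> rot I1 I2 \<otimes>\<^bsub>Delta\<^esub> rot I0 I1 [^]\<^bsub>Delta\<^esub> e \<in> ?N"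
    by (intro normal_invert_pow[OF Tri_normal rot_closed rot_closed v])
  show "?N \<subseteq> kernel Delta (cyclic 2) (sign_hom ?P)"
    by (rule Tri_kernel[OF sign_hom(1)]) (simp_all add: sign_hom_mult sign_hom)
  show "sign_hom ?P (rot I0 I1 [^]\<^bsub>Delta\<^esub> e) = 0"
    using group_hom.hom_nat_pow[OF sign_hom(1)[of ?P], of "rot I0 I1" e] by (simp add: sign_hom_mult sign_hom)
  show "sign_hom ?P (rot I1 I2) = 1"
    by (simp add: sign_hom_mult sign_hom)
qed

lemma Ups_dihedral_D02_prism:
  assumes n: "n > 0" and sub: "Tri (ty n 2 2) \<subseteq> Theta (Tri (ty 1 2 2))"
    and ord: "order (Ups (ty n 2 2) (Tri (ty 1 2 2))) = 2 * n"
  shows "Ups (ty n 2 2) (Tri (ty 1 2 2)) \<cong> dihedral n"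
proof (rule Ups_dihedral[OF Tri_normal sub rot12_in_Theta _ _ _ _ _ _ _ ord n])
  let ?N = "Tri (ty n 2 2)" and ?P = "\<lambda>i. i = I0"
  show "order_mod ?N (rot I1 I2) n"
    using type_order_mod[of "ty n 2 2" I1 I2 I0] D02_PP_type[OF n] by simp
  show "rot I0 I1 \<in> Theta (Tri (ty 1 2 2))" using rot01_in_Theta[of 2 1 1 2] by simp
  have sq: "rot I0 I1 [^]\<^bsub>Delta\<^esub> (2::nat) \<in> ?N" "rot I0 I2 [^]\<^bsub>Delta\<^esub> (2::nat) \<in> ?N"
    using relator_in_Tri[of I0 I1 I2 "ty n 2 2"] relator_in_Tri[of I0 I2 I1 "ty n 2 2"] by simp_all
  then show "rot I0 I1 \<otimes>\<^bsub>Delta\<^esub> rot I0 I1 \<in> ?N" by (simp add: numeral_2_eq_2)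
  show "rot I0 I1 \<otimes>\<^bsub>Delta\<^esub> rot I1 I2 \<otimes>\<^bsub>Delta\<^esub> rot I0 I1 \<otimes>\<^bsub>Delta\<^esub> rot I1 I2 \<in> ?N"
    using sq(2) by (simp add: numeral_2_eq_2 Delta.m_assoc)
  show "?N \<subseteq> kernel Delta (cyclic 2) (sign_hom ?P)"
    by (rule Tri_kernel[OF sign_hom(1)]) (simp_all add: sign_hom_mult sign_hom)
  show "sign_hom ?P (rot I1 I2) = 0" "sign_hom ?P (rot I0 I1) = 1"
    by (simp_all add: sign_hom_mult sign_hom)
qed

lemma Ups_dihedral_even:
  assumes n: "n > 0" "even n"
    and sub: "Tri (ty 2 2 n) \<subseteq> Theta (Tri (ty 1 4 4))" and ord: "order (Ups (ty 2 2 n) (Tri (ty 1 4 4))) = n"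
  shows "Ups (ty 2 2 n) (Tri (ty 1 4 4)) \<cong> dihedral (n div 2)"
proof (rule Ups_dihedral_prism[OF n(1) Tri_normal sub rot12_in_Theta])
  show "rot I0 I1 [^]\<^bsub>Delta\<^esub> (2::nat) \<in> Theta (Tri (ty 1 4 4))"
    by (rule rot01_in_Theta) simp
  have "order_mod (Tri (ty 2 2 n)) (rot I0 I1) n"
    using type_order_mod[OF prism_type(1)[OF n(1)], of I0 I1 I2] by simp
  then show "order_mod (Tri (ty 2 2 n)) (rot I0 I1 [^]\<^bsub>Delta\<^esub> (2::nat)) (n div 2)"
    using n(2) rot_closed by (rule order_mod_double)
qed (use n ord in \<open>auto elim!: evenE\<close>)

lemma Ups_dihedral_odd:
  assumes n: "n > 0"
    and sub: "Tri (ty 2 2 n) \<subseteq> Theta (Tri (ty 1 2 2))" and ord: "order (Ups (ty 2 2 n) (Tri (ty 1 2 2))) = 2 * n"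
  shows "Ups (ty 2 2 n) (Tri (ty 1 2 2)) \<cong> dihedral n"
proof (rule Ups_dihedral_prism[OF n Tri_normal sub rot12_in_Theta _ _ ord n])
  show "rot I0 I1 [^]\<^bsub>Delta\<^esub> (1::nat) \<in> Theta (Tri (ty 1 2 2))"
    by (rule rot01_in_Theta) simp
  show "order_mod (Tri (ty 2 2 n)) (rot I0 I1 [^]\<^bsub>Delta\<^esub> (1::nat)) n"
    using type_order_mod[OF prism_type(1)[OF n], of I0 I1 I2] by simp
qed

lemma Ups_cyclic_rot12:
  assumes t: "spherical_type (ty k m n)"
    and sub: "Tri (ty k m n) \<subseteq> Theta (Tri (ty 1 d d))" and ord: "order (Ups (ty k m n) (Tri (ty 1 d d))) = k"
  shows "Ups (ty k m n) (Tri (ty 1 d d)) \<cong> cyclic k"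
proof (rule Ups_cyclic[OF Tri_normal sub rot12_in_Theta _ ord])
  show "order_mod (Tri (ty k m n)) (rot I1 I2) k"
    using type_order_mod[OF t, of I1 I2 I0] by simp
  show "k > 0" using t unfolding spherical_type_def by (metis ty_simps(1))
qed

lemma Ups_cyclic_even:
  assumes n: "n > 0" "even n"
    and sub: "Tri (ty n 2 2) \<subseteq> Theta (Tri (ty 2 2 4))" and ord: "order (Ups (ty n 2 2) (Tri (ty 2 2 4))) = n div 2"
  shows "Ups (ty n 2 2) (Tri (ty 2 2 4)) \<cong> cyclic (n div 2)"
proof (rule Ups_cyclic[OF Tri_normal sub _ _ ord])
  show "rot I1 I2 [^]\<^bsub>Delta\<^esub> (2::nat) \<in> Theta (Tri (ty 2 2 4))"
    using rot_in_Theta(1)[of 2] relator_in_Tri[of I1 I2 I0 "ty 2 2 4"] by simp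
  have "order_mod (Tri (ty n 2 2)) (rot I1 I2) n"
    using type_order_mod[of "ty n 2 2" I1 I2 I0] D02_PP_type[OF n(1)] by simp
  then show "order_mod (Tri (ty n 2 2)) (rot I1 I2 [^]\<^bsub>Delta\<^esub> (2::nat)) (n div 2)"
    using n(2) rot_closed by (rule order_mod_double)
qed (use n in \<open>auto elim!: evenE\<close>)

theorem mainTheorem3:
  fixes n :: nat
  assumes "n \<ge> 1"
  shows
    "table_row (Pin (D02 (DD n))) (D02 (DD (2 * n))) (1, 2 * n, 2 * n)
       (4 * n) 0 1 trivial_grp \<and>
     (even n \<longrightarrow> table_row (Pin (PP n)) (D02 (DD 4)) (2, 4, 2 * n)
       (8 * n ^ 2) (((of_nat n - 1) ^ 2 + 1) / 2) n (dihedral (n div 2))) \<and>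
     (odd n \<longrightarrow> table_row (Pin (PP n)) (D02 (DD 2)) (2, 4, 2 * n)
       (16 * n ^ 2) ((of_nat n - 1) ^ 2) (2 * n) (dihedral n)) \<and>
     table_row (Pin (D01 Tetrahedron)) (D02 (DD 6)) (2, 6, 6) 192 9 4 V4 \<and>
     table_row (Pin (D01 Cube)) (D02 (DD 2)) (2, 6, 8) 2304 121 24 (sym_group 4) \<and>
     table_row (Pin (D01 Dodecahedron)) (D02 (DD 2)) (2, 6, 10) 14400 841 60 (alt_group 5) \<and>
     table_row (Pin Tetrahedron) (D02 (DD 2)) (3, 4, 6) 576 37 12 (alt_group 4) \<and>
     table_row (Pin Cube) (D02 (DD 4)) (3, 4, 8) 1152 85 12 (alt_group 4) \<and>
     table_row (Pin Dodecahedron) (D02 (DD 2)) (3, 4, 10) 14400 1141 60 (alt_group 5) \<and>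
     table_row (Pin (D02 Cube)) (D02 (DD 2)) (4, 4, 6) 2304 193 24 (sym_group 4) \<and>
     table_row (Pin (D02 Dodecahedron)) (D02 (DD 2)) (5, 4, 6) 14400 1381 60 (alt_group 5) \<and>
     table_row (Pin (D12 (DD n))) (D02 (DD 2)) (n, 2, 2 * n)
       (4 * n ^ 2) ((of_nat n - 1) * (of_nat n - 2) / 2) n (cyclic n) \<and>
     table_row (Pin (D02 (PP n))) (D02 (DD 4)) (n, 4, 4)
       (8 * n ^ 2) ((of_nat n - 1) ^ 2) n (cyclic n) \<and>
     table_row (Wal (PP n)) (PP (2 * n)) (2, 2, 2 * n) (8 * n) 0 1 trivial_grp \<and>
     table_row (Wal Tetrahedron) (D02 (DD 2)) (6, 2, 6) 576 25 12 (alt_group 4) \<and>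
     table_row (Wal Cube) (D02 (DD 2)) (6, 2, 8) 2304 121 24 (sym_group 4) \<and>
     table_row (Wal Dodecahedron) (D02 (DD 2)) (6, 2, 10) 14400 841 60 (alt_group 5) \<and>
     table_row (Wal (D02 Cube)) (PP 6) (4, 2, 6) 384 9 4 V4 \<and>
     table_row (Wal (D02 Dodecahedron)) (D02 (DD 2)) (10, 2, 6) 14400 841 60 (alt_group 5) \<and>
     (even n \<longrightarrow> table_row (Wal (D02 (PP n))) (PP 4) (n, 2, 4)
       (4 * n ^ 2) ((of_nat n - 2) ^ 2 / 4) (n div 2) (cyclic (n div 2))) \<and>
     (odd n \<longrightarrow> table_row (Wal (D02 (PP n))) (D02 (DD 2)) (2 * n, 2, 4)
       (16 * n ^ 2) ((of_nat n - 1) ^ 2) (2 * n) (dihedral n)) \<and>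
     table_row (Wal (D12 Tetrahedron)) Cube (3, 2, 4) 48 0 1 trivial_grp \<and>
     table_row (Wal (D12 Cube)) (D02 (DD 2)) (12, 2, 4) 2304 97 24 (sym_group 4) \<and>
     table_row (Wal (D12 Dodecahedron)) (D02 (DD 2)) (15, 2, 4) 14400 661 60 (alt_group 5) \<and>
     table_row (Wal (DD n)) (D02 (PP n)) (n, 2, 2) (4 * n) 0 1 trivial_grp"
proof (intro conjI impI)
  have n: "n > 0" and n2: "2 * n > 0" using assms by simp_all
  note swT = type_swap[OF tetrahedron_type] and swC = type_swap[OF cube_type] and swD = type_swap[OF dodecahedron_type]
  \<comment> \<open>the closure cover of \<open>Wal\<close> whenever the first two entries of the type are coprime\<close>
  have T4: "index (Tri (ty 1 2 2)) = 4" using dihedron_type(2)[of 2] by simp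
  have id: "ty l m n = ty l m n \<circ> (\<lambda>i. i)" for l m n by (simp add: o_def)
  note S4 = Ups_S4[OF _ id] Ups_S4[OF transpose_twice ty_transpose(1)[symmetric]]
    Ups_S4[OF transpose_twice ty_transpose(2)[symmetric]] Ups_S4[OF transpose_twice ty_transpose(3)[symmetric]]
  note A5 = Ups_A5[OF _ id] Ups_A5[OF transpose_twice ty_transpose(1)[symmetric]]
    Ups_A5[OF transpose_twice ty_transpose(2)[symmetric]] Ups_A5[OF transpose_twice ty_transpose(3)[symmetric]]
  note DDT = conjunct1[OF DD_type[OF n]] conjunct2[OF DD_type[OF n]]
  note PPT = conjunct1[OF D02_PP_type[OF n]] conjunct2[OF D02_PP_type[OF n]]
  \<comment> \<open>the type \<open>(n; 1; n)\<close>\<close>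
  note DnT = type_swap(1)[OF dihedron_type[OF n]]
  note D02_2 = iso_D02_DD[of 2, OF zero_less_numeral] and D02_4 = iso_D02_DD[of 4, OF zero_less_numeral] and D02_6 = iso_D02_DD[of 6, OF zero_less_numeral]
  show "table_row (Pin (D02 (DD n))) (D02 (DD (2 * n))) (1, 2 * n, 2 * n)
       (4 * n) 0 1 trivial_grp"
    by (rule Pin_row[OF hsub_Dop(2)[OF hsub_DD[OF n]] dihedron_type[OF n] iso_D02_DD[OF n2]], erule (1) Ups_trivial[OF Tri_normal]) (use n in \<open>simp_all add: field_simps\<close>)
  show "table_row (Pin (PP n)) (D02 (DD 4)) (2, 4, 2 * n)
       (8 * n ^ 2) (((of_nat n - 1) ^ 2 + 1) / 2) n (dihedral (n div 2))" if even: "even n"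
    by (rule Pin_row[OF hsub_PP[OF n] prism_type[OF n] D02_4], erule (1) Ups_dihedral_even[OF n even]) (use n even in \<open>simp_all add: field_simps power2_eq_square gcd_nat.absorb1\<close>)
  show "table_row (Pin (PP n)) (D02 (DD 2)) (2, 4, 2 * n)
       (16 * n ^ 2) ((of_nat n - 1) ^ 2) (2 * n) (dihedral n)" if odd: "odd n"
    by (rule Pin_row[OF hsub_PP[OF n] prism_type[OF n] D02_2], erule (1) Ups_dihedral_odd[OF n]) (use n odd in \<open>simp_all add: field_simps power2_eq_square coprime_imp_gcd_eq_1\<close>)
  show "table_row (Pin (D01 Tetrahedron)) (D02 (DD 6)) (2, 6, 6) 192 9 4 V4"
    by (rule Pin_row[OF hsub_Dop(1)[OF hsub_platonic(1)] conjunct1[OF swT(1)] conjunct2[OF swT(1)] D02_6], erule (1) Ups_V4_tetrahedron, simp_all add: gcd_non_0_nat lcm_nat_def)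
  show "table_row (Pin (D01 Cube)) (D02 (DD 2)) (2, 6, 8) 2304 121 24 (sym_group 4)"
    by (rule Pin_row[OF hsub_Dop(1)[OF hsub_platonic(2)] conjunct1[OF swC(1)] conjunct2[OF swC(1)] D02_2], erule (1) S4(2), simp_all add: gcd_non_0_nat lcm_nat_def)
  show "table_row (Pin (D01 Dodecahedron)) (D02 (DD 2)) (2, 6, 10) 14400 841 60 (alt_group 5)"
    by (rule Pin_row[OF hsub_Dop(1)[OF hsub_platonic(3)] conjunct1[OF swD(1)] conjunct2[OF swD(1)] D02_2], erule (1) A5(2), simp_all add: gcd_non_0_nat lcm_nat_def)
  show "table_row (Pin Tetrahedron) (D02 (DD 2)) (3, 4, 6) 576 37 12 (alt_group 4)"
    by (rule Pin_row[OF hsub_platonic(1) tetrahedron_type D02_2], erule (1) Ups_A4, simp_all add: gcd_non_0_nat lcm_nat_def)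
  show "table_row (Pin Cube) (D02 (DD 4)) (3, 4, 8) 1152 85 12 (alt_group 4)"
    by (rule Pin_row[OF hsub_platonic(2) cube_type D02_4], erule (1) Ups_A4_cube, simp_all add: gcd_non_0_nat lcm_nat_def)
  show "table_row (Pin Dodecahedron) (D02 (DD 2)) (3, 4, 10) 14400 1141 60 (alt_group 5)"
    by (rule Pin_row[OF hsub_platonic(3) dodecahedron_type D02_2], rule A5(1), simp_all add: gcd_non_0_nat lcm_nat_def)
  show "table_row (Pin (D02 Cube)) (D02 (DD 2)) (4, 4, 6) 2304 193 24 (sym_group 4)"
    by (rule Pin_row[OF hsub_Dop(2)[OF hsub_platonic(2)] conjunct1[OF swC(2)] conjunct2[OF swC(2)] D02_2], erule (1) S4(3), simp_all add: gcd_non_0_nat lcm_nat_def)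
  show "table_row (Pin (D02 Dodecahedron)) (D02 (DD 2)) (5, 4, 6) 14400 1381 60 (alt_group 5)"
    by (rule Pin_row[OF hsub_Dop(2)[OF hsub_platonic(3)] conjunct1[OF swD(2)] conjunct2[OF swD(2)] D02_2], erule (1) A5(3), simp_all add: gcd_non_0_nat lcm_nat_def)
  show "table_row (Pin (D12 (DD n))) (D02 (DD 2)) (n, 2, 2 * n)
       (4 * n ^ 2) ((of_nat n - 1) * (of_nat n - 2) / 2) n (cyclic n)"
    by (rule Pin_row[OF hsub_Dop(3)[OF hsub_DD[OF n]] conjunct1[OF DnT] conjunct2[OF DnT] D02_2], erule (1) Ups_cyclic_rot12[OF conjunct1[OF DnT]]) (use n in \<open>simp_all add: field_simps power2_eq_square\<close>)
  show "table_row (Pin (D02 (PP n))) (D02 (DD 4)) (n, 4, 4)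
       (8 * n ^ 2) ((of_nat n - 1) ^ 2) n (cyclic n)"
    by (rule Pin_row[OF hsub_Dop(2)[OF hsub_PP[OF n]] PPT D02_4], erule (1) Ups_cyclic_rot12[OF PPT(1)]) (use n in \<open>simp_all add: field_simps power2_eq_square\<close>)
  show "table_row (Wal (PP n)) (PP (2 * n)) (2, 2, 2 * n) (8 * n) 0 1 trivial_grp"
    by (rule Wal_row[OF hsub_PP[OF n] prism_type[OF n] prism_type(2)[OF n2] iso_PP[OF n2]], erule (1) Ups_trivial[OF Tri_normal])
      (use n in \<open>simp_all add: field_simps\<close>)
  show "table_row (Wal Tetrahedron) (D02 (DD 2)) (6, 2, 6) 576 25 12 (alt_group 4)"
    by (rule Wal_row[OF hsub_platonic(1) tetrahedron_type T4 D02_2], erule (1) Ups_A4, simp_all add: gcd_non_0_nat lcm_nat_def)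
  show "table_row (Wal Cube) (D02 (DD 2)) (6, 2, 8) 2304 121 24 (sym_group 4)"
    by (rule Wal_row[OF hsub_platonic(2) cube_type T4 D02_2], rule S4(1), simp_all add: gcd_non_0_nat lcm_nat_def)
  show "table_row (Wal Dodecahedron) (D02 (DD 2)) (6, 2, 10) 14400 841 60 (alt_group 5)"
    by (rule Wal_row[OF hsub_platonic(3) dodecahedron_type T4 D02_2], rule A5(1), simp_all add: gcd_non_0_nat lcm_nat_def)
  show "table_row (Wal (D02 Cube)) (PP 6) (4, 2, 6) 384 9 4 V4"
    by (rule Wal_row[OF hsub_Dop(2)[OF hsub_platonic(2)] conjunct1[OF swC(2)] conjunct2[OF swC(2)] prism_type(2)[of 6, OF zero_less_numeral] iso_PP[of 6, OF zero_less_numeral]], erule (1) Ups_V4_cube, simp_all add: gcd_non_0_nat lcm_nat_def)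
  show "table_row (Wal (D02 Dodecahedron)) (D02 (DD 2)) (10, 2, 6) 14400 841 60 (alt_group 5)"
    by (rule Wal_row[OF hsub_Dop(2)[OF hsub_platonic(3)] conjunct1[OF swD(2)] conjunct2[OF swD(2)] T4 D02_2], erule (1) A5(3), simp_all add: gcd_non_0_nat lcm_nat_def)
  show "table_row (Wal (D02 (PP n))) (PP 4) (n, 2, 4)
       (4 * n ^ 2) ((of_nat n - 2) ^ 2 / 4) (n div 2) (cyclic (n div 2))" if even: "even n"
    by (rule Wal_row[OF hsub_Dop(2)[OF hsub_PP[OF n]] PPT prism_type(2)[of 4, OF zero_less_numeral] iso_PP[of 4, OF zero_less_numeral]], erule (1) Ups_cyclic_even[OF n even])
      (use n even in \<open>auto elim!: evenE simp: field_simps power2_eq_square\<close>)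
  show "table_row (Wal (D02 (PP n))) (D02 (DD 2)) (2 * n, 2, 4)
       (16 * n ^ 2) ((of_nat n - 1) ^ 2) (2 * n) (dihedral n)" if odd: "odd n"
    by (rule Wal_row[OF hsub_Dop(2)[OF hsub_PP[OF n]] PPT T4 D02_2], erule (1) Ups_dihedral_D02_prism[OF n])
      (use n odd lcm_coprime[of n 2] in \<open>simp_all add: field_simps power2_eq_square\<close>)
  show "table_row (Wal (D12 Tetrahedron)) Cube (3, 2, 4) 48 0 1 trivial_grp"
    by (rule Wal_row[OF hsub_Dop(3)[OF hsub_platonic(1)] conjunct1[OF swT(3)] conjunct2[OF swT(3)] cube_type(2) iso_Cube], erule (1) Ups_trivial[OF Tri_normal], simp_all add: gcd_non_0_nat lcm_nat_def)
  show "table_row (Wal (D12 Cube)) (D02 (DD 2)) (12, 2, 4) 2304 97 24 (sym_group 4)"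
    by (rule Wal_row[OF hsub_Dop(3)[OF hsub_platonic(2)] conjunct1[OF swC(3)] conjunct2[OF swC(3)] T4 D02_2], erule (1) S4(4), simp_all add: gcd_non_0_nat lcm_nat_def)
  show "table_row (Wal (D12 Dodecahedron)) (D02 (DD 2)) (15, 2, 4) 14400 661 60 (alt_group 5)"
    by (rule Wal_row[OF hsub_Dop(3)[OF hsub_platonic(3)] conjunct1[OF swD(3)] conjunct2[OF swD(3)] T4 D02_2], erule (1) A5(4), simp_all add: gcd_non_0_nat lcm_nat_def)
  show "table_row (Wal (DD n)) (D02 (PP n)) (n, 2, 2) (4 * n) 0 1 trivial_grp"
    by (rule Wal_row[OF hsub_DD[OF n] DDT PPT(2) iso_D02[OF hsub_PP[OF n]]], erule (1) Ups_trivial[OF Tri_normal])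
      (use n in \<open>simp_all add: field_simps\<close>)
qed

end
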